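(* Let $M$ be a compact connected manifold, ${\mathscr F}$ a coherent ${\mathscr A}$-module on $M$, $\nabla$ a connection on ${\mathscr F}$, and ${\mathcal E}\in{\rm Hom}_{\mathscr A}({\mathscr F},{\mathscr A}^1\otimes_{\mathscr A}{\mathscr F})$. The curvature of the connection $\hat\nabla=\nabla+{\mathcal E}$ is $${\mathcal K}_{\hat\nabla}={\mathcal K}_\nabla+\nabla^1\circ{\mathcal E}+{\mathcal E}^1\circ\nabla+{\mathcal E}^1\circ{\mathcal E}.$$
   Context: ${\mathscr A}$ is the sheaf of differentiable functions and ${\mathscr A}^k$ the sheaf of differential $k$-forms on $M$. A connection on ${\mathscr F}$ is a morphism of abelian sheaves $\nabla:{\mathscr F}\to{\mathscr A}^1\otimes_{\mathscr A}{\mathscr F}$ with $\nabla(g\sigma)=dg\otimes\sigma+g\nabla\sigma$. It extends to $\nabla^k:{\mathscr A}^k\otimes_{\mathscr A}{\mathscr F}\to{\mathscr A}^{k+1}\otimes_{\mathscr A}{\mathscr F}$ by $\nabla^k(\beta\otimes\sigma)=d\beta\otimes\sigma+(-1)^k\beta\wedge\nabla\sigma$, where $\beta\wedge\nabla\sigma={\mathcal N}(\beta\otimes\nabla\sigma)$ and ${\mathcal N}:{\mathscr A}^k\otimes_{\mathscr A}({\mathscr A}^1\otimes_{\mathscr A}{\mathscr F})\to{\mathscr A}^{k+1}\otimes_{\mathscr A}{\mathscr F}$ is the natural (wedge product) morphism. The curvature is ${\mathcal K}_\nabla:=\nabla^1\circ\nabla:{\mathscr F}\to{\mathscr A}^2\otimes_{\mathscr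 A}{\mathscr F}$. The morphism ${\mathcal E}$ induces ${\mathcal E}^k:{\mathscr A}^k\otimes_{\mathscr A}{\mathscr F}\to{\mathscr A}^{k+1}\otimes_{\mathscr A}{\mathscr F}$, $\alpha\otimes\sigma\mapsto{\mathcal N}(\alpha\otimes(-1)^k{\mathcal E}(\sigma))$. *)

theory Defs
  imports
    "HOL-Analysis.Analysis"
    "HOL-Combinatorics.Permutations"
    "HOL-Algebra.Module"
    "HOL-Algebra.Free_Abelian_Groups"
begin

section \<open>Smooth manifolds and their smooth functions\<close>

primrec C_on :: "nat \<Rightarrow> 'e::real_normed_vector set \<Rightarrow> ('e \<Rightarrow> 'b::real_normed_vector) \<Rightarrow> bool" where
  "C_on 0 S g \<longleftrightarrow> continuous_on S g"
| "C_on (Suc k) S g \<longleftrightarrow>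
     (\<forall>x\<in>S. g differentiable (at x)) \<and> (\<forall>v. C_on k S (\<lambda>x. frechet_derivative g (at x) v))"

definition smooth_on :: "'e::real_normed_vector set \<Rightarrow> ('e \<Rightarrow> 'b::real_normed_vector) \<Rightarrow> bool" where
  "smooth_on S g \<longleftrightarrow> (\<forall>k. C_on k S g)"

text \<open>
  The manifold is the whole type \<open>'p\<close>; the Hausdorff and second countability axioms are
  imposed by the sort of \<open>'p\<close>.  A chart is a pair of a domain and a map into the model space.
  The model space is an arbitrary finite-dimensional normed space instead of a
  \<open>euclidean_space\<close>, because the latter class excludes dimension 0.
\<close>

type_synonym ('p, 'e) atlas = "('p set \<times> ('p \<Rightarrow> 'e)) set"

definition smooth_manifold ::
  "('p::{second_countable_topology, t2_space}, 'e::real_normed_vector) atlas \<Rightarrow> bool" where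
  "smooth_manifold \<A> \<longleftrightarrow>
     (\<exists>B::'e set. finite B \<and> span B = UNIV) \<and>
     (\<Union>(U, \<phi>)\<in>\<A>. U) = UNIV \<and>
     (\<forall>(U, \<phi>)\<in>\<A>. open U \<and> open (\<phi> ` U) \<and> homeomorphism U (\<phi> ` U) \<phi> (inv_into U \<phi>)) \<and>
     (\<forall>(U, \<phi>)\<in>\<A>. \<forall>(V, \<psi>)\<in>\<A>. smooth_on (\<phi> ` (U \<inter> V)) (\<psi> \<circ> inv_into U \<phi>))"

text \<open>
  Sections over \<open>U\<close> of sheaves of functions are total functions vanishing outside \<open>U\<close>;
  \<open>cut V\<close> is the restriction map to \<open>V\<close>.  Up to isomorphism the only instances of
  \<open>real_normed_field\<close> are the real and the complex numbers, so real-valued and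
  complex-valued functions and forms are treated simultaneously.
\<close>

definition cut :: "'p set \<Rightarrow> ('p \<Rightarrow> 'k::zero) \<Rightarrow> 'p \<Rightarrow> 'k" where
  "cut V f = (\<lambda>x. if x \<in> V then f x else 0)"

definition smooth_functions ::
  "('p, 'e::real_normed_vector) atlas \<Rightarrow> 'p set \<Rightarrow> ('p \<Rightarrow> 'k::real_normed_field) set" where
  "smooth_functions \<A> U =
     {f. (\<forall>x. x \<notin> U \<longrightarrow> f x = 0) \<and>
         (\<forall>(V, \<phi>)\<in>\<A>. smooth_on (\<phi> ` (U \<inter> V)) (f \<circ> inv_into V \<phi>))}"

text \<open>In the rest of this theory \<open>A\<close> stands for such a sheaf of functions.\<close>

definition function_ring :: "('p set \<Rightarrow> ('p \<Rightarrow> 'k::field) set) \<Rightarrow> 'p set \<Rightarrow> ('p \<Rightarrow> 'k) ring" where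
  "function_ring A U =
     \<lparr>carrier = A U, monoid.mult = (\<lambda>f g x. f x * g x), monoid.one = (\<lambda>x. if x \<in> U then 1 else 0),
      ring.zero = (\<lambda>x. 0), ring.add = (\<lambda>f g x. f x + g x)\<rparr>"

section \<open>Sheaves of modules\<close>

record ('p, 'r, 's) module_presheaf =
  sect :: "'p set \<Rightarrow> ('r, 's) module"
  res :: "'p set \<Rightarrow> 'p set \<Rightarrow> 's \<Rightarrow> 's"

definition presheaf_of_modules ::
  "('p::topological_space set \<Rightarrow> ('p \<Rightarrow> 'k::field) set) \<Rightarrow> ('p, 'p \<Rightarrow> 'k, 's) module_presheaf \<Rightarrow> bool"
  where
  "presheaf_of_modules A F \<longleftrightarrow>
     (\<forall>U. open U \<longrightarrow> Module.module (function_ring A U) (sect F U)) \<and>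
     (\<forall>U. open U \<longrightarrow> (\<forall>s\<in>carrier (sect F U). res F U U s = s)) \<and>
     (\<forall>U V. open U \<longrightarrow> open V \<longrightarrow> V \<subseteq> U \<longrightarrow>
        res F U V \<in> carrier (sect F U) \<rightarrow> carrier (sect F V) \<and>
        (\<forall>s\<in>carrier (sect F U). \<forall>t\<in>carrier (sect F U).
           res F U V (s \<oplus>\<^bsub>sect F U\<^esub> t) = res F U V s \<oplus>\<^bsub>sect F V\<^esub> res F U V t) \<and>
        (\<forall>g\<in>A U. \<forall>s\<in>carrier (sect F U).
           res F U V (g \<odot>\<^bsub>sect F U\<^esub> s) = cut V g \<odot>\<^bsub>sect F V\<^esub> res F U V s)) \<and>
     (\<forall>U V W. open U \<longrightarrow> open V \<longrightarrow> open W \<longrightarrow> W \<subseteq> V \<longrightarrow> V \<subseteq> U \<longrightarrow>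
        (\<forall>s\<in>carrier (sect F U). res F V W (res F U V s) = res F U W s))"

definition sheaf_of_modules ::
  "('p::topological_space set \<Rightarrow> ('p \<Rightarrow> 'k::field) set) \<Rightarrow> ('p, 'p \<Rightarrow> 'k, 's) module_presheaf \<Rightarrow> bool"
  where
  "sheaf_of_modules A F \<longleftrightarrow>
     presheaf_of_modules A F \<and>
     (\<forall>\<U>. (\<forall>U\<in>\<U>. open U) \<longrightarrow>
        (\<forall>s\<in>carrier (sect F (\<Union>\<U>)). \<forall>t\<in>carrier (sect F (\<Union>\<U>)).
           (\<forall>U\<in>\<U>. res F (\<Union>\<U>) U s = res F (\<Union>\<U>) U t) \<longrightarrow> s = t) \<and>
        (\<forall>s. (\<forall>U\<in>\<U>. s U \<in> carrier (sect F U)) \<and>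
             (\<forall>U\<in>\<U>. \<forall>V\<in>\<U>. res F U (U \<inter> V) (s U) = res F V (U \<inter> V) (s V)) \<longrightarrow>
           (\<exists>t\<in>carrier (sect F (\<Union>\<U>)). \<forall>U\<in>\<U>. res F (\<Union>\<U>) U t = s U)))"

text \<open>
  Morphisms of abelian sheaves and \<open>A\<close>-linear morphisms.  Their components are extensional
  (and trivial at sets that are not open), so that equality of morphisms is equality in HOL.
\<close>

definition additive_morphisms ::
  "('p::topological_space, 'r, 's) module_presheaf \<Rightarrow> ('p, 'r, 't) module_presheaf
     \<Rightarrow> ('p set \<Rightarrow> 's \<Rightarrow> 't) set" where
  "additive_morphisms F G =
     {\<phi>. (\<forall>U. \<phi> U \<in> (if open U then carrier (sect F U) else {}) \<rightarrow>\<^sub>E carrier (sect G U)) \<and>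
         (\<forall>U. open U \<longrightarrow> (\<forall>s\<in>carrier (sect F U). \<forall>t\<in>carrier (sect F U).
            \<phi> U (s \<oplus>\<^bsub>sect F U\<^esub> t) = \<phi> U s \<oplus>\<^bsub>sect G U\<^esub> \<phi> U t)) \<and>
         (\<forall>U V. open U \<longrightarrow> open V \<longrightarrow> V \<subseteq> U \<longrightarrow>
            (\<forall>s\<in>carrier (sect F U). \<phi> V (res F U V s) = res G U V (\<phi> U s)))}"

definition linear_morphisms ::
  "('p::topological_space set \<Rightarrow> ('p \<Rightarrow> 'k) set) \<Rightarrow>
     ('p, 'p \<Rightarrow> 'k, 's) module_presheaf \<Rightarrow> ('p, 'p \<Rightarrow> 'k, 't) module_presheaf
     \<Rightarrow> ('p set \<Rightarrow> 's \<Rightarrow> 't) set" where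
  "linear_morphisms A F G =
     {\<phi> \<in> additive_morphisms F G.
        \<forall>U. open U \<longrightarrow> (\<forall>g\<in>A U. \<forall>s\<in>carrier (sect F U).
          \<phi> U (g \<odot>\<^bsub>sect F U\<^esub> s) = g \<odot>\<^bsub>sect G U\<^esub> \<phi> U s)}"

definition hom_add ::
  "('p::topological_space, 'r, 's) module_presheaf \<Rightarrow> ('p, 'r, 't) module_presheaf
     \<Rightarrow> ('p set \<Rightarrow> 's \<Rightarrow> 't) \<Rightarrow> ('p set \<Rightarrow> 's \<Rightarrow> 't) \<Rightarrow> 'p set \<Rightarrow> 's \<Rightarrow> 't" where
  "hom_add F G \<phi> \<psi> U =
     (\<lambda>s \<in> (if open U then carrier (sect F U) else {}). \<phi> U s \<oplus>\<^bsub>sect G U\<^esub> \<psi> U s)"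

definition hom_comp ::
  "('p::topological_space, 'r, 's) module_presheaf
     \<Rightarrow> ('p set \<Rightarrow> 't \<Rightarrow> 'u) \<Rightarrow> ('p set \<Rightarrow> 's \<Rightarrow> 't) \<Rightarrow> 'p set \<Rightarrow> 's \<Rightarrow> 'u" where
  "hom_comp F \<psi> \<phi> U = compose (if open U then carrier (sect F U) else {}) (\<psi> U) (\<phi> U)"

section \<open>Coherence\<close>

text \<open>
  A family \<open>s\<^sub>0, \<dots>, s\<^sub>n\<^sub>-\<^sub>1\<close> of sections over \<open>U\<close> is the same as a morphism from \<open>A\<^sup>n\<close> to \<open>F\<close>
  over \<open>U\<close>.  It \<open>generates\<close> if this morphism is an epimorphism of sheaves;
  \<open>relations\<close> is its kernel.
\<close>

definition generates ::
  "('p::topological_space set \<Rightarrow> ('p \<Rightarrow> 'k) set) \<Rightarrow> ('p, 'p \<Rightarrow> 'k, 's) module_presheaf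
     \<Rightarrow> 'p set \<Rightarrow> nat \<Rightarrow> (nat \<Rightarrow> 's) \<Rightarrow> bool" where
  "generates A F U n s \<longleftrightarrow>
     s \<in> {..<n} \<rightarrow> carrier (sect F U) \<and>
     (\<forall>V t. open V \<longrightarrow> V \<subseteq> U \<longrightarrow> t \<in> carrier (sect F V) \<longrightarrow>
        (\<forall>x\<in>V. \<exists>W. open W \<and> x \<in> W \<and> W \<subseteq> V \<and>
           (\<exists>g \<in> {..<n} \<rightarrow> A W. res F V W t =
              (\<Oplus>\<^bsub>sect F W\<^esub>i\<in>{..<n}. g i \<odot>\<^bsub>sect F W\<^esub> res F U W (s i)))))"

definition relations ::
  "('p::topological_space set \<Rightarrow> ('p \<Rightarrow> 'k) set) \<Rightarrow> ('p, 'p \<Rightarrow> 'k, 's) module_presheaf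
     \<Rightarrow> 'p set \<Rightarrow> nat \<Rightarrow> (nat \<Rightarrow> 's) \<Rightarrow> 'p set \<Rightarrow> (nat \<Rightarrow> 'p \<Rightarrow> 'k) set" where
  "relations A F U n s V =
     {g \<in> {..<n} \<rightarrow> A V.
        (\<Oplus>\<^bsub>sect F V\<^esub>i\<in>{..<n}. g i \<odot>\<^bsub>sect F V\<^esub> res F U V (s i)) = \<zero>\<^bsub>sect F V\<^esub>}"

definition relations_generated ::
  "('p::topological_space set \<Rightarrow> ('p \<Rightarrow> 'k::field) set) \<Rightarrow> ('p, 'p \<Rightarrow> 'k, 's) module_presheaf
     \<Rightarrow> 'p set \<Rightarrow> nat \<Rightarrow> (nat \<Rightarrow> 's) \<Rightarrow> 'p set \<Rightarrow> nat \<Rightarrow> (nat \<Rightarrow> nat \<Rightarrow> 'p \<Rightarrow> 'k) \<Rightarrow> bool" where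
  "relations_generated A F U n s U' m r \<longleftrightarrow>
     r \<in> {..<m} \<rightarrow> relations A F U n s U' \<and>
     (\<forall>V g. open V \<longrightarrow> V \<subseteq> U' \<longrightarrow> g \<in> relations A F U n s V \<longrightarrow>
        (\<forall>x\<in>V. \<exists>W. open W \<and> x \<in> W \<and> W \<subseteq> V \<and>
           (\<exists>h \<in> {..<m} \<rightarrow> A W. \<forall>i<n.
              cut W (g i) = (\<lambda>y. \<Sum>j<m. h j y * cut W (r j i) y))))"

text \<open>
  The sheaf of smooth functions is not coherent over itself in the sense of analytic or
  algebraic geometry (\<open>strictly_coherent\<close> below), and in positive dimension locally free
  sheaves of positive finite rank are not coherent in that sense either.  A coherent
  module over smooth functions is therefore understood as one that has finite presentations
  \<open>A\<^sup>m \<rightarrow> A\<^sup>n \<rightarrow> F \<rightarrow> 0\<close> locally.  This is the weaker condition: see \<open>coherent_if_strictly_coherent\<close>.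
\<close>

definition coherent ::
  "('p::topological_space set \<Rightarrow> ('p \<Rightarrow> 'k::field) set) \<Rightarrow> ('p, 'p \<Rightarrow> 'k, 's) module_presheaf \<Rightarrow> bool"
  where
  "coherent A F \<longleftrightarrow>
     (\<forall>x. \<exists>U n s m r. open U \<and> x \<in> U \<and> generates A F U n s \<and> relations_generated A F U n s U m r)"

definition strictly_coherent ::
  "('p::topological_space set \<Rightarrow> ('p \<Rightarrow> 'k::field) set) \<Rightarrow> ('p, 'p \<Rightarrow> 'k, 's) module_presheaf \<Rightarrow> bool"
  where
  "strictly_coherent A F \<longleftrightarrow>
     (\<forall>x. \<exists>U n s. open U \<and> x \<in> U \<and> generates A F U n s) \<and>
     (\<forall>U n s. open U \<longrightarrow> s \<in> {..<n} \<rightarrow> carrier (sect F U) \<longrightarrow>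
        (\<forall>x\<in>U. \<exists>V m r. open V \<and> x \<in> V \<and> V \<subseteq> U \<and> relations_generated A F U n s V m r))"

lemma finsum_res_res:
  assumes F: "presheaf_of_modules A F" and op: "open U" "open V" "open W" "W \<subseteq> V" "V \<subseteq> U"
    and s: "s \<in> {..<n} \<rightarrow> carrier (sect F U)" and g: "g \<in> {..<n} \<rightarrow> A W"
  shows "(\<Oplus>\<^bsub>sect F W\<^esub>i\<in>{..<n}. g i \<odot>\<^bsub>sect F W\<^esub> res F V W (res F U V (s i))) =
         (\<Oplus>\<^bsub>sect F W\<^esub>i\<in>{..<n}. g i \<odot>\<^bsub>sect F W\<^esub> res F U W (s i))"
proof -
  interpret Module.module "function_ring A W" "sect F W"
    using F op unfolding presheaf_of_modules_def by simp
  have s': "s i \<in> carrier (sect F U)" if "i < n" for i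
    using s that by auto
  have eq: "res F V W (res F U V (s i)) = res F U W (s i)" if "i < n" for i
    using F op s'[OF that] unfolding presheaf_of_modules_def by simp
  have "W \<subseteq> U" using op by simp
  then have "res F U W \<in> carrier (sect F U) \<rightarrow> carrier (sect F W)"
    using F op(1,3) unfolding presheaf_of_modules_def by simp
  then have "res F U W (s i) \<in> carrier (sect F W)" if "i < n" for i
    using s'[OF that] by auto
  moreover have "g i \<in> carrier (function_ring A W)" if "i < n" for i
    using g that by (auto simp: function_ring_def)
  ultimately show ?thesis
    by (intro M.finsum_cong') (auto simp: eq)
qed

lemma coherent_if_strictly_coherent:
  assumes F: "presheaf_of_modules A F" and "strictly_coherent A F"
  shows "coherent A F"
  unfolding coherent_def
proof
  fix x
  obtain U n s where U: "open U" "x \<in> U" and gen: "generates A F U n s"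
    using assms(2) unfolding strictly_coherent_def by blast
  have s: "s \<in> {..<n} \<rightarrow> carrier (sect F U)"
    using gen unfolding generates_def by blast
  obtain V m r where V: "open V" "x \<in> V" "V \<subseteq> U" and rel: "relations_generated A F U n s V m r"
    using assms(2) U s unfolding strictly_coherent_def by blast
  define s' where "s' = (\<lambda>i. res F U V (s i))"
  have sum: "(\<Oplus>\<^bsub>sect F W\<^esub>i\<in>{..<n}. g i \<odot>\<^bsub>sect F W\<^esub> res F V W (s' i)) =
      (\<Oplus>\<^bsub>sect F W\<^esub>i\<in>{..<n}. g i \<odot>\<^bsub>sect F W\<^esub> res F U W (s i))"
    if "open W" "W \<subseteq> V" "g \<in> {..<n} \<rightarrow> A W" for W g
    unfolding s'_def using F U V s that by (intro finsum_res_res) auto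
  have rels: "relations A F V n s' W = relations A F U n s W" if "open W" "W \<subseteq> V" for W
    unfolding relations_def using sum[OF that] by auto
  have "res F U V \<in> carrier (sect F U) \<rightarrow> carrier (sect F V)"
    using F U(1) V(1,3) unfolding presheaf_of_modules_def by simp
  then have "s' \<in> {..<n} \<rightarrow> carrier (sect F V)"
    using s unfolding s'_def by (auto simp: Pi_iff)
  moreover have "\<exists>W'. open W' \<and> y \<in> W' \<and> W' \<subseteq> W \<and>
      (\<exists>g \<in> {..<n} \<rightarrow> A W'. res F W W' t =
         (\<Oplus>\<^bsub>sect F W'\<^esub>i\<in>{..<n}. g i \<odot>\<^bsub>sect F W'\<^esub> res F V W' (s' i)))"
    if W: "open W" "W \<subseteq> V" "t \<in> carrier (sect F W)" "y \<in> W" for W t y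
  proof -
    have "W \<subseteq> U" using W V by blast
    then have "\<exists>W'. open W' \<and> y \<in> W' \<and> W' \<subseteq> W \<and>
        (\<exists>g \<in> {..<n} \<rightarrow> A W'. res F W W' t =
           (\<Oplus>\<^bsub>sect F W'\<^esub>i\<in>{..<n}. g i \<odot>\<^bsub>sect F W'\<^esub> res F U W' (s i)))"
      using gen W unfolding generates_def by simp
    then obtain W' g where "open W'" "y \<in> W'" "W' \<subseteq> W" "g \<in> {..<n} \<rightarrow> A W'"
      "res F W W' t = (\<Oplus>\<^bsub>sect F W'\<^esub>i\<in>{..<n}. g i \<odot>\<^bsub>sect F W'\<^esub> res F U W' (s i))"
      by (elim exE conjE bexE)
    moreover have "W' \<subseteq> V" using \<open>W' \<subseteq> W\<close> W by blast
    ultimately show ?thesis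
      using sum[of W' g] by (intro exI[of _ W'] conjI bexI[of _ g]) simp_all
  qed
  ultimately have "generates A F V n s'"
    unfolding generates_def by simp
  moreover have "relations_generated A F V n s' V m r"
    using rel rels V(1) unfolding relations_generated_def by auto
  ultimately show "\<exists>U n s m r. open U \<and> x \<in> U \<and> generates A F U n s \<and>
      relations_generated A F U n s U m r"
    using V(1,2)
    by (intro exI[of _ V] exI[of _ n] exI[of _ s'] exI[of _ m] exI[of _ r]) simp
qed

section \<open>Tensor products of modules\<close>

text \<open>
  The tensor product of the \<open>R\<close>-modules \<open>M\<close> and \<open>N\<close> is the free abelian group on
  \<open>M \<times> N\<close> modulo the usual relations; its elements are cosets.
\<close>

definition tensor_relations ::
  "'r ring \<Rightarrow> ('r, 'm) module \<Rightarrow> ('r, 'n) module \<Rightarrow> ('m \<times> 'n \<Rightarrow>\<^sub>0 int) set" where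
  "tensor_relations R M N =
     generate (free_Abelian_group (carrier M \<times> carrier N))
       ({frag_of (m \<oplus>\<^bsub>M\<^esub> m', n) - frag_of (m, n) - frag_of (m', n) | m m' n.
            m \<in> carrier M \<and> m' \<in> carrier M \<and> n \<in> carrier N} \<union>
        {frag_of (m, n \<oplus>\<^bsub>N\<^esub> n') - frag_of (m, n) - frag_of (m, n') | m n n'.
            m \<in> carrier M \<and> n \<in> carrier N \<and> n' \<in> carrier N} \<union>
        {frag_of (r \<odot>\<^bsub>M\<^esub> m, n) - frag_of (m, r \<odot>\<^bsub>N\<^esub> n) | r m n.
            r \<in> carrier R \<and> m \<in> carrier M \<and> n \<in> carrier N})"

definition tensor_class ::
  "'r ring \<Rightarrow> ('r, 'm) module \<Rightarrow> ('r, 'n) module \<Rightarrow> ('m \<times> 'n \<Rightarrow>\<^sub>0 int) \<Rightarrow> ('m \<times> 'n \<Rightarrow>\<^sub>0 int) set" where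
  "tensor_class R M N w =
     tensor_relations R M N #>\<^bsub>free_Abelian_group (carrier M \<times> carrier N)\<^esub> w"

text \<open>
  In \<open>smult\<close>, as in the later definitions of this kind, the union runs over all representatives
  of a class, each of which contributes the same set.
\<close>

definition tensor_product ::
  "'r ring \<Rightarrow> ('r, 'm) module \<Rightarrow> ('r, 'n) module \<Rightarrow> ('r, ('m \<times> 'n \<Rightarrow>\<^sub>0 int) set) module" where
  "tensor_product R M N =
     \<lparr>carrier = rcosets\<^bsub>free_Abelian_group (carrier M \<times> carrier N)\<^esub> (tensor_relations R M N),
      monoid.mult = undefined,
      monoid.one = undefined,
      ring.zero = tensor_relations R M N,
      ring.add = set_mult (free_Abelian_group (carrier M \<times> carrier N)),
      smult = (\<lambda>r C. \<Union>w\<in>C. tensor_class R M N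
                 (frag_extend (\<lambda>(m, n). frag_of (r \<odot>\<^bsub>M\<^esub> m, n)) w))\<rparr>"

definition tensor_presheaf ::
  "('p set \<Rightarrow> ('p \<Rightarrow> 'k::field) set) \<Rightarrow>
     ('p, 'p \<Rightarrow> 'k, 's) module_presheaf \<Rightarrow> ('p, 'p \<Rightarrow> 'k, 't) module_presheaf
     \<Rightarrow> ('p, 'p \<Rightarrow> 'k, ('s \<times> 't \<Rightarrow>\<^sub>0 int) set) module_presheaf" where
  "tensor_presheaf A F G =
     \<lparr>sect = (\<lambda>U. tensor_product (function_ring A U) (sect F U) (sect G U)),
      res = (\<lambda>U V C. \<Union>w\<in>C. tensor_class (function_ring A V) (sect F V) (sect G V)
               (frag_extend (\<lambda>(s, t). frag_of (res F U V s, res G U V t)) w))\<rparr>"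

section \<open>Sheafification and tensor products of sheaves\<close>

definition germ ::
  "('p::topological_space, 'r, 's) module_presheaf \<Rightarrow> 'p \<Rightarrow> 'p set \<Rightarrow> 's \<Rightarrow> ('p set \<times> 's) set" where
  "germ P x U s =
     {(V, t). open V \<and> x \<in> V \<and> t \<in> carrier (sect P V) \<and>
        (\<exists>W. open W \<and> x \<in> W \<and> W \<subseteq> U \<inter> V \<and> res P U W s = res P V W t)}"

definition to_sheafification ::
  "('p::topological_space, 'r, 's) module_presheaf \<Rightarrow> 'p set \<Rightarrow> 's \<Rightarrow> 'p \<Rightarrow> ('p set \<times> 's) set" where
  "to_sheafification P U s = (\<lambda>x. if x \<in> U then germ P x U s else {})"

text \<open>
  The sections of the sheafification are the functions to the stalks that are locally given
  by sections of the presheaf; they take the value \<open>{}\<close> outside their domain.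
\<close>

definition sheafification ::
  "('p::topological_space, 'p \<Rightarrow> 'k::field, 's) module_presheaf
     \<Rightarrow> ('p, 'p \<Rightarrow> 'k, 'p \<Rightarrow> ('p set \<times> 's) set) module_presheaf" where
  "sheafification P =
     \<lparr>sect = (\<lambda>U.
        \<lparr>carrier =
           {\<sigma>. (\<forall>x\<in>U. \<exists>V t. open V \<and> x \<in> V \<and> V \<subseteq> U \<and> t \<in> carrier (sect P V) \<and>
                  (\<forall>y\<in>V. \<sigma> y = germ P y V t)) \<and>
               (\<forall>x. x \<notin> U \<longrightarrow> \<sigma> x = {})},
         monoid.mult = undefined,
         monoid.one = undefined,
         ring.zero = to_sheafification P U \<zero>\<^bsub>sect P U\<^esub>,
         ring.add = (\<lambda>\<sigma> \<tau> x. \<Union>(V, s)\<in>\<sigma> x. \<Union>(W, t)\<in>\<tau> x. germ P x (V \<inter> W)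
                  (res P V (V \<inter> W) s \<oplus>\<^bsub>sect P (V \<inter> W)\<^esub> res P W (V \<inter> W) t)),
         smult = (\<lambda>g \<sigma> x. \<Union>(V, s)\<in>\<sigma> x. germ P x (U \<inter> V)
                  (cut (U \<inter> V) g \<odot>\<^bsub>sect P (U \<inter> V)\<^esub> res P V (U \<inter> V) s))\<rparr>),
      res = (\<lambda>U V \<sigma> x. if x \<in> V then \<sigma> x else {})\<rparr>"

type_synonym ('p, 's, 't) tensor_section = "'p \<Rightarrow> ('p set \<times> ('s \<times> 't \<Rightarrow>\<^sub>0 int) set) set"

definition tensor_sheaf ::
  "('p::topological_space set \<Rightarrow> ('p \<Rightarrow> 'k::field) set) \<Rightarrow>
     ('p, 'p \<Rightarrow> 'k, 's) module_presheaf \<Rightarrow> ('p, 'p \<Rightarrow> 'k, 't) module_presheaf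
     \<Rightarrow> ('p, 'p \<Rightarrow> 'k, ('p, 's, 't) tensor_section) module_presheaf" where
  "tensor_sheaf A F G = sheafification (tensor_presheaf A F G)"

definition pure_tensor ::
  "('p::topological_space set \<Rightarrow> ('p \<Rightarrow> 'k::field) set) \<Rightarrow>
     ('p, 'p \<Rightarrow> 'k, 's) module_presheaf \<Rightarrow> ('p, 'p \<Rightarrow> 'k, 't) module_presheaf
     \<Rightarrow> 'p set \<Rightarrow> 's \<Rightarrow> 't \<Rightarrow> ('p, 's, 't) tensor_section" where
  "pure_tensor A F G U s t =
     to_sheafification (tensor_presheaf A F G) U
       (tensor_class (function_ring A U) (sect F U) (sect G U) (frag_of (s, t)))"

text \<open>
  The morphism of abelian sheaves on \<open>F \<otimes> G\<close> with prescribed values on the sections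
  \<open>s \<otimes> t\<close>.  It is unique because these sections generate \<open>F \<otimes> G\<close> locally, and exists
  if the prescription is biadditive, \<open>A\<close>-balanced and compatible with restriction.
\<close>

definition tensor_lift ::
  "('p::topological_space set \<Rightarrow> ('p \<Rightarrow> 'k::field) set) \<Rightarrow>
     ('p, 'p \<Rightarrow> 'k, 's) module_presheaf \<Rightarrow> ('p, 'p \<Rightarrow> 'k, 't) module_presheaf \<Rightarrow>
     ('p, 'p \<Rightarrow> 'k, 'u) module_presheaf \<Rightarrow> ('p set \<Rightarrow> 's \<Rightarrow> 't \<Rightarrow> 'u)
     \<Rightarrow> 'p set \<Rightarrow> ('p, 's, 't) tensor_section \<Rightarrow> 'u" where
  "tensor_lift A F G H b =
     (THE \<phi>. \<phi> \<in> additive_morphisms (tensor_sheaf A F G) H \<and>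
        (\<forall>U. open U \<longrightarrow> (\<forall>s\<in>carrier (sect F U). \<forall>t\<in>carrier (sect G U).
           \<phi> U (pure_tensor A F G U s t) = b U s t)))"

section \<open>Vector fields and differential forms\<close>

text \<open>
  Vector fields on \<open>U\<close> are the derivations of the sheaf \<open>A\<close> restricted to \<open>U\<close>: families,
  indexed by the open subsets \<open>V\<close> of \<open>U\<close>, of derivations of \<open>A V\<close> compatible with restriction.
  They are normalised to be 0 on all other arguments.
\<close>

type_synonym ('p, 'k) vector_field = "'p set \<Rightarrow> ('p \<Rightarrow> 'k) \<Rightarrow> 'p \<Rightarrow> 'k"

definition vector_fields ::
  "('p::topological_space set \<Rightarrow> ('p \<Rightarrow> 'k::field) set) \<Rightarrow> 'p set \<Rightarrow> ('p, 'k) vector_field set" where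
  "vector_fields A U =
     {X. (\<forall>V f. X V f \<in> (if open V \<and> V \<subseteq> U \<and> f \<in> A V then A V else {\<lambda>x. 0})) \<and>
         (\<forall>V. open V \<longrightarrow> V \<subseteq> U \<longrightarrow>
            (\<forall>f\<in>A V. \<forall>g\<in>A V. X V (\<lambda>x. f x + g x) = (\<lambda>x. X V f x + X V g x)) \<and>
            (\<forall>c. \<forall>f\<in>A V. X V (\<lambda>x. c * f x) = (\<lambda>x. c * X V f x)) \<and>
            (\<forall>f\<in>A V. \<forall>g\<in>A V. X V (\<lambda>x. f x * g x) = (\<lambda>x. X V f x * g x + f x * X V g x))) \<and>
         (\<forall>V W. open V \<longrightarrow> open W \<longrightarrow> W \<subseteq> V \<longrightarrow> V \<subseteq> U \<longrightarrow>
            (\<forall>f\<in>A V. X W (cut W f) = cut W (X V f)))}"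

definition vf_restrict :: "'p set \<Rightarrow> ('p, 'k::zero) vector_field \<Rightarrow> ('p, 'k) vector_field" where
  "vf_restrict V X = (\<lambda>W f. if W \<subseteq> V then X W f else (\<lambda>x. 0))"

definition vf_add ::
  "('p, 'k::plus) vector_field \<Rightarrow> ('p, 'k) vector_field \<Rightarrow> ('p, 'k) vector_field" where
  "vf_add X Y = (\<lambda>V f x. X V f x + Y V f x)"

definition vf_smult ::
  "('p \<Rightarrow> 'k::{times, zero}) \<Rightarrow> ('p, 'k) vector_field \<Rightarrow> ('p, 'k) vector_field" where
  "vf_smult g X = (\<lambda>V f x. cut V g x * X V f x)"

definition lie_bracket ::
  "('p, 'k::minus) vector_field \<Rightarrow> ('p, 'k) vector_field \<Rightarrow> ('p, 'k) vector_field" where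
  "lie_bracket X Y = (\<lambda>V f x. X V (Y V f) x - Y V (X V f) x)"

text \<open>
  Differential \<open>k\<close>-forms on \<open>U\<close> are alternating \<open>A\<close>-multilinear functions of \<open>k\<close> vector fields:
  families, indexed by the open subsets \<open>V\<close> of \<open>U\<close>, of alternating \<open>A V\<close>-multilinear maps
  compatible with restriction.  The \<open>k\<close> arguments are a list of length \<open>k\<close>.
\<close>

type_synonym ('p, 'k) form = "'p set \<Rightarrow> ('p, 'k) vector_field list \<Rightarrow> 'p \<Rightarrow> 'k"

definition differential_forms ::
  "('p::topological_space set \<Rightarrow> ('p \<Rightarrow> 'k::field) set) \<Rightarrow> nat \<Rightarrow> 'p set \<Rightarrow> ('p, 'k) form set" where
  "differential_forms A k U =
     {\<omega>. (\<forall>V Xs. \<omega> V Xs \<in>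
            (if open V \<and> V \<subseteq> U \<and> set Xs \<subseteq> vector_fields A V \<and> length Xs = k then A V else {\<lambda>x. 0})) \<and>
         (\<forall>V Xs. open V \<longrightarrow> V \<subseteq> U \<longrightarrow> set Xs \<subseteq> vector_fields A V \<longrightarrow> length Xs = k \<longrightarrow>
            (\<forall>i<k. \<forall>X\<in>vector_fields A V. \<forall>Y\<in>vector_fields A V.
               \<omega> V (Xs[i := vf_add X Y]) = (\<lambda>x. \<omega> V (Xs[i := X]) x + \<omega> V (Xs[i := Y]) x)) \<and>
            (\<forall>i<k. \<forall>g\<in>A V. \<forall>X\<in>vector_fields A V.
               \<omega> V (Xs[i := vf_smult g X]) = (\<lambda>x. g x * \<omega> V (Xs[i := X]) x)) \<and>
            (\<forall>i<k. \<forall>j<k. i \<noteq> j \<longrightarrow> Xs ! i = Xs ! j \<longrightarrow> \<omega> V Xs = (\<lambda>x. 0)) \<and>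
            (\<forall>W. open W \<longrightarrow> W \<subseteq> V \<longrightarrow> \<omega> W (map (vf_restrict W) Xs) = cut W (\<omega> V Xs)))}"

definition form_sheaf ::
  "('p::topological_space set \<Rightarrow> ('p \<Rightarrow> 'k::field) set) \<Rightarrow> nat
     \<Rightarrow> ('p, 'p \<Rightarrow> 'k, ('p, 'k) form) module_presheaf" where
  "form_sheaf A k =
     \<lparr>sect = (\<lambda>U.
        \<lparr>carrier = differential_forms A k U,
         monoid.mult = undefined,
         monoid.one = undefined,
         ring.zero = (\<lambda>V Xs x. 0),
         ring.add = (\<lambda>\<omega> \<eta> V Xs x. \<omega> V Xs x + \<eta> V Xs x),
         smult = (\<lambda>g \<omega> V Xs x. cut V g x * \<omega> V Xs x)\<rparr>),
      res = (\<lambda>U V \<omega> W Xs. if W \<subseteq> V then \<omega> W Xs else (\<lambda>x. 0))\<rparr>"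

definition function_form ::
  "('p::topological_space set) \<Rightarrow> ('p \<Rightarrow> 'k::field) \<Rightarrow> ('p, 'k) form" where
  "function_form U f = (\<lambda>V Xs. if open V \<and> V \<subseteq> U \<and> Xs = [] then cut V f else (\<lambda>x. 0))"

text \<open>
  The sum over all permutations divided by \<open>k! l!\<close> is the sum over all \<open>(k,l)\<close>-shuffles.
\<close>

definition wedge :: "nat \<Rightarrow> nat \<Rightarrow> ('p, 'k::field_char_0) form \<Rightarrow> ('p, 'k) form \<Rightarrow> ('p, 'k) form" where
  "wedge k l \<alpha> \<beta> = (\<lambda>V Xs x.
     if length Xs = k + l
     then (\<Sum>\<pi> | \<pi> permutes {..<k + l}. of_int (sign \<pi>) *
             \<alpha> V (map (\<lambda>i. Xs ! \<pi> i) [0..<k]) x * \<beta> V (map (\<lambda>i. Xs ! \<pi> i) [k..<k + l]) x)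
          / (fact k * fact l)
     else 0)"

definition drop_nth :: "nat \<Rightarrow> 'a list \<Rightarrow> 'a list" where
  "drop_nth i xs = take i xs @ drop (Suc i) xs"

text \<open>The coordinate-free (Koszul) formula for the exterior derivative.\<close>

definition ext_deriv ::
  "('p::topological_space set \<Rightarrow> ('p \<Rightarrow> 'k::field) set) \<Rightarrow> ('p, 'k) form \<Rightarrow> ('p, 'k) form" where
  "ext_deriv A \<omega> = (\<lambda>V Xs x.
     if open V \<and> set Xs \<subseteq> vector_fields A V
     then (\<Sum>i<length Xs. (-1) ^ i * (Xs ! i) V (\<omega> V (drop_nth i Xs)) x)
        + (\<Sum>j<length Xs. \<Sum>i<j. (-1) ^ (i + j) *
             \<omega> V (lie_bracket (Xs ! i) (Xs ! j) # drop_nth i (drop_nth j Xs)) x)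
     else 0)"

section \<open>Connections and curvature\<close>

text \<open>The sheaf of \<open>k\<close>-forms with values in \<open>F\<close>.\<close>

definition forms_with_values ::
  "('p::topological_space set \<Rightarrow> ('p \<Rightarrow> 'k::field) set) \<Rightarrow> nat \<Rightarrow> ('p, 'p \<Rightarrow> 'k, 's) module_presheaf
     \<Rightarrow> ('p, 'p \<Rightarrow> 'k, ('p, ('p, 'k) form, 's) tensor_section) module_presheaf" where
  "forms_with_values A k F = tensor_sheaf A (form_sheaf A k) F"

definition connection ::
  "('p::topological_space set \<Rightarrow> ('p \<Rightarrow> 'k::field) set) \<Rightarrow> ('p, 'p \<Rightarrow> 'k, 's) module_presheaf
     \<Rightarrow> ('p set \<Rightarrow> 's \<Rightarrow> ('p, ('p, 'k) form, 's) tensor_section) \<Rightarrow> bool" where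
  "connection A F D \<longleftrightarrow>
     D \<in> additive_morphisms F (forms_with_values A 1 F) \<and>
     (\<forall>U. open U \<longrightarrow> (\<forall>g\<in>A U. \<forall>\<sigma>\<in>carrier (sect F U).
        D U (g \<odot>\<^bsub>sect F U\<^esub> \<sigma>) =
          pure_tensor A (form_sheaf A 1) F U (ext_deriv A (function_form U g)) \<sigma>
          \<oplus>\<^bsub>sect (forms_with_values A 1 F) U\<^esub> g \<odot>\<^bsub>sect (forms_with_values A 1 F) U\<^esub> D U \<sigma>))"

text \<open>
  The natural morphism \<open>\<N>\<close> from \<open>A\<^sup>k \<otimes> (A\<^sup>1 \<otimes> F)\<close> to \<open>A\<^sup>k\<^sup>+\<^sup>1 \<otimes> F\<close>.
\<close>

definition wedge_morphism ::
  "('p::topological_space set \<Rightarrow> ('p \<Rightarrow> 'k::field_char_0) set) \<Rightarrow>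
     ('p, 'p \<Rightarrow> 'k, 's) module_presheaf \<Rightarrow> nat \<Rightarrow> 'p set
     \<Rightarrow> ('p, ('p, 'k) form, ('p, ('p, 'k) form, 's) tensor_section) tensor_section
     \<Rightarrow> ('p, ('p, 'k) form, 's) tensor_section" where
  "wedge_morphism A F k =
     (THE \<phi>. \<phi> \<in> linear_morphisms A (forms_with_values A k (forms_with_values A 1 F))
                   (forms_with_values A (Suc k) F) \<and>
        (\<forall>U. open U \<longrightarrow> (\<forall>\<alpha>\<in>differential_forms A k U. \<forall>\<beta>\<in>differential_forms A 1 U.
           \<forall>\<sigma>\<in>carrier (sect F U).
             \<phi> U (pure_tensor A (form_sheaf A k) (forms_with_values A 1 F) U \<alpha>
                    (pure_tensor A (form_sheaf A 1) F U \<beta> \<sigma>))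
             = pure_tensor A (form_sheaf A (Suc k)) F U (wedge k 1 \<alpha> \<beta>) \<sigma>)))"

definition wedge_section ::
  "('p::topological_space set \<Rightarrow> ('p \<Rightarrow> 'k::field_char_0) set) \<Rightarrow>
     ('p, 'p \<Rightarrow> 'k, 's) module_presheaf \<Rightarrow> nat \<Rightarrow> 'p set \<Rightarrow> ('p, 'k) form
     \<Rightarrow> ('p, ('p, 'k) form, 's) tensor_section \<Rightarrow> ('p, ('p, 'k) form, 's) tensor_section" where
  "wedge_section A F k U \<alpha> \<tau> =
     wedge_morphism A F k U (pure_tensor A (form_sheaf A k) (forms_with_values A 1 F) U \<alpha> \<tau>)"

definition connection_extension ::
  "('p::topological_space set \<Rightarrow> ('p \<Rightarrow> 'k::field_char_0) set) \<Rightarrow>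
     ('p, 'p \<Rightarrow> 'k, 's) module_presheaf \<Rightarrow>
     ('p set \<Rightarrow> 's \<Rightarrow> ('p, ('p, 'k) form, 's) tensor_section) \<Rightarrow> nat \<Rightarrow> 'p set
     \<Rightarrow> ('p, ('p, 'k) form, 's) tensor_section \<Rightarrow> ('p, ('p, 'k) form, 's) tensor_section" where
  "connection_extension A F D k =
     tensor_lift A (form_sheaf A k) F (forms_with_values A (Suc k) F)
       (\<lambda>U \<beta> \<sigma>. pure_tensor A (form_sheaf A (Suc k)) F U (ext_deriv A \<beta>) \<sigma>
          \<oplus>\<^bsub>sect (forms_with_values A (Suc k) F) U\<^esub>
          add_pow (sect (forms_with_values A (Suc k) F) U) ((-1::int) ^ k)
            (wedge_section A F k U \<beta> (D U \<sigma>)))"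

definition endomorphism_extension ::
  "('p::topological_space set \<Rightarrow> ('p \<Rightarrow> 'k::field_char_0) set) \<Rightarrow>
     ('p, 'p \<Rightarrow> 'k, 's) module_presheaf \<Rightarrow>
     ('p set \<Rightarrow> 's \<Rightarrow> ('p, ('p, 'k) form, 's) tensor_section) \<Rightarrow> nat \<Rightarrow> 'p set
     \<Rightarrow> ('p, ('p, 'k) form, 's) tensor_section \<Rightarrow> ('p, ('p, 'k) form, 's) tensor_section" where
  "endomorphism_extension A F E k =
     tensor_lift A (form_sheaf A k) F (forms_with_values A (Suc k) F)
       (\<lambda>U \<alpha> \<sigma>. wedge_section A F k U \<alpha>
          (add_pow (sect (forms_with_values A 1 F) U) ((-1::int) ^ k) (E U \<sigma>)))"

definition curvature ::
  "('p::topological_space set \<Rightarrow> ('p \<Rightarrow> 'k::field_char_0) set) \<Rightarrow>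
     ('p, 'p \<Rightarrow> 'k, 's) module_presheaf \<Rightarrow>
     ('p set \<Rightarrow> 's \<Rightarrow> ('p, ('p, 'k) form, 's) tensor_section)
     \<Rightarrow> 'p set \<Rightarrow> 's \<Rightarrow> ('p, ('p, 'k) form, 's) tensor_section" where
  "curvature A F D = hom_comp F (connection_extension A F D 1) D"

end

(*
  Both extensions to S1, the sheaf of 1-forms with values in F, are characterised by their values
  on the local generators b (x) s, and on these nabla-hat^1 agrees with nabla^1 + E^1; evaluating at
  nabla-hat = nabla + E gives the formula.  The substance is that the THE-defined morphisms exist.
  A tensor_lift exists because a balanced biadditive map induces maps on the presheaf tensor product,
  hence, by gluing, on its sheafification.  The morphism N on A^1 (x) (A^1 (x) F) is obtained by
  lifting twice: first, for a fixed 1-form a on U, over the open subsets of U, then in a.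
  That the prescription defining nabla^1 is balanced is the Leibniz rule d(gb) = g db - b /\ dg
  cancelling the Leibniz term of nabla(gs).
*)

theory Submission
  imports Defs
begin

section \<open>Smooth functions\<close>

text \<open>The curvature involves both extensions in degree k = 1 only, so forms are handled in
  degrees 0, 1 and 2, and the wedge product for two 1-forms. The sign in the extension of E is what
  makes the sum work: on a generator, -(b \<and> (nabla + E) s) splits into -(b \<and> nabla s),
  which belongs to the extension of nabla, and b \<and> (-E s), which is the value of the extension
  of E. The obstacle is that all objects are quotients: tensors are cosets and germs are sets of
  equivalent pairs, so direct computation is rarely possible. Linearity, compatibility with
  restriction and additivity in a parameter are therefore each rephrased as equality of two additive
  maps into a sheaf and settled by \<open>tensor_eqI\<close>. The maps are kept merely additive
  because the extension of a connection is not linear; balancedness is what factoring through the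
  tensor product requires. The smooth structure enters through the five properties of
  \<open>function_presheaf\<close>.\<close>

lemma C_on_continuous: "C_on k S f \<Longrightarrow> continuous_on S f"
  by (cases k) (auto simp: differentiable_imp_continuous_within continuous_at_imp_continuous_on)

lemma C_on_subset: "C_on k S f \<Longrightarrow> T \<subseteq> S \<Longrightarrow> C_on k T f"
  by (induction k arbitrary: f) (auto intro: continuous_on_subset)

text \<open>That differentiability implies continuity settles the base case. The lemma serves the
  product rule, in which the undifferentiated factors appear next to the derivatives.\<close>

lemma C_on_Suc_imp: "C_on (Suc k) S f \<Longrightarrow> C_on k S f"
proof (induction k arbitrary: f)
  case 0
  then show ?case using C_on_continuous[of "Suc 0"] by auto
next
  case (Suc k)
  then show ?case by (metis C_on.simps(2))
qed

text \<open>On an open set the values near each point determine the derivatives there, whatever the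
  function does outside. This allows a sum, a product or a cut-off to be replaced by a formula that
  is valid on S only.\<close>

lemma C_on_cong:
  assumes "open S" "\<And>x. x \<in> S \<Longrightarrow> f x = g x" "C_on k S f"
  shows "C_on k S g"
  using assms(2,3)
proof (induction k arbitrary: f g)
  case 0
  then show ?case by (simp cong: continuous_on_cong)
next
  case (Suc k)
  \<comment> \<open>\<open>frechet_derivative\<close> is a choice among all derivatives satisfying
    \<open>has_derivative\<close>, so an equivalence for every candidate forces the same choice for
    f and g.\<close>
  have d: "(f has_derivative f') (at x) \<longleftrightarrow> (g has_derivative f') (at x)" if "x \<in> S" for x f'
    using has_derivative_transform_within_open[OF _ \<open>open S\<close> that] Suc.prems(1) by metis
  have "g differentiable (at x)" if "x \<in> S" for x
    using Suc.prems(2) that d[OF that] unfolding C_on.simps differentiable_def by metis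
  moreover have "frechet_derivative f (at x) = frechet_derivative g (at x)" if "x \<in> S" for x
    unfolding frechet_derivative_def using d[OF that] by simp
  moreover have "C_on k S (\<lambda>x. frechet_derivative g (at x) v)" for v
    using Suc.prems(2) calculation(2)
    by - (rule Suc.IH[of "\<lambda>x. frechet_derivative f (at x) v"], simp_all)
  ultimately show ?case by simp
qed

lemma C_on_const: "C_on k S (\<lambda>x. c)"
  by (induction k arbitrary: c) (auto simp: frechet_derivative_const)

text \<open>The induction varies f and g because its hypothesis is applied to their directional
  derivatives. The sum rule holds at points of S, which suffices by
  \<open>C_on_cong\<close>.\<close>

lemma C_on_add:
  assumes "open S" "C_on k S f" "C_on k S g"
  shows "C_on k S (\<lambda>x. f x + g x)"
  using assms(2,3)
proof (induction k arbitrary: f g)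
  case (Suc k)
  have eq: "frechet_derivative (\<lambda>x. f x + g x) (at x) v =
      frechet_derivative f (at x) v + frechet_derivative g (at x) v" if "x \<in> S" for x v
  proof -
    have "((\<lambda>x. f x + g x) has_derivative
        (\<lambda>h. frechet_derivative f (at x) h + frechet_derivative g (at x) h)) (at x)"
      using Suc.prems that by (intro has_derivative_add) (auto simp: frechet_derivative_works[symmetric])
    from frechet_derivative_at[OF this] show ?thesis by metis
  qed
  have "C_on k S (\<lambda>x. frechet_derivative (\<lambda>x. f x + g x) (at x) v)" for v
  proof (rule C_on_cong[OF \<open>open S\<close>])
    show "C_on k S (\<lambda>x. frechet_derivative f (at x) v + frechet_derivative g (at x) v)"
      using Suc.prems by (intro Suc.IH) auto
  qed (simp add: eq)
  with Suc.prems show ?case by auto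
qed (auto intro: continuous_on_add)

text \<open>By the product rule each directional derivative is a sum of two products of functions of
  class k, to which the induction hypothesis and \<open>C_on_add\<close> apply.\<close>

lemma C_on_mult:
  fixes f g :: "'e::real_normed_vector \<Rightarrow> 'k::real_normed_field"
  assumes "open S" "C_on k S f" "C_on k S g"
  shows "C_on k S (\<lambda>x. f x * g x)"
  using assms(2,3)
proof (induction k arbitrary: f g)
  case (Suc k)
  have eq: "frechet_derivative (\<lambda>x. f x * g x) (at x) v =
      f x * frechet_derivative g (at x) v + frechet_derivative f (at x) v * g x" if "x \<in> S" for x v
  proof -
    have "((\<lambda>x. f x * g x) has_derivative
        (\<lambda>h. f x * frechet_derivative g (at x) h + frechet_derivative f (at x) h * g x)) (at x)"
      using Suc.prems that by (intro has_derivative_mult) (auto simp: frechet_derivative_works[symmetric])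
    from frechet_derivative_at[OF this] show ?thesis by metis
  qed
  have "C_on k S (\<lambda>x. frechet_derivative (\<lambda>x. f x * g x) (at x) v)" for v
  proof (rule C_on_cong[OF \<open>open S\<close>])
    show "C_on k S (\<lambda>x. f x * frechet_derivative g (at x) v + frechet_derivative f (at x) v * g x)"
      using Suc.prems C_on_Suc_imp[OF Suc.prems(1)] C_on_Suc_imp[OF Suc.prems(2)]
      by (intro C_on_add \<open>open S\<close> Suc.IH) auto
  qed (simp add: eq)
  with Suc.prems show ?case by auto
qed (auto intro: continuous_on_mult)

text \<open>An abstraction of \<open>smooth_functions\<close> over an arbitrary space and field of
  values. Zero, negatives and scalar multiples come from multiplication by the constants
  \<open>cut U (\<lambda>x. c)\<close>.\<close>

locale function_presheaf =
  fixes A :: "'p::topological_space set \<Rightarrow> ('p \<Rightarrow> 'k::field) set"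
  assumes zero_outside: "open U \<Longrightarrow> f \<in> A U \<Longrightarrow> x \<notin> U \<Longrightarrow> f x = 0"
    and const_closed: "open U \<Longrightarrow> cut U (\<lambda>x. c) \<in> A U"
    and add_closed: "open U \<Longrightarrow> f \<in> A U \<Longrightarrow> g \<in> A U \<Longrightarrow> (\<lambda>x. f x + g x) \<in> A U"
    and mult_closed: "open U \<Longrightarrow> f \<in> A U \<Longrightarrow> g \<in> A U \<Longrightarrow> (\<lambda>x. f x * g x) \<in> A U"
    and cut_closed: "open U \<Longrightarrow> open V \<Longrightarrow> V \<subseteq> U \<Longrightarrow> f \<in> A U \<Longrightarrow> cut V f \<in> A V"

lemma smooth_functions_function_presheaf:
  assumes "smooth_manifold \<A>"
  shows "function_presheaf (smooth_functions \<A>)"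
proof -
  \<comment> \<open>A homeomorphism maps relatively open sets to relatively open ones, and the chart
    image is itself open. Openness is what \<open>C_on_cong\<close>, \<open>C_on_add\<close> and
    \<open>C_on_mult\<close> ask for.\<close>
  have op: "open (\<phi> ` (U \<inter> V))" if "open U" "(V, \<phi>) \<in> \<A>" for U V \<phi>
  proof -
    have *: "open V" "open (\<phi> ` V)" "homeomorphism V (\<phi> ` V) \<phi> (inv_into V \<phi>)"
      using assms that unfolding smooth_manifold_def by auto
    then have "openin (top_of_set (\<phi> ` V)) (\<phi> ` (U \<inter> V))"
      using homeomorphism_imp_open_map[OF *(3), of "U \<inter> V"] that(1) by (auto simp: openin_open)
    then show ?thesis using *(2) by (meson openin_open_trans)
  qed
  have inv: "inv_into V \<phi> (\<phi> x) = x" if "(V, \<phi>) \<in> \<A>" "x \<in> V" for V \<phi> x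
    using assms that unfolding smooth_manifold_def homeomorphism_def by fastforce
  \<comment> \<open>A coordinate in the image of U \<inter> V comes from a point of U, where cutting
    to U changes nothing.\<close>
  have cuteq: "smooth_on (\<phi> ` (U \<inter> V)) (cut U f \<circ> inv_into V \<phi>)"
    if "open U" "(V, \<phi>) \<in> \<A>" "smooth_on (\<phi> ` (U \<inter> V)) (f \<circ> inv_into V \<phi>)"
    for U V \<phi> and f :: "'a \<Rightarrow> 'c"
  proof -
    have "C_on k (\<phi> ` (U \<inter> V)) (cut U f \<circ> inv_into V \<phi>)" for k
      using that(3) by - (rule C_on_cong[OF op[OF that(1,2)], of "f \<circ> inv_into V \<phi>"],
        auto simp: smooth_on_def cut_def inv[OF that(2)])
    then show ?thesis by (simp add: smooth_on_def)
  qed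
  have sm: "f \<in> smooth_functions \<A> U \<longleftrightarrow> (\<forall>x. x \<notin> U \<longrightarrow> f x = 0) \<and>
      (\<forall>V \<phi>. (V, \<phi>) \<in> \<A> \<longrightarrow> smooth_on (\<phi> ` (U \<inter> V)) (f \<circ> inv_into V \<phi>))"
    for U and f :: "'a \<Rightarrow> 'c"
    unfolding smooth_functions_def by blast
  show ?thesis
  proof (rule function_presheaf.intro)
    fix U :: "'a set" and f :: "'a \<Rightarrow> 'c" and x assume "f \<in> smooth_functions \<A> U" "x \<notin> U"
    then show "f x = 0" by (simp add: sm)
  next
    fix U :: "'a set" and c :: 'c assume U: "open U"
    have "smooth_on (\<phi> ` (U \<inter> V)) (cut U (\<lambda>x. c) \<circ> inv_into V \<phi>)" if "(V, \<phi>) \<in> \<A>" for V \<phi>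
      by (rule cuteq[OF U that]) (simp add: smooth_on_def o_def C_on_const)
    then show "cut U (\<lambda>x. c) \<in> smooth_functions \<A> U"
      unfolding sm by (simp add: cut_def)
  next
    fix U :: "'a set" and f g :: "'a \<Rightarrow> 'c"
    assume U: "open U" and fg: "f \<in> smooth_functions \<A> U" "g \<in> smooth_functions \<A> U"
    have "C_on k (\<phi> ` (U \<inter> V)) (\<lambda>x. f (inv_into V \<phi> x))" "C_on k (\<phi> ` (U \<inter> V)) (\<lambda>x. g (inv_into V \<phi> x))"
      if "(V, \<phi>) \<in> \<A>" for V \<phi> k
      using fg that unfolding sm smooth_on_def o_def by simp_all
    note C = this
    have "smooth_on (\<phi> ` (U \<inter> V)) ((\<lambda>x. f x + g x) \<circ> inv_into V \<phi>)"
      "smooth_on (\<phi> ` (U \<inter> V)) ((\<lambda>x. f x * g x) \<circ> inv_into V \<phi>)" if "(V, \<phi>) \<in> \<A>" for V \<phi>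
      unfolding smooth_on_def o_def
      by (intro allI C_on_add[OF op[OF U that] C[OF that]])
         (intro allI C_on_mult[OF op[OF U that] C[OF that]])
    then show "(\<lambda>x. f x + g x) \<in> smooth_functions \<A> U" "(\<lambda>x. f x * g x) \<in> smooth_functions \<A> U"
      using fg by (simp_all add: sm)
  next
    fix U V :: "'a set" and f :: "'a \<Rightarrow> 'c"
    assume V: "open V" "V \<subseteq> U" and f: "f \<in> smooth_functions \<A> U"
    have "smooth_on (\<phi> ` (V \<inter> W)) (cut V f \<circ> inv_into W \<phi>)" if W: "(W, \<phi>) \<in> \<A>" for W \<phi>
    proof (rule cuteq[OF V(1) W])
      have "C_on k (\<phi> ` (U \<inter> W)) (f \<circ> inv_into W \<phi>)" for k
        using f W unfolding sm smooth_on_def by simp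
      then show "smooth_on (\<phi> ` (V \<inter> W)) (f \<circ> inv_into W \<phi>)"
        using V(2) unfolding smooth_on_def by (meson C_on_subset Int_mono image_mono order_refl)
    qed
    then show "cut V f \<in> smooth_functions \<A> V"
      unfolding sm by (simp add: cut_def)
  qed
qed

section \<open>Tensor products of modules\<close>

locale module_pair =
  fixes R :: "'r ring" and M :: "('r, 'm) module" and N :: "('r, 'n) module"
  assumes module_left: "module R M" and module_right: "module R N"
begin

abbreviation "basis \<equiv> carrier M \<times> carrier N"

text \<open>An induction principle for relations. Closure of Q is asked for in the form of
  differences, which covers both products and inverses in the generated subgroup.\<close>

lemma tensor_relations_subset:
  assumes zero: "0 \<in> Q" and diff: "\<And>v w. v \<in> Q \<Longrightarrow> w \<in> Q \<Longrightarrow> v - w \<in> Q"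
    and left: "\<And>m m' n. m \<in> carrier M \<Longrightarrow> m' \<in> carrier M \<Longrightarrow> n \<in> carrier N \<Longrightarrow>
      frag_of (m \<oplus>\<^bsub>M\<^esub> m', n) - frag_of (m, n) - frag_of (m', n) \<in> Q"
    and right: "\<And>m n n'. m \<in> carrier M \<Longrightarrow> n \<in> carrier N \<Longrightarrow> n' \<in> carrier N \<Longrightarrow>
      frag_of (m, n \<oplus>\<^bsub>N\<^esub> n') - frag_of (m, n) - frag_of (m, n') \<in> Q"
    and scalar: "\<And>r m n. r \<in> carrier R \<Longrightarrow> m \<in> carrier M \<Longrightarrow> n \<in> carrier N \<Longrightarrow>
      frag_of (r \<odot>\<^bsub>M\<^esub> m, n) - frag_of (m, r \<odot>\<^bsub>N\<^esub> n) \<in> Q"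
  shows "tensor_relations R M N \<subseteq> Q"
proof
  fix w assume "w \<in> tensor_relations R M N"
  interpret M: module R M by (rule module_left)
  interpret N: module R N by (rule module_right)
  have k: "Poly_Mapping.keys (u - v) \<subseteq> basis"
    if "Poly_Mapping.keys u \<subseteq> basis" "Poly_Mapping.keys v \<subseteq> basis" for u v :: "'m \<times> 'n \<Rightarrow>\<^sub>0 int"
    using keys_diff[of u v] that by blast
  from \<open>w \<in> tensor_relations R M N\<close> show "w \<in> Q"
    unfolding tensor_relations_def
  proof (induction rule: generate.induct)
    case one
    then show ?case using zero by simp
  next
    case (incl h)
    then show ?case
      by (elim UnE CollectE exE conjE) (simp_all only: left right scalar)
  next
    case (inv h)
    \<comment> \<open>The inverse in \<open>free_Abelian_group\<close> is negation only on its
      carrier, so the support of the generator is tracked together with its membership in Q.\<close>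
    then have "h \<in> Q \<and> Poly_Mapping.keys h \<subseteq> basis"
    proof (elim UnE CollectE exE conjE, goal_cases)
      case 1
      then show ?case by (simp only: left) (intro conjI TrueI k; simp)
    next
      case 2
      then show ?case by (simp only: right) (intro conjI TrueI k; simp)
    next
      case 3
      then show ?case by (simp only: scalar) (intro conjI TrueI k; simp)
    qed
    then show ?case using diff[OF zero, of h] by simp
  next
    case (eng v w)
    have "- w \<in> Q" using diff[OF zero, of w] eng by simp
    then show ?case using diff[of v "- w"] eng by simp
  qed
qed

lemma keys_tensor_relations: "w \<in> tensor_relations R M N \<Longrightarrow> Poly_Mapping.keys w \<subseteq> basis"
proof -
  interpret M: module R M by (rule module_left)
  interpret N: module R N by (rule module_right)
  have k: "Poly_Mapping.keys (u - v) \<subseteq> basis" if "Poly_Mapping.keys u \<subseteq> basis" "Poly_Mapping.keys v \<subseteq> basis" for u v :: "'m \<times> 'n \<Rightarrow>\<^sub>0 int"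
    using keys_diff[of u v] that by blast
  have "tensor_relations R M N \<subseteq> {w. Poly_Mapping.keys w \<subseteq> basis}"
    by (rule tensor_relations_subset; (simp; fail)?; intro CollectI k) simp_all
  then show "w \<in> tensor_relations R M N \<Longrightarrow> Poly_Mapping.keys w \<subseteq> basis" by blast
qed

lemma tensor_relations_zero: "0 \<in> tensor_relations R M N"
  using generate.one[of "free_Abelian_group basis"] by (simp add: tensor_relations_def)

lemma tensor_relations_add:
  "v \<in> tensor_relations R M N \<Longrightarrow> w \<in> tensor_relations R M N \<Longrightarrow> v + w \<in> tensor_relations R M N"
  using generate.eng[of v "free_Abelian_group basis"] by (simp add: tensor_relations_def)

text \<open>\<open>generate\<close> adds inverses of generators only. Closure of the generated set
  under inverses is a fact about groups whose generators lie in the carrier, hence the detour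
  through \<open>keys_tensor_relations\<close>.\<close>

lemma tensor_relations_uminus:
  assumes "w \<in> tensor_relations R M N"
  shows "- w \<in> tensor_relations R M N"
proof -
  interpret FG: group "free_Abelian_group basis" by simp
  let ?G = "{frag_of (m \<oplus>\<^bsub>M\<^esub> m', n) - frag_of (m, n) - frag_of (m', n) | m m' n.
            m \<in> carrier M \<and> m' \<in> carrier M \<and> n \<in> carrier N} \<union>
        {frag_of (m, n \<oplus>\<^bsub>N\<^esub> n') - frag_of (m, n) - frag_of (m, n') | m n n'.
            m \<in> carrier M \<and> n \<in> carrier N \<and> n' \<in> carrier N} \<union>
        {frag_of (r \<odot>\<^bsub>M\<^esub> m, n) - frag_of (m, r \<odot>\<^bsub>N\<^esub> n) | r m n.
            r \<in> carrier R \<and> m \<in> carrier M \<and> n \<in> carrier N}"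
  have "?G \<subseteq> tensor_relations R M N"
    unfolding tensor_relations_def by (intro subsetI generate.incl)
  from subsetD[OF this] have "?G \<subseteq> carrier (free_Abelian_group basis)"
    unfolding subset_iff[of ?G] carrier_free_Abelian_group_iff by (intro allI impI keys_tensor_relations)
  from FG.generate_m_inv_closed[OF this] have "inv\<^bsub>free_Abelian_group basis\<^esub> w \<in> tensor_relations R M N"
    using assms unfolding tensor_relations_def by blast
  then show ?thesis using keys_tensor_relations[OF assms] by simp
qed

lemma tensor_relations_diff:
  "v \<in> tensor_relations R M N \<Longrightarrow> w \<in> tensor_relations R M N \<Longrightarrow> v - w \<in> tensor_relations R M N"
  using tensor_relations_add[OF _ tensor_relations_uminus, of v w] by simp

lemma tensor_relations_generators:
  "m \<in> carrier M \<Longrightarrow> m' \<in> carrier M \<Longrightarrow> n \<in> carrier N \<Longrightarrow>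
     frag_of (m \<oplus>\<^bsub>M\<^esub> m', n) - frag_of (m, n) - frag_of (m', n) \<in> tensor_relations R M N"
  "m \<in> carrier M \<Longrightarrow> n \<in> carrier N \<Longrightarrow> n' \<in> carrier N \<Longrightarrow>
     frag_of (m, n \<oplus>\<^bsub>N\<^esub> n') - frag_of (m, n) - frag_of (m, n') \<in> tensor_relations R M N"
  "r \<in> carrier R \<Longrightarrow> m \<in> carrier M \<Longrightarrow> n \<in> carrier N \<Longrightarrow>
     frag_of (r \<odot>\<^bsub>M\<^esub> m, n) - frag_of (m, r \<odot>\<^bsub>N\<^esub> n) \<in> tensor_relations R M N"
  unfolding tensor_relations_def
    apply (rule generate.incl, rule UnI1, rule UnI1, rule CollectI, intro exI conjI, rule refl, assumption+)
   apply (rule generate.incl, rule UnI1, rule UnI2, rule CollectI, intro exI conjI, rule refl, assumption+)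
  apply (rule generate.incl, rule UnI2, rule CollectI, intro exI conjI, rule refl, assumption+)
  done

lemma tensor_class_eq: "tensor_class R M N w = (\<lambda>v. v + w) ` tensor_relations R M N"
  by (auto simp: tensor_class_def r_coset_def)

lemma tensor_class_self: "w \<in> tensor_class R M N w"
  unfolding tensor_class_eq using tensor_relations_zero by force

text \<open>The bridge for all computations with tensors: an equality of cosets becomes membership
  in the subgroup, where the generators can be cited.\<close>

lemma tensor_class_eq_iff:
  "tensor_class R M N v = tensor_class R M N w \<longleftrightarrow> v - w \<in> tensor_relations R M N"
proof
  assume "tensor_class R M N v = tensor_class R M N w"
  then have "v \<in> tensor_class R M N w" using tensor_class_self by blast
  then show "v - w \<in> tensor_relations R M N" by (auto simp: tensor_class_eq)
next
  have sub: "tensor_class R M N v \<subseteq> tensor_class R M N w" if "v - w \<in> tensor_relations R M N" for v w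
  proof
    fix u assume "u \<in> tensor_class R M N v"
    then obtain r where r: "r \<in> tensor_relations R M N" "u = r + v" by (auto simp: tensor_class_eq)
    then have "u = (r + (v - w)) + w" "r + (v - w) \<in> tensor_relations R M N"
      using that by (simp_all add: tensor_relations_add)
    then show "u \<in> tensor_class R M N w" unfolding tensor_class_eq by blast
  qed
  assume *: "v - w \<in> tensor_relations R M N"
  then have "w - v \<in> tensor_relations R M N" using tensor_relations_uminus by fastforce
  with * show "tensor_class R M N v = tensor_class R M N w" using sub by blast
qed

lemma mem_tensor_class: "v \<in> tensor_class R M N w \<Longrightarrow> tensor_class R M N v = tensor_class R M N w"
  unfolding tensor_class_eq_iff by (auto simp: tensor_class_eq)

lemma carrier_tensor_product:
  "carrier (tensor_product R M N) = tensor_class R M N ` {w. Poly_Mapping.keys w \<subseteq> basis}"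
  by (auto simp: tensor_product_def RCOSETS_def tensor_class_def)

lemma tensor_class_closed:
  "Poly_Mapping.keys w \<subseteq> basis \<Longrightarrow> tensor_class R M N w \<in> carrier (tensor_product R M N)"
  by (auto simp: carrier_tensor_product)

lemma tensor_product_cases:
  assumes "C \<in> carrier (tensor_product R M N)"
  obtains w where "Poly_Mapping.keys w \<subseteq> basis" "C = tensor_class R M N w"
  using assms by (auto simp: carrier_tensor_product)

lemma tensor_product_zero: "\<zero>\<^bsub>tensor_product R M N\<^esub> = tensor_class R M N 0"
  by (simp add: tensor_product_def tensor_class_eq)

lemma tensor_product_add:
  "tensor_class R M N v \<oplus>\<^bsub>tensor_product R M N\<^esub> tensor_class R M N w = tensor_class R M N (v + w)"
proof -
  have "x + v + (y + w) \<in> tensor_class R M N (v + w)"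
    if "x \<in> tensor_relations R M N" "y \<in> tensor_relations R M N" for x y
    using tensor_relations_add[OF that] by (auto simp: tensor_class_eq algebra_simps intro!: image_eqI[of _ _ "x + y"])
  \<comment> \<open>A relation in the sum is split as itself in the first factor and 0 in the
    second.\<close>
  moreover have "\<exists>y\<in>tensor_relations R M N. \<exists>z\<in>tensor_relations R M N. x + (v + w) = y + v + (z + w)"
    if "x \<in> tensor_relations R M N" for x
    using that tensor_relations_zero by (intro bexI[of _ x] bexI[of _ 0]) (simp_all add: algebra_simps)
  ultimately show ?thesis
    by (fastforce simp: tensor_product_def set_mult_def tensor_class_eq[of v] tensor_class_eq[of w]
        tensor_class_eq[of "v + w"])
qed

lemma abelian_group_tensor_product: "abelian_group (tensor_product R M N)"
proof (rule abelian_groupI)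
  note add_keys = order_trans[OF keys_add Un_least]
  fix x y assume x: "x \<in> carrier (tensor_product R M N)"
  show "\<exists>y\<in>carrier (tensor_product R M N). y \<oplus>\<^bsub>tensor_product R M N\<^esub> x = \<zero>\<^bsub>tensor_product R M N\<^esub>"
  proof -
    obtain w where w: "Poly_Mapping.keys w \<subseteq> basis" "x = tensor_class R M N w"
      using x by (rule tensor_product_cases)
    then show ?thesis
      by (intro bexI[of _ "tensor_class R M N (- w)"])
         (simp_all add: tensor_product_add tensor_product_zero tensor_class_closed)
  qed
  show "\<zero>\<^bsub>tensor_product R M N\<^esub> \<oplus>\<^bsub>tensor_product R M N\<^esub> x = x"
    using x by (rule tensor_product_cases) (simp add: tensor_product_add tensor_product_zero)
  assume y: "y \<in> carrier (tensor_product R M N)"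
  obtain v w where vw: "Poly_Mapping.keys v \<subseteq> basis" "x = tensor_class R M N v"
    "Poly_Mapping.keys w \<subseteq> basis" "y = tensor_class R M N w"
    using x y by (elim tensor_product_cases)
  then show "x \<oplus>\<^bsub>tensor_product R M N\<^esub> y \<in> carrier (tensor_product R M N)"
    by (simp add: tensor_product_add tensor_class_closed add_keys)
  show "x \<oplus>\<^bsub>tensor_product R M N\<^esub> y = y \<oplus>\<^bsub>tensor_product R M N\<^esub> x"
    using vw by (simp add: tensor_product_add add.commute)
  fix z assume "z \<in> carrier (tensor_product R M N)"
  then show "x \<oplus>\<^bsub>tensor_product R M N\<^esub> y \<oplus>\<^bsub>tensor_product R M N\<^esub> z =
      x \<oplus>\<^bsub>tensor_product R M N\<^esub> (y \<oplus>\<^bsub>tensor_product R M N\<^esub> z)"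
    by (rule tensor_product_cases) (simp add: vw tensor_product_add add.assoc)
qed (simp add: tensor_product_zero tensor_class_closed)

lemma tensor_class_pure:
  "m \<in> carrier M \<Longrightarrow> m' \<in> carrier M \<Longrightarrow> n \<in> carrier N \<Longrightarrow>
     tensor_class R M N (frag_of (m \<oplus>\<^bsub>M\<^esub> m', n)) =
     tensor_class R M N (frag_of (m, n)) \<oplus>\<^bsub>tensor_product R M N\<^esub> tensor_class R M N (frag_of (m', n))"
  "m \<in> carrier M \<Longrightarrow> n \<in> carrier N \<Longrightarrow> n' \<in> carrier N \<Longrightarrow>
     tensor_class R M N (frag_of (m, n \<oplus>\<^bsub>N\<^esub> n')) =
     tensor_class R M N (frag_of (m, n)) \<oplus>\<^bsub>tensor_product R M N\<^esub> tensor_class R M N (frag_of (m, n'))"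
  "r \<in> carrier R \<Longrightarrow> m \<in> carrier M \<Longrightarrow> n \<in> carrier N \<Longrightarrow>
     tensor_class R M N (frag_of (r \<odot>\<^bsub>M\<^esub> m, n)) = tensor_class R M N (frag_of (m, r \<odot>\<^bsub>N\<^esub> n))"
  using tensor_relations_generators unfolding tensor_product_add tensor_class_eq_iff
  by (simp_all add: diff_diff_add)

text \<open>Every element of the free abelian group arises from basis elements by repeated
  subtraction; differences cover sums and negative coefficients alike.\<close>

lemma tensor_product_induct [consumes 1, case_names pure zero diff]:
  assumes "Poly_Mapping.keys w \<subseteq> basis"
    and "\<And>m n. m \<in> carrier M \<Longrightarrow> n \<in> carrier N \<Longrightarrow> P (frag_of (m, n))"
    and "P 0"
    and "\<And>v w. Poly_Mapping.keys v \<subseteq> basis \<Longrightarrow> Poly_Mapping.keys w \<subseteq> basis \<Longrightarrow> P v \<Longrightarrow> P w \<Longrightarrow> P (v - w)"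
  shows "P w"
  using assms(1) by (rule free_Abelian_group_induct) (use assms(2-) in auto)

text \<open>The map b extends freely to the free abelian group. Biadditivity and balance say that
  the extension kills the three kinds of generators, so it descends to cosets. The target is an
  abelian group and the induced map additive, rather than a module and linear, because the extension
  of a connection is not linear.\<close>

lemma tensor_product_universal:
  assumes H: "abelian_group H"
    and b: "\<And>m n. m \<in> carrier M \<Longrightarrow> n \<in> carrier N \<Longrightarrow> b m n \<in> carrier H"
    and bl: "\<And>m m' n. m \<in> carrier M \<Longrightarrow> m' \<in> carrier M \<Longrightarrow> n \<in> carrier N \<Longrightarrow>
      b (m \<oplus>\<^bsub>M\<^esub> m') n = b m n \<oplus>\<^bsub>H\<^esub> b m' n"
    and br: "\<And>m n n'. m \<in> carrier M \<Longrightarrow> n \<in> carrier N \<Longrightarrow> n' \<in> carrier N \<Longrightarrow>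
      b m (n \<oplus>\<^bsub>N\<^esub> n') = b m n \<oplus>\<^bsub>H\<^esub> b m n'"
    and bs: "\<And>r m n. r \<in> carrier R \<Longrightarrow> m \<in> carrier M \<Longrightarrow> n \<in> carrier N \<Longrightarrow>
      b (r \<odot>\<^bsub>M\<^esub> m) n = b m (r \<odot>\<^bsub>N\<^esub> n)"
  obtains \<phi> where "\<phi> \<in> carrier (tensor_product R M N) \<rightarrow> carrier H"
    "\<forall>C\<in>carrier (tensor_product R M N). \<forall>C'\<in>carrier (tensor_product R M N).
      \<phi> (C \<oplus>\<^bsub>tensor_product R M N\<^esub> C') = \<phi> C \<oplus>\<^bsub>H\<^esub> \<phi> C'"
    "\<forall>m\<in>carrier M. \<forall>n\<in>carrier N. \<phi> (tensor_class R M N (frag_of (m, n))) = b m n"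
proof -
  interpret H: abelian_group H by (rule H)
  interpret M: module R M by (rule module_left)
  interpret N: module R N by (rule module_right)
  have "(\<lambda>(m, n). b m n) ` basis \<subseteq> carrier (add_monoid H)" using b by auto
  from comm_group.free_Abelian_group_universal[OF H.a_comm_group this]
  obtain h where h: "h \<in> hom (free_Abelian_group basis) (add_monoid H)"
    "\<And>x. x \<in> basis \<Longrightarrow> h (frag_of x) = (\<lambda>(m, n). b m n) x" by blast
  have h_cl: "h w \<in> carrier H" if "Poly_Mapping.keys w \<subseteq> basis" for w
    using hom_in_carrier[OF h(1)] that by simp
  have h_add: "h (v + w) = h v \<oplus>\<^bsub>H\<^esub> h w" if "Poly_Mapping.keys v \<subseteq> basis" "Poly_Mapping.keys w \<subseteq> basis" for v w
    using hom_mult[OF h(1), of v w] that by simp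
  have keys: "Poly_Mapping.keys (v - w) \<subseteq> basis"
    if "Poly_Mapping.keys v \<subseteq> basis" "Poly_Mapping.keys w \<subseteq> basis" for v w :: "'m \<times> 'n \<Rightarrow>\<^sub>0 int"
    using keys_diff[of v w] that by blast
  have h_diff: "h (v - w) = h v \<ominus>\<^bsub>H\<^esub> h w" if "Poly_Mapping.keys v \<subseteq> basis" "Poly_Mapping.keys w \<subseteq> basis" for v w
  proof -
    have "h v = h (v - w) \<oplus>\<^bsub>H\<^esub> h w" using h_add[OF keys[OF that] that(2)] by simp
    then show ?thesis using h_cl that keys[OF that] by (simp add: H.minus_eq H.a_assoc H.r_neg)
  qed
  have h0: "h 0 = \<zero>\<^bsub>H\<^esub>" using h_diff[of 0 0] h_cl[of 0] by (simp add: H.minus_eq H.r_neg)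
  \<comment> \<open>Once b is expanded, h takes this form, x + y - x - y, on a generator expressing
    additivity.\<close>
  have zero: "x \<oplus>\<^bsub>H\<^esub> y \<oplus>\<^bsub>H\<^esub> \<ominus>\<^bsub>H\<^esub> x \<oplus>\<^bsub>H\<^esub> \<ominus>\<^bsub>H\<^esub> y = \<zero>\<^bsub>H\<^esub>" if "x \<in> carrier H" "y \<in> carrier H" for x y
    using that by (simp add: H.a_comm[of "x \<oplus>\<^bsub>H\<^esub> y" "\<ominus>\<^bsub>H\<^esub> x"] H.r_neg1 H.r_neg)
  have kill: "tensor_relations R M N \<subseteq> {w. Poly_Mapping.keys w \<subseteq> basis \<and> h w = \<zero>\<^bsub>H\<^esub>}"
    by (rule tensor_relations_subset)
       (auto simp: h0 h_diff keys h_cl h(2) b bl br bs zero H.minus_eq H.r_neg simp del: Un_subset_iff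
         dest: subsetD[OF keys_diff])
  \<comment> \<open>A representative supported in the basis is chosen; \<open>kill\<close> shows
    that the value of h does not depend on it.\<close>
  define \<phi> where "\<phi> = (\<lambda>C. h (SOME w. Poly_Mapping.keys w \<subseteq> basis \<and> C = tensor_class R M N w))"
  have \<phi>: "\<phi> (tensor_class R M N w) = h w" if w: "Poly_Mapping.keys w \<subseteq> basis" for w
  proof -
    define v where "v = (SOME v. Poly_Mapping.keys v \<subseteq> basis \<and> tensor_class R M N w = tensor_class R M N v)"
    have v: "Poly_Mapping.keys v \<subseteq> basis \<and> tensor_class R M N w = tensor_class R M N v"
      unfolding v_def by (rule someI[of _ w]) (use w in simp)
    then have "w - v \<in> tensor_relations R M N" by (simp add: tensor_class_eq_iff)
    then have "h (w - v) = \<zero>\<^bsub>H\<^esub>" using kill by blast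
    moreover have "h w = h (w - v) \<oplus>\<^bsub>H\<^esub> h v" using h_add[OF keys[OF w] , of v v] v by simp
    ultimately have "h w = h v" using v h_cl by simp
    then show ?thesis by (simp add: \<phi>_def v_def)
  qed
  show ?thesis
  proof (rule that)
    show "\<phi> \<in> carrier (tensor_product R M N) \<rightarrow> carrier H"
      by (auto simp: \<phi> h_cl elim!: tensor_product_cases)
    show "\<forall>C\<in>carrier (tensor_product R M N). \<forall>C'\<in>carrier (tensor_product R M N).
      \<phi> (C \<oplus>\<^bsub>tensor_product R M N\<^esub> C') = \<phi> C \<oplus>\<^bsub>H\<^esub> \<phi> C'"
    proof (intro ballI)
      fix C C' assume C: "C \<in> carrier (tensor_product R M N)" "C' \<in> carrier (tensor_product R M N)"
      obtain v w where vw: "Poly_Mapping.keys v \<subseteq> basis" "C = tensor_class R M N v"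
        "Poly_Mapping.keys w \<subseteq> basis" "C' = tensor_class R M N w"
        using C by (elim tensor_product_cases)
      moreover have "Poly_Mapping.keys (v + w) \<subseteq> basis" using vw keys_add[of v w] by blast
      ultimately show "\<phi> (C \<oplus>\<^bsub>tensor_product R M N\<^esub> C') = \<phi> C \<oplus>\<^bsub>H\<^esub> \<phi> C'"
        by (simp add: tensor_product_add \<phi> h_add)
    qed
    show "\<forall>m\<in>carrier M. \<forall>n\<in>carrier N. \<phi> (tensor_class R M N (frag_of (m, n))) = b m n"
      by (simp add: \<phi> h(2))
  qed
qed

end

text \<open>
  The maps \<open>\<mu>\<close> and \<open>\<nu>\<close> may be semilinear over \<open>\<rho>\<close>; this covers both the scalar multiplication
  of \<open>tensor_product\<close> and the restriction maps of \<open>tensor_presheaf\<close>.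
\<close>

locale module_pair_map =
  dom: module_pair R M N + cod: module_pair R' M' N'
  for R :: "'r ring" and M :: "('r, 'm) module" and N :: "('r, 'n) module"
    and R' :: "'r ring" and M' :: "('r, 'm) module" and N' :: "('r, 'n) module" +
  fixes \<mu> \<nu> \<rho>
  assumes \<mu>_closed: "m \<in> carrier M \<Longrightarrow> \<mu> m \<in> carrier M'"
    and \<nu>_closed: "n \<in> carrier N \<Longrightarrow> \<nu> n \<in> carrier N'"
    and \<rho>_closed: "r \<in> carrier R \<Longrightarrow> \<rho> r \<in> carrier R'"
    and \<mu>_add: "m \<in> carrier M \<Longrightarrow> m' \<in> carrier M \<Longrightarrow> \<mu> (m \<oplus>\<^bsub>M\<^esub> m') = \<mu> m \<oplus>\<^bsub>M'\<^esub> \<mu> m'"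
    and \<nu>_add: "n \<in> carrier N \<Longrightarrow> n' \<in> carrier N \<Longrightarrow> \<nu> (n \<oplus>\<^bsub>N\<^esub> n') = \<nu> n \<oplus>\<^bsub>N'\<^esub> \<nu> n'"
    and \<mu>_smult: "r \<in> carrier R \<Longrightarrow> m \<in> carrier M \<Longrightarrow> \<mu> (r \<odot>\<^bsub>M\<^esub> m) = \<rho> r \<odot>\<^bsub>M'\<^esub> \<mu> m"
    and \<nu>_smult: "r \<in> carrier R \<Longrightarrow> n \<in> carrier N \<Longrightarrow> \<nu> (r \<odot>\<^bsub>N\<^esub> n) = \<rho> r \<odot>\<^bsub>N'\<^esub> \<nu> n"
begin

definition frag_map :: "('m \<times> 'n \<Rightarrow>\<^sub>0 int) \<Rightarrow> 'm \<times> 'n \<Rightarrow>\<^sub>0 int" where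
  "frag_map = frag_extend (\<lambda>(m, n). frag_of (\<mu> m, \<nu> n))"

lemma frag_map_of: "frag_map (frag_of (m, n)) = frag_of (\<mu> m, \<nu> n)"
  by (simp add: frag_map_def)

lemma frag_map_diff: "frag_map (v - w) = frag_map v - frag_map w"
  by (simp add: frag_map_def frag_extend_diff)

lemma keys_frag_map:
  "Poly_Mapping.keys w \<subseteq> carrier M \<times> carrier N \<Longrightarrow>
    Poly_Mapping.keys (frag_map w) \<subseteq> carrier M' \<times> carrier N'"
  unfolding frag_map_def
  by (rule order_trans[OF keys_frag_extend]) (auto simp: \<mu>_closed \<nu>_closed)

text \<open>Generators go to generators: the one for a scalar r is sent to the one for
  \<open>\<rho> r\<close>, which is why both maps are semilinear over the same \<rho>.\<close>

lemma frag_map_relations: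
  assumes "w \<in> tensor_relations R M N"
  shows "frag_map w \<in> tensor_relations R' M' N'"
proof -
  have "tensor_relations R M N \<subseteq> {w. frag_map w \<in> tensor_relations R' M' N'}"
  proof (rule dom.tensor_relations_subset; intro CollectI)
    show "frag_map 0 \<in> tensor_relations R' M' N'"
      by (simp add: frag_map_def cod.tensor_relations_zero)
  next
    fix v w
    assume "v \<in> {w. frag_map w \<in> tensor_relations R' M' N'}" "w \<in> {w. frag_map w \<in> tensor_relations R' M' N'}"
    then show "frag_map (v - w) \<in> tensor_relations R' M' N'"
      by (simp add: frag_map_diff cod.tensor_relations_diff)
  qed (simp_all only: frag_map_diff frag_map_of \<mu>_add \<nu>_add \<mu>_smult \<nu>_smult
      \<mu>_closed \<nu>_closed \<rho>_closed cod.tensor_relations_generators)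
  then show ?thesis using assms by blast
qed

text \<open>This justifies the unions in \<open>tensor_product\<close> and
  \<open>tensor_presheaf\<close>: the representatives of a class all contribute one coset, and the
  class is not empty.\<close>

lemma tensor_class_frag_map:
  "(\<Union>v\<in>tensor_class R M N w. tensor_class R' M' N' (frag_map v)) = tensor_class R' M' N' (frag_map w)"
proof -
  have "tensor_class R' M' N' (frag_map v) = tensor_class R' M' N' (frag_map w)"
    if "v \<in> tensor_class R M N w" for v
    using dom.mem_tensor_class[OF that] frag_map_relations
    by (auto simp: dom.tensor_class_eq_iff cod.tensor_class_eq_iff frag_map_diff[symmetric])
  then show ?thesis using dom.tensor_class_self by blast
qed

end

section \<open>The module structure on the tensor product\<close>

context module_pair begin

text \<open>Scaling the left factor alone respects the balance relations because R is commutative;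
  here \<rho> is the identity.\<close>

lemma module_pair_map_smult:
  assumes "r \<in> carrier R"
  shows "module_pair_map R M N R M N (smult M r) (\<lambda>n. n) (\<lambda>r. r)"
proof -
  interpret M: module R M by (rule module_left)
  have "r \<odot>\<^bsub>M\<^esub> (r' \<odot>\<^bsub>M\<^esub> m) = r' \<odot>\<^bsub>M\<^esub> (r \<odot>\<^bsub>M\<^esub> m)"
    if "r' \<in> carrier R" "m \<in> carrier M" for r' m
    using assms that by (metis M.smult_assoc1 M.R.m_comm)
  then show ?thesis
    using assms by (intro module_pair_map.intro module_pair_axioms module_pair_map_axioms.intro)
      (simp_all add: M.smult_r_distr)
qed

lemma tensor_product_smult:
  assumes "r \<in> carrier R"
  shows "r \<odot>\<^bsub>tensor_product R M N\<^esub> tensor_class R M N w =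
    tensor_class R M N (frag_extend (\<lambda>(m, n). frag_of (r \<odot>\<^bsub>M\<^esub> m, n)) w)"
proof -
  interpret s: module_pair_map R M N R M N "smult M r" "\<lambda>n. n" "\<lambda>r. r"
    using assms by (rule module_pair_map_smult)
  show ?thesis using s.tensor_class_frag_map[of w] by (simp add: tensor_product_def s.frag_map_def)
qed

lemma module_tensor_product: "module R (tensor_product R M N)"
proof -
  interpret M: module R M by (rule module_left)
  let ?T = "tensor_product R M N" and ?c = "tensor_class R M N"
  let ?s = "\<lambda>r. frag_extend (\<lambda>(m, n). frag_of (r \<odot>\<^bsub>M\<^esub> m, n))"
  show ?thesis
  proof (rule moduleI)
    show "cring R" by (rule M.R.is_cring)
    show "abelian_group ?T" by (rule abelian_group_tensor_product)
    {
      fix r x assume r: "r \<in> carrier R" and "x \<in> carrier ?T"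
      interpret s: module_pair_map R M N R M N "smult M r" "\<lambda>n. n" "\<lambda>r. r"
        using r by (rule module_pair_map_smult)
      obtain w where w: "Poly_Mapping.keys w \<subseteq> basis" "x = ?c w"
        using \<open>x \<in> carrier ?T\<close> by (rule tensor_product_cases)
      show "r \<odot>\<^bsub>?T\<^esub> x \<in> carrier ?T"
        unfolding w(2) tensor_product_smult[OF r]
        using s.keys_frag_map[OF w(1)] unfolding s.frag_map_def by (rule tensor_class_closed)
    }
    fix r r' x assume r: "r \<in> carrier R" and r': "r' \<in> carrier R" and x: "x \<in> carrier ?T"
    obtain w where w: "Poly_Mapping.keys w \<subseteq> basis" "x = ?c w"
      using x by (rule tensor_product_cases)
    \<comment> \<open>Distributivity over the addition of scalars holds only modulo relations: on a
      basis element the defect is an additivity relation in the left factor.\<close>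
    have "?s (r \<oplus>\<^bsub>R\<^esub> r') w - (?s r w + ?s r' w) \<in> tensor_relations R M N"
      using w(1)
    proof (induction rule: tensor_product_induct)
      case (pure m n)
      then show ?case
        using tensor_relations_generators(1)[of "r \<odot>\<^bsub>M\<^esub> m" "r' \<odot>\<^bsub>M\<^esub> m" n] r r'
        by (simp add: M.smult_l_distr diff_diff_add)
    next
      case (diff v w)
      have "?s (r \<oplus>\<^bsub>R\<^esub> r') (v - w) - (?s r (v - w) + ?s r' (v - w)) =
        (?s (r \<oplus>\<^bsub>R\<^esub> r') v - (?s r v + ?s r' v)) - (?s (r \<oplus>\<^bsub>R\<^esub> r') w - (?s r w + ?s r' w))"
        by (simp add: frag_extend_diff)
      then show ?case using tensor_relations_diff[OF diff(3,4)] by simp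
    qed (simp add: tensor_relations_zero)
    then show "(r \<oplus>\<^bsub>R\<^esub> r') \<odot>\<^bsub>?T\<^esub> x = r \<odot>\<^bsub>?T\<^esub> x \<oplus>\<^bsub>?T\<^esub> r' \<odot>\<^bsub>?T\<^esub> x"
      using r r' by (simp add: w tensor_product_smult tensor_product_add tensor_class_eq_iff)
    \<comment> \<open>Compatibility with products of scalars holds already in the free abelian
      group, before passing to cosets.\<close>
    have "?s (r \<otimes>\<^bsub>R\<^esub> r') w = ?s r (?s r' w)"
      using w(1) by (induction rule: tensor_product_induct)
        (use r r' in \<open>simp_all add: M.smult_assoc1 frag_extend_diff\<close>)
    then show "(r \<otimes>\<^bsub>R\<^esub> r') \<odot>\<^bsub>?T\<^esub> x = r \<odot>\<^bsub>?T\<^esub> (r' \<odot>\<^bsub>?T\<^esub> x)"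
      using r r' by (simp add: w tensor_product_smult)
    fix y assume "y \<in> carrier ?T"
    then show "r \<odot>\<^bsub>?T\<^esub> (x \<oplus>\<^bsub>?T\<^esub> y) = r \<odot>\<^bsub>?T\<^esub> x \<oplus>\<^bsub>?T\<^esub> r \<odot>\<^bsub>?T\<^esub> y"
      using r by (auto simp: w tensor_product_smult tensor_product_add frag_extend_add elim!: tensor_product_cases)
  next
    fix x assume "x \<in> carrier (tensor_product R M N)"
    then obtain w where w: "Poly_Mapping.keys w \<subseteq> basis" "x = tensor_class R M N w"
      by (rule tensor_product_cases)
    have "frag_extend (\<lambda>(m, n). frag_of (\<one>\<^bsub>R\<^esub> \<odot>\<^bsub>M\<^esub> m, n)) w = w"
      using w(1) by (induction rule: tensor_product_induct) (simp_all add: frag_extend_diff)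
    then show "\<one>\<^bsub>R\<^esub> \<odot>\<^bsub>tensor_product R M N\<^esub> x = x"
      by (simp add: w tensor_product_smult)
  qed
qed

end

section \<open>Sheafification\<close>

lemma function_ring_simps [simp]:
  "carrier (function_ring A U) = A U"
  "f \<otimes>\<^bsub>function_ring A U\<^esub> g = (\<lambda>x. f x * g x)"
  "f \<oplus>\<^bsub>function_ring A U\<^esub> g = (\<lambda>x. f x + g x)"
  "\<one>\<^bsub>function_ring A U\<^esub> = cut U (\<lambda>x. 1)"
  "\<zero>\<^bsub>function_ring A U\<^esub> = (\<lambda>x. 0)"
  by (simp_all add: function_ring_def cut_def)

lemma cut_cut: "W \<subseteq> V \<Longrightarrow> cut W (cut V f) = cut W f"
  by (auto simp: cut_def fun_eq_iff)

context function_presheaf begin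

lemma cut_self: "open U \<Longrightarrow> f \<in> A U \<Longrightarrow> cut U f = f"
  using zero_outside by (fastforce simp: cut_def)

lemma zero_closed: "open U \<Longrightarrow> (\<lambda>x. 0) \<in> A U"
  using const_closed[of U 0] by (simp add: cut_def)

lemma scale_closed:
  assumes "open U" "f \<in> A U"
  shows "(\<lambda>x. c * f x) \<in> A U"
proof -
  \<comment> \<open>Off U both sides vanish because f does, so the cut-off constant acts as
    c.\<close>
  have "(\<lambda>x. cut U (\<lambda>x. c) x * f x) = (\<lambda>x. c * f x)"
    using zero_outside[OF assms] by (auto simp: cut_def)
  with mult_closed[OF assms(1) const_closed[OF assms(1)] assms(2), of c] show ?thesis by simp
qed

lemma uminus_closed: "open U \<Longrightarrow> f \<in> A U \<Longrightarrow> (\<lambda>x. - f x) \<in> A U"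
  using scale_closed[of U f "-1"] by simp

lemma cring_function_ring:
  assumes U: "open U"
  shows "cring (function_ring A U)"
proof (rule cringI)
  \<comment> \<open>The unit equals 1 on U only; it is neutral because the elements of
    \<open>A U\<close> vanish elsewhere.\<close>
  have one: "(\<lambda>x. cut U (\<lambda>x. 1) x * f x) = f" "(\<lambda>x. f x * cut U (\<lambda>x. 1) x) = f" if "f \<in> A U" for f
    using zero_outside[OF U that] by (auto simp: cut_def)
  show "abelian_group (function_ring A U)"
  proof (rule abelian_groupI)
    fix f assume "f \<in> carrier (function_ring A U)"
    then show "\<exists>g\<in>carrier (function_ring A U). g \<oplus>\<^bsub>function_ring A U\<^esub> f = \<zero>\<^bsub>function_ring A U\<^esub>"
      using U by (intro bexI[of _ "\<lambda>x. - f x"]) (simp_all add: uminus_closed)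
  qed (use U in \<open>simp_all add: add_closed zero_closed add_ac\<close>)
  show "comm_monoid (function_ring A U)"
    by (rule comm_monoidI) (use U in \<open>simp_all add: mult_closed const_closed one mult_ac\<close>)
qed (simp add: distrib_right)

end

section \<open>Presheaves of modules and the germs of their sections\<close>

locale module_presheaf_on = function_presheaf A
  for A :: "'p::topological_space set \<Rightarrow> ('p \<Rightarrow> 'k::field) set" +
  fixes P :: "('p, 'p \<Rightarrow> 'k, 's) module_presheaf"
  assumes presheaf: "presheaf_of_modules A P"
begin

lemma sect_module: "open U \<Longrightarrow> module (function_ring A U) (sect P U)"
  and res_id: "open U \<Longrightarrow> s \<in> carrier (sect P U) \<Longrightarrow> res P U U s = s"
  and res_closed: "open U \<Longrightarrow> open V \<Longrightarrow> V \<subseteq> U \<Longrightarrow> s \<in> carrier (sect P U) \<Longrightarrow>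
    res P U V s \<in> carrier (sect P V)"
  and res_add: "open U \<Longrightarrow> open V \<Longrightarrow> V \<subseteq> U \<Longrightarrow> s \<in> carrier (sect P U) \<Longrightarrow> t \<in> carrier (sect P U) \<Longrightarrow>
    res P U V (s \<oplus>\<^bsub>sect P U\<^esub> t) = res P U V s \<oplus>\<^bsub>sect P V\<^esub> res P U V t"
  and res_smult: "open U \<Longrightarrow> open V \<Longrightarrow> V \<subseteq> U \<Longrightarrow> g \<in> A U \<Longrightarrow> s \<in> carrier (sect P U) \<Longrightarrow>
    res P U V (g \<odot>\<^bsub>sect P U\<^esub> s) = cut V g \<odot>\<^bsub>sect P V\<^esub> res P U V s"
  and res_res: "open U \<Longrightarrow> open V \<Longrightarrow> open W \<Longrightarrow> W \<subseteq> V \<Longrightarrow> V \<subseteq> U \<Longrightarrow> s \<in> carrier (sect P U) \<Longrightarrow>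
    res P V W (res P U V s) = res P U W s"
  using presheaf unfolding presheaf_of_modules_def by (simp_all add: Pi_iff)

lemma sect_abelian_group: "open U \<Longrightarrow> abelian_group (sect P U)"
  using sect_module by (simp add: module_def)

lemma sect_add_closed: "open U \<Longrightarrow> s \<in> carrier (sect P U) \<Longrightarrow> t \<in> carrier (sect P U) \<Longrightarrow>
    s \<oplus>\<^bsub>sect P U\<^esub> t \<in> carrier (sect P U)"
  by (rule abelian_monoid.a_closed[OF abelian_group.axioms(1)[OF sect_abelian_group]])

lemma sect_zero_closed: "open U \<Longrightarrow> \<zero>\<^bsub>sect P U\<^esub> \<in> carrier (sect P U)"
  by (rule abelian_monoid.zero_closed[OF abelian_group.axioms(1)[OF sect_abelian_group]])

lemma sect_smult_closed: "open U \<Longrightarrow> g \<in> A U \<Longrightarrow> s \<in> carrier (sect P U) \<Longrightarrow>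
    g \<odot>\<^bsub>sect P U\<^esub> s \<in> carrier (sect P U)"
  using module.smult_closed[OF sect_module] by simp

lemma sect_smult_zero: "open U \<Longrightarrow> s \<in> carrier (sect P U) \<Longrightarrow> (\<lambda>x. 0) \<odot>\<^bsub>sect P U\<^esub> s = \<zero>\<^bsub>sect P U\<^esub>"
  using module.smult_l_null[OF sect_module] by simp

text \<open>The zero section is 0 times itself, so compatibility with scalars yields compatibility
  with zero.\<close>

lemma res_zero:
  assumes "open U" "open V" "V \<subseteq> U"
  shows "res P U V \<zero>\<^bsub>sect P U\<^esub> = \<zero>\<^bsub>sect P V\<^esub>"
proof -
  have "res P U V ((\<lambda>x. 0) \<odot>\<^bsub>sect P U\<^esub> \<zero>\<^bsub>sect P U\<^esub>) = cut V (\<lambda>x. 0) \<odot>\<^bsub>sect P V\<^esub> res P U V \<zero>\<^bsub>sect P U\<^esub>"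
    using assms by (simp add: res_smult zero_closed sect_zero_closed)
  moreover have "cut V (\<lambda>x. 0) = (\<lambda>x::'p. 0::'k)" by (auto simp: cut_def)
  ultimately show ?thesis
    using assms by (simp add: sect_smult_zero sect_zero_closed res_closed)
qed

lemma germ_self: "open V \<Longrightarrow> x \<in> V \<Longrightarrow> t \<in> carrier (sect P V) \<Longrightarrow> (V, t) \<in> germ P x V t"
  by (auto simp: germ_def)

text \<open>A germ is the full set of pairs equivalent to a given one. Equality is therefore
  transitivity of agreement near x, obtained by intersecting two neighbourhoods of agreement;
  symmetry gives the other inclusion.\<close>

lemma germ_eqI:
  assumes U: "open U" "s \<in> carrier (sect P U)" and V: "open V" "t \<in> carrier (sect P V)"
    and W: "open W" "x \<in> W" "W \<subseteq> U \<inter> V" "res P U W s = res P V W t"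
  shows "germ P x U s = germ P x V t"
proof -
  have sub: "germ P x U s \<subseteq> germ P x V t"
    if U: "open U" "s \<in> carrier (sect P U)" and V: "open V" "t \<in> carrier (sect P V)"
      and W: "open W" "x \<in> W" "W \<subseteq> U \<inter> V" "res P U W s = res P V W t" for U V s t
  proof (clarsimp simp: germ_def[of P x U s])
    fix V' u W' assume V': "open V'" "x \<in> V'" "u \<in> carrier (sect P V')"
      and W': "open W'" "x \<in> W'" "W' \<subseteq> U" "W' \<subseteq> V'" "res P U W' s = res P V' W' u"
    have "res P V (W \<inter> W') t = res P W (W \<inter> W') (res P V W t)"
      using V W W' by (simp add: res_res open_Int)
    also have "\<dots> = res P U (W \<inter> W') s"
      using U W W' by (simp add: W(4)[symmetric] res_res open_Int)
    also have "\<dots> = res P W' (W \<inter> W') (res P U W' s)"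
      using U W W' res_res[of U W' "W \<inter> W'" s] by (simp del: W'(5) add: open_Int)
    also have "\<dots> = res P V' (W \<inter> W') u"
      using V' W W' by (simp add: res_res open_Int)
    finally show "(V', u) \<in> germ P x V t"
      using V' W W' unfolding germ_def by (auto intro!: exI[of _ "W \<inter> W'"])
  qed
  show ?thesis
    using sub[OF U V W] sub[OF V U W(1,2) _ W(4)[symmetric]] W(3) by blast
qed

text \<open>The pair (V, t) lies in its own germ, hence in that of s, and membership there provides
  the neighbourhood.\<close>

lemma germ_eqD:
  assumes "germ P x U s = germ P x V t" "open V" "x \<in> V" "t \<in> carrier (sect P V)"
  obtains W where "open W" "x \<in> W" "W \<subseteq> U \<inter> V" "res P U W s = res P V W t"
  using germ_self[OF assms(2-4)] assms(1)[symmetric] by (auto simp: germ_def[of P x U s])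

lemma mem_germ:
  assumes "(V, t) \<in> germ P x U s"
  obtains W where "open V" "x \<in> V" "t \<in> carrier (sect P V)"
    "open W" "x \<in> W" "W \<subseteq> U \<inter> V" "res P U W s = res P V W t"
  using assms by (auto simp: germ_def)

lemma germ_res:
  assumes "open U" "open V" "V \<subseteq> U" "x \<in> V" "s \<in> carrier (sect P U)"
  shows "germ P x V (res P U V s) = germ P x U s"
  using assms by (intro germ_eqI[of _ _ _ _ V]) (auto simp: res_closed res_res res_id)

section \<open>Sections of the sheafification and their operations, germ by germ\<close>

lemma mem_sections:
  "\<sigma> \<in> carrier (sect (sheafification P) U) \<longleftrightarrow>
     (\<forall>x\<in>U. \<exists>V t. open V \<and> x \<in> V \<and> V \<subseteq> U \<and> t \<in> carrier (sect P V) \<and> (\<forall>y\<in>V. \<sigma> y = germ P y V t)) \<and>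
     (\<forall>x. x \<notin> U \<longrightarrow> \<sigma> x = {})"
  by (simp add: sheafification_def)

lemma sectionsI:
  assumes "\<And>x. x \<in> U \<Longrightarrow> \<exists>V t. open V \<and> x \<in> V \<and> V \<subseteq> U \<and> t \<in> carrier (sect P V) \<and> (\<forall>y\<in>V. \<sigma> y = germ P y V t)"
    and "\<And>x. x \<notin> U \<Longrightarrow> \<sigma> x = {}"
  shows "\<sigma> \<in> carrier (sect (sheafification P) U)"
  using assms by (simp add: mem_sections)

lemma section_outside: "\<sigma> \<in> carrier (sect (sheafification P) U) \<Longrightarrow> x \<notin> U \<Longrightarrow> \<sigma> x = {}"
  by (simp add: mem_sections)

lemma section_local:
  assumes "\<sigma> \<in> carrier (sect (sheafification P) U)" "x \<in> U"
  obtains V s where "open V" "x \<in> V" "V \<subseteq> U" "s \<in> carrier (sect P V)" "\<forall>y\<in>V. \<sigma> y = germ P y V s"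
  using assms unfolding mem_sections by metis

text \<open>Both local representatives are restricted to the intersection of their domains, so that
  operations on germs can be computed in a single module \<open>sect P V\<close>.\<close>

lemma section_local2:
  assumes "\<sigma> \<in> carrier (sect (sheafification P) U)" "\<tau> \<in> carrier (sect (sheafification P) U)" "x \<in> U"
  obtains V s t where "open V" "x \<in> V" "V \<subseteq> U" "s \<in> carrier (sect P V)" "t \<in> carrier (sect P V)"
    "\<forall>y\<in>V. \<sigma> y = germ P y V s" "\<forall>y\<in>V. \<tau> y = germ P y V t"
proof -
  obtain V s where V: "open V" "x \<in> V" "V \<subseteq> U" "s \<in> carrier (sect P V)" "\<forall>y\<in>V. \<sigma> y = germ P y V s"
    using section_local[OF assms(1,3)] .
  obtain W t where W: "open W" "x \<in> W" "W \<subseteq> U" "t \<in> carrier (sect P W)" "\<forall>y\<in>W. \<tau> y = germ P y W t"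
    using section_local[OF assms(2,3)] .
  show ?thesis
    by (rule that[of "V \<inter> W" "res P V (V \<inter> W) s" "res P W (V \<inter> W) t"])
       (use V W in \<open>auto simp: open_Int res_closed germ_res\<close>)
qed

lemma section_local3:
  assumes "\<sigma> \<in> carrier (sect (sheafification P) U)" "\<tau> \<in> carrier (sect (sheafification P) U)"
    "\<rho> \<in> carrier (sect (sheafification P) U)" "x \<in> U"
  obtains V s t r where "open V" "x \<in> V" "V \<subseteq> U" "s \<in> carrier (sect P V)" "t \<in> carrier (sect P V)"
    "r \<in> carrier (sect P V)" "\<sigma> x = germ P x V s" "\<tau> x = germ P x V t" "\<rho> x = germ P x V r"
proof -
  obtain V s t where V: "open V" "x \<in> V" "V \<subseteq> U" "s \<in> carrier (sect P V)" "t \<in> carrier (sect P V)"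
    "\<forall>y\<in>V. \<sigma> y = germ P y V s" "\<forall>y\<in>V. \<tau> y = germ P y V t"
    using section_local2[OF assms(1,2,4)] .
  obtain W r where W: "open W" "x \<in> W" "W \<subseteq> U" "r \<in> carrier (sect P W)" "\<forall>y\<in>W. \<rho> y = germ P y W r"
    using section_local[OF assms(3,4)] .
  show ?thesis
    by (rule that[of "V \<inter> W" "res P V (V \<inter> W) s" "res P V (V \<inter> W) t" "res P W (V \<inter> W) r"])
       (use V W in \<open>auto simp: open_Int res_closed germ_res\<close>)
qed

lemma section_eqI:
  assumes "\<sigma> \<in> carrier (sect (sheafification P) U)" "\<tau> \<in> carrier (sect (sheafification P) U)"
    "\<And>x. x \<in> U \<Longrightarrow> \<sigma> x = \<tau> x"
  shows "\<sigma> = \<tau>"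
proof
  fix x show "\<sigma> x = \<tau> x"
    using assms(3)[of x] section_outside[OF assms(1), of x] section_outside[OF assms(2), of x] by metis
qed

text \<open>The union defining addition runs over pairs of representatives. They agree with s and t
  near x, so each pair contributes the same germ and the union collapses.\<close>

lemma sheafification_add_germ:
  assumes V: "open V" "x \<in> V" "s \<in> carrier (sect P V)" "t \<in> carrier (sect P V)"
    and \<sigma>: "\<sigma> x = germ P x V s" and \<tau>: "\<tau> x = germ P x V t"
  shows "(\<sigma> \<oplus>\<^bsub>sect (sheafification P) U\<^esub> \<tau>) x = germ P x V (s \<oplus>\<^bsub>sect P V\<^esub> t)"
proof -
  have eq: "germ P x (V1 \<inter> V2) (res P V1 (V1 \<inter> V2) s1 \<oplus>\<^bsub>sect P (V1 \<inter> V2)\<^esub> res P V2 (V1 \<inter> V2) t1) =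
      germ P x V (s \<oplus>\<^bsub>sect P V\<^esub> t)" if 1: "(V1, s1) \<in> germ P x V s" and 2: "(V2, t1) \<in> germ P x V t" for V1 s1 V2 t1
  proof -
    obtain W1 where W1: "open V1" "x \<in> V1" "s1 \<in> carrier (sect P V1)" "open W1" "x \<in> W1" "W1 \<subseteq> V \<inter> V1"
      "res P V W1 s = res P V1 W1 s1" using mem_germ[OF 1] .
    obtain W2 where W2: "open V2" "x \<in> V2" "t1 \<in> carrier (sect P V2)" "open W2" "x \<in> W2" "W2 \<subseteq> V \<inter> V2"
      "res P V W2 t = res P V2 W2 t1" using mem_germ[OF 2] .
    define W where "W = W1 \<inter> W2"
    have W: "open W" "x \<in> W" "W \<subseteq> V1 \<inter> V2" "W \<subseteq> V" "W \<subseteq> V1" "W \<subseteq> V2" "W \<subseteq> W1" "W \<subseteq> W2"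
      using W1 W2 by (auto simp: W_def)
    have s: "res P V1 W s1 = res P V W s"
      using res_res[of V1 W1 W s1] res_res[of V W1 W s] W1 W V by simp
    have t: "res P V2 W t1 = res P V W t"
      using res_res[of V2 W2 W t1] res_res[of V W2 W t] W2 W V by simp
    show ?thesis
      by (rule germ_eqI[of _ _ _ _ W])
         (use W W1 W2 V s t in \<open>auto simp: open_Int sect_add_closed res_closed res_add res_res\<close>)
  qed
  have "(\<sigma> \<oplus>\<^bsub>sect (sheafification P) U\<^esub> \<tau>) x = (\<Union>(V1, s1)\<in>germ P x V s. \<Union>(V2, t1)\<in>germ P x V t.
      germ P x (V1 \<inter> V2) (res P V1 (V1 \<inter> V2) s1 \<oplus>\<^bsub>sect P (V1 \<inter> V2)\<^esub> res P V2 (V1 \<inter> V2) t1))"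
    by (simp add: sheafification_def \<sigma> \<tau>)
  also have "\<dots> = (\<Union>(V1, s1)\<in>germ P x V s. \<Union>(V2, t1)\<in>germ P x V t. germ P x V (s \<oplus>\<^bsub>sect P V\<^esub> t))"
    unfolding split_beta by (intro SUP_cong refl) (simp add: eq)
  also have "\<dots> = germ P x V (s \<oplus>\<^bsub>sect P V\<^esub> t)"
    using germ_self[OF V(1,2,3)] germ_self[OF V(1,2,4)] by auto
  finally show ?thesis .
qed

text \<open>The union collapses as for addition. The scalar lives on U while a representative may
  live on a set reaching outside U, hence the cut to the intersection in the definition.\<close>

lemma sheafification_smult_germ:
  assumes U: "open U" "g \<in> A U" and V: "open V" "x \<in> V" "V \<subseteq> U" "s \<in> carrier (sect P V)"
    and \<sigma>: "\<sigma> x = germ P x V s"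
  shows "(g \<odot>\<^bsub>sect (sheafification P) U\<^esub> \<sigma>) x = germ P x V (cut V g \<odot>\<^bsub>sect P V\<^esub> s)"
proof -
  have eq: "germ P x (U \<inter> V1) (cut (U \<inter> V1) g \<odot>\<^bsub>sect P (U \<inter> V1)\<^esub> res P V1 (U \<inter> V1) s1) =
      germ P x V (cut V g \<odot>\<^bsub>sect P V\<^esub> s)" if 1: "(V1, s1) \<in> germ P x V s" for V1 s1
  proof -
    obtain W where W: "open V1" "x \<in> V1" "s1 \<in> carrier (sect P V1)" "open W" "x \<in> W" "W \<subseteq> V \<inter> V1"
      "res P V W s = res P V1 W s1" using mem_germ[OF 1] .
    have c: "cut (U \<inter> V1) g \<in> A (U \<inter> V1)" "cut V g \<in> A V"
      using U V W by (auto intro!: cut_closed[of U])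
    have "W \<subseteq> U \<inter> V1" "W \<subseteq> V" "W \<subseteq> V1" "open (U \<inter> V1)" using V W U by auto
    then show ?thesis
      by (intro germ_eqI[of _ _ _ _ W])
         (use W V U c in \<open>auto simp: sect_smult_closed res_closed res_smult res_res cut_cut\<close>)
  qed
  have "(g \<odot>\<^bsub>sect (sheafification P) U\<^esub> \<sigma>) x = (\<Union>(V1, s1)\<in>germ P x V s.
      germ P x (U \<inter> V1) (cut (U \<inter> V1) g \<odot>\<^bsub>sect P (U \<inter> V1)\<^esub> res P V1 (U \<inter> V1) s1))"
    by (simp add: sheafification_def \<sigma>)
  also have "\<dots> = (\<Union>(V1, s1)\<in>germ P x V s. germ P x V (cut V g \<odot>\<^bsub>sect P V\<^esub> s))"
    by (intro SUP_cong refl) (clarsimp simp: eq)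
  also have "\<dots> = germ P x V (cut V g \<odot>\<^bsub>sect P V\<^esub> s)"
    using germ_self[OF V(1,2,4)] by auto
  finally show ?thesis .
qed

lemma to_sheafification_apply: "x \<in> U \<Longrightarrow> to_sheafification P U s x = germ P x U s"
  by (simp add: to_sheafification_def)

lemma to_sheafification_closed:
  "open U \<Longrightarrow> s \<in> carrier (sect P U) \<Longrightarrow> to_sheafification P U s \<in> carrier (sect (sheafification P) U)"
  by (intro sectionsI) (auto simp: to_sheafification_def)

lemma sheafification_zero: "\<zero>\<^bsub>sect (sheafification P) U\<^esub> = to_sheafification P U \<zero>\<^bsub>sect P U\<^esub>"
  by (simp add: sheafification_def)

lemma sheafification_zero_germ:
  assumes "open U" "open V" "x \<in> V" "V \<subseteq> U"
  shows "\<zero>\<^bsub>sect (sheafification P) U\<^esub> x = germ P x V \<zero>\<^bsub>sect P V\<^esub>"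
proof -
  have "x \<in> U" using assms by blast
  with assms germ_res[OF assms(1,2,4,3) sect_zero_closed] show ?thesis
    by (simp add: sheafification_zero to_sheafification_def res_zero)
qed

lemma sheafification_zero_closed:
  "open U \<Longrightarrow> \<zero>\<^bsub>sect (sheafification P) U\<^esub> \<in> carrier (sect (sheafification P) U)"
  by (simp add: sheafification_zero to_sheafification_closed sect_zero_closed)

lemma sheafification_add_closed:
  assumes "\<sigma> \<in> carrier (sect (sheafification P) U)" "\<tau> \<in> carrier (sect (sheafification P) U)"
  shows "\<sigma> \<oplus>\<^bsub>sect (sheafification P) U\<^esub> \<tau> \<in> carrier (sect (sheafification P) U)"
proof (rule sectionsI)
  fix x assume "x \<notin> U"
  then show "(\<sigma> \<oplus>\<^bsub>sect (sheafification P) U\<^esub> \<tau>) x = {}"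
    using section_outside[OF assms(1)] by (simp add: sheafification_def)
next
  fix x assume "x \<in> U"
  obtain V s t where V: "open V" "x \<in> V" "V \<subseteq> U" "s \<in> carrier (sect P V)" "t \<in> carrier (sect P V)"
    "\<forall>y\<in>V. \<sigma> y = germ P y V s" "\<forall>y\<in>V. \<tau> y = germ P y V t"
    using section_local2[OF assms \<open>x \<in> U\<close>] .
  then show "\<exists>V t. open V \<and> x \<in> V \<and> V \<subseteq> U \<and> t \<in> carrier (sect P V) \<and>
      (\<forall>y\<in>V. (\<sigma> \<oplus>\<^bsub>sect (sheafification P) U\<^esub> \<tau>) y = germ P y V t)"
    by (intro exI[of _ V] exI[of _ "s \<oplus>\<^bsub>sect P V\<^esub> t"]) (simp add: sect_add_closed sheafification_add_germ)
qed

lemma sheafification_smult_closed: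
  assumes "open U" "g \<in> A U" "\<sigma> \<in> carrier (sect (sheafification P) U)"
  shows "g \<odot>\<^bsub>sect (sheafification P) U\<^esub> \<sigma> \<in> carrier (sect (sheafification P) U)"
proof (rule sectionsI)
  fix x assume "x \<notin> U"
  then show "(g \<odot>\<^bsub>sect (sheafification P) U\<^esub> \<sigma>) x = {}"
    using section_outside[OF assms(3)] by (simp add: sheafification_def)
next
  fix x assume "x \<in> U"
  obtain V s where V: "open V" "x \<in> V" "V \<subseteq> U" "s \<in> carrier (sect P V)"
    "\<forall>y\<in>V. \<sigma> y = germ P y V s"
    using section_local[OF assms(3) \<open>x \<in> U\<close>] .
  then have "cut V g \<in> A V" using assms by (auto intro: cut_closed)
  with V assms(1,2) show "\<exists>V t. open V \<and> x \<in> V \<and> V \<subseteq> U \<and> t \<in> carrier (sect P V) \<and>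
      (\<forall>y\<in>V. (g \<odot>\<^bsub>sect (sheafification P) U\<^esub> \<sigma>) y = germ P y V t)"
    by (intro exI[of _ V] exI[of _ "cut V g \<odot>\<^bsub>sect P V\<^esub> s"])
       (simp add: sect_smult_closed sheafification_smult_germ)
qed

text \<open>Each law is checked at one point, where the sections involved become germs of elements
  of one module \<open>sect P V\<close> and its own law applies.\<close>

lemma abelian_group_sheafification:
  assumes U: "open U"
  shows "abelian_group (sect (sheafification P) U)" (is "abelian_group ?S")
proof (rule abelian_groupI)
  fix \<sigma> assume \<sigma>: "\<sigma> \<in> carrier ?S"
  show "\<zero>\<^bsub>?S\<^esub> \<oplus>\<^bsub>?S\<^esub> \<sigma> = \<sigma>"
  proof (rule section_eqI)
    fix x assume "x \<in> U"
    with \<sigma> obtain V s where V: "open V" "x \<in> V" "V \<subseteq> U" "s \<in> carrier (sect P V)"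
      "\<forall>y\<in>V. \<sigma> y = germ P y V s" by (rule section_local)
    interpret V: abelian_group "sect P V" using V(1) by (rule sect_abelian_group)
    have "(\<zero>\<^bsub>?S\<^esub> \<oplus>\<^bsub>?S\<^esub> \<sigma>) x = germ P x V (\<zero>\<^bsub>sect P V\<^esub> \<oplus>\<^bsub>sect P V\<^esub> s)"
      using U V by (intro sheafification_add_germ) (simp_all add: sheafification_zero_germ)
    then show "(\<zero>\<^bsub>?S\<^esub> \<oplus>\<^bsub>?S\<^esub> \<sigma>) x = \<sigma> x" using V by simp
  qed (use U \<sigma> in \<open>simp_all add: sheafification_add_closed sheafification_zero_closed\<close>)
  \<comment> \<open>The inverse is taken to be the multiple by the constant -1, which is already
    known to be a section.\<close>
  have m1: "cut U (\<lambda>x. -1) \<in> A U" using U by (rule const_closed)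
  show "\<exists>\<tau>\<in>carrier ?S. \<tau> \<oplus>\<^bsub>?S\<^esub> \<sigma> = \<zero>\<^bsub>?S\<^esub>"
  proof (intro bexI section_eqI)
    fix x assume "x \<in> U"
    with \<sigma> obtain V s where V: "open V" "x \<in> V" "V \<subseteq> U" "s \<in> carrier (sect P V)"
      "\<forall>y\<in>V. \<sigma> y = germ P y V s" by (rule section_local)
    interpret V: module "function_ring A V" "sect P V" using V(1) by (rule sect_module)
    have c: "cut V (\<lambda>x. -1) \<in> A V" "cut V (\<lambda>x. 1) \<in> A V" using V(1) by (rule const_closed)+
    have "(cut U (\<lambda>x. -1) \<odot>\<^bsub>?S\<^esub> \<sigma> \<oplus>\<^bsub>?S\<^esub> \<sigma>) x =
        germ P x V (cut V (cut U (\<lambda>x. -1)) \<odot>\<^bsub>sect P V\<^esub> s \<oplus>\<^bsub>sect P V\<^esub> s)"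
      using U V m1 c by (intro sheafification_add_germ)
        (simp_all add: sheafification_smult_germ sect_smult_closed cut_cut)
    also have "cut V (cut U (\<lambda>x. -1)) \<odot>\<^bsub>sect P V\<^esub> s \<oplus>\<^bsub>sect P V\<^esub> s =
        cut V (\<lambda>x. -1) \<odot>\<^bsub>sect P V\<^esub> s \<oplus>\<^bsub>sect P V\<^esub> cut V (\<lambda>x. 1) \<odot>\<^bsub>sect P V\<^esub> s"
      using V V.smult_one[of s] by (simp add: cut_cut)
    also have "\<dots> = (\<lambda>x. cut V (\<lambda>x. -1) x + cut V (\<lambda>x. 1) x) \<odot>\<^bsub>sect P V\<^esub> s"
      using V.smult_l_distr[of "cut V (\<lambda>x. -1)" "cut V (\<lambda>x. 1)" s] c V by simp
    also have "(\<lambda>x. cut V (\<lambda>x. -1) x + cut V (\<lambda>x. 1) x) = (\<lambda>x. 0::'k)" by (auto simp: cut_def)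
    finally show "(cut U (\<lambda>x. -1) \<odot>\<^bsub>?S\<^esub> \<sigma> \<oplus>\<^bsub>?S\<^esub> \<sigma>) x = \<zero>\<^bsub>?S\<^esub> x"
      using U V by (simp add: sheafification_zero_germ sect_smult_zero)
  qed (use U \<sigma> m1 in \<open>simp_all add: sheafification_add_closed sheafification_zero_closed sheafification_smult_closed\<close>)
  fix \<tau> assume \<tau>: "\<tau> \<in> carrier ?S"
  show "\<sigma> \<oplus>\<^bsub>?S\<^esub> \<tau> \<in> carrier ?S" using \<sigma> \<tau> by (rule sheafification_add_closed)
  show "\<sigma> \<oplus>\<^bsub>?S\<^esub> \<tau> = \<tau> \<oplus>\<^bsub>?S\<^esub> \<sigma>"
  proof (rule section_eqI)
    fix x assume x: "x \<in> U"
    obtain V s t where V: "open V" "x \<in> V" "V \<subseteq> U" "s \<in> carrier (sect P V)" "t \<in> carrier (sect P V)"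
      "\<forall>y\<in>V. \<sigma> y = germ P y V s" "\<forall>y\<in>V. \<tau> y = germ P y V t"
      using section_local2[OF \<sigma> \<tau> x] .
    interpret V: abelian_group "sect P V" using V(1) by (rule sect_abelian_group)
    show "(\<sigma> \<oplus>\<^bsub>?S\<^esub> \<tau>) x = (\<tau> \<oplus>\<^bsub>?S\<^esub> \<sigma>) x"
      using V by (simp add: sheafification_add_germ[of V x s t] sheafification_add_germ[of V x t s] V.a_comm)
  qed (use \<sigma> \<tau> in \<open>simp_all add: sheafification_add_closed\<close>)
  fix \<rho> assume \<rho>: "\<rho> \<in> carrier ?S"
  show "\<sigma> \<oplus>\<^bsub>?S\<^esub> \<tau> \<oplus>\<^bsub>?S\<^esub> \<rho> = \<sigma> \<oplus>\<^bsub>?S\<^esub> (\<tau> \<oplus>\<^bsub>?S\<^esub> \<rho>)"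
  proof (rule section_eqI)
    fix x assume x: "x \<in> U"
    obtain V s t r where V: "open V" "x \<in> V" "V \<subseteq> U" "s \<in> carrier (sect P V)" "t \<in> carrier (sect P V)"
      "r \<in> carrier (sect P V)" "\<sigma> x = germ P x V s" "\<tau> x = germ P x V t" "\<rho> x = germ P x V r"
      using section_local3[OF \<sigma> \<tau> \<rho> x] .
    interpret V: abelian_group "sect P V" using V(1) by (rule sect_abelian_group)
    have "(\<sigma> \<oplus>\<^bsub>?S\<^esub> \<tau> \<oplus>\<^bsub>?S\<^esub> \<rho>) x = germ P x V ((s \<oplus>\<^bsub>sect P V\<^esub> t) \<oplus>\<^bsub>sect P V\<^esub> r)"
      using V by (intro sheafification_add_germ) (simp_all add: sheafification_add_germ[of V x s t])
    moreover have "(\<sigma> \<oplus>\<^bsub>?S\<^esub> (\<tau> \<oplus>\<^bsub>?S\<^esub> \<rho>)) x = germ P x V (s \<oplus>\<^bsub>sect P V\<^esub> (t \<oplus>\<^bsub>sect P V\<^esub> r))"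
      using V by (intro sheafification_add_germ) (simp_all add: sheafification_add_germ[of V x t r])
    ultimately show "(\<sigma> \<oplus>\<^bsub>?S\<^esub> \<tau> \<oplus>\<^bsub>?S\<^esub> \<rho>) x = (\<sigma> \<oplus>\<^bsub>?S\<^esub> (\<tau> \<oplus>\<^bsub>?S\<^esub> \<rho>)) x"
      using V by (simp add: V.a_assoc)
  qed (use \<sigma> \<tau> \<rho> in \<open>simp_all add: sheafification_add_closed\<close>)
qed (use U in \<open>simp add: sheafification_zero_closed\<close>)

text \<open>The same method as for the group laws: a scalar g on U acts on a representative over V
  through \<open>cut V g\<close>, and \<open>cut\<close> respects sums and products of
  functions.\<close>

lemma module_sheafification:
  assumes U: "open U"
  shows "module (function_ring A U) (sect (sheafification P) U)" (is "module ?R ?S")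
proof (rule moduleI)
  fix g h \<sigma> assume gh: "g \<in> carrier ?R" "h \<in> carrier ?R" and \<sigma>: "\<sigma> \<in> carrier ?S"
  then have gh': "g \<in> A U" "h \<in> A U" "(\<lambda>x. g x * h x) \<in> A U" "(\<lambda>x. g x + h x) \<in> A U"
    using U by (simp_all add: mult_closed add_closed)
  have cut: "cut V (\<lambda>x. g x * h x) = (\<lambda>x. cut V g x * cut V h x)"
    "cut V (\<lambda>x. g x + h x) = (\<lambda>x. cut V g x + cut V h x)" for V by (auto simp: cut_def)
  have cutA: "cut V g \<in> A V" "cut V h \<in> A V" if "open V" "V \<subseteq> U" for V
    using U gh' that by (auto intro: cut_closed)
  show "(g \<otimes>\<^bsub>?R\<^esub> h) \<odot>\<^bsub>?S\<^esub> \<sigma> = g \<odot>\<^bsub>?S\<^esub> (h \<odot>\<^bsub>?S\<^esub> \<sigma>)"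
  proof (rule section_eqI)
    fix x assume "x \<in> U"
    with \<sigma> obtain V s where V: "open V" "x \<in> V" "V \<subseteq> U" "s \<in> carrier (sect P V)"
      "\<forall>y\<in>V. \<sigma> y = germ P y V s" by (rule section_local)
    interpret V: module "function_ring A V" "sect P V" using V(1) by (rule sect_module)
    have "(g \<odot>\<^bsub>?S\<^esub> (h \<odot>\<^bsub>?S\<^esub> \<sigma>)) x = germ P x V (cut V g \<odot>\<^bsub>sect P V\<^esub> (cut V h \<odot>\<^bsub>sect P V\<^esub> s))"
      using U V gh' cutA[OF V(1,3)] by (intro sheafification_smult_germ) (simp_all add: sheafification_smult_germ sect_smult_closed)
    moreover have "((g \<otimes>\<^bsub>?R\<^esub> h) \<odot>\<^bsub>?S\<^esub> \<sigma>) x = germ P x V (cut V (\<lambda>x. g x * h x) \<odot>\<^bsub>sect P V\<^esub> s)"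
      using U V gh' by (simp add: sheafification_smult_germ)
    ultimately show "((g \<otimes>\<^bsub>?R\<^esub> h) \<odot>\<^bsub>?S\<^esub> \<sigma>) x = (g \<odot>\<^bsub>?S\<^esub> (h \<odot>\<^bsub>?S\<^esub> \<sigma>)) x"
      using V.smult_assoc1[of "cut V g" "cut V h" s] V cutA[OF V(1,3)] by (simp add: cut)
  qed (use \<sigma> gh' U in \<open>simp_all add: sheafification_smult_closed\<close>)
  show "(g \<oplus>\<^bsub>?R\<^esub> h) \<odot>\<^bsub>?S\<^esub> \<sigma> = g \<odot>\<^bsub>?S\<^esub> \<sigma> \<oplus>\<^bsub>?S\<^esub> h \<odot>\<^bsub>?S\<^esub> \<sigma>"
  proof (rule section_eqI)
    fix x assume "x \<in> U"
    with \<sigma> obtain V s where V: "open V" "x \<in> V" "V \<subseteq> U" "s \<in> carrier (sect P V)"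
      "\<forall>y\<in>V. \<sigma> y = germ P y V s" by (rule section_local)
    interpret V: module "function_ring A V" "sect P V" using V(1) by (rule sect_module)
    have "(g \<odot>\<^bsub>?S\<^esub> \<sigma> \<oplus>\<^bsub>?S\<^esub> h \<odot>\<^bsub>?S\<^esub> \<sigma>) x =
        germ P x V (cut V g \<odot>\<^bsub>sect P V\<^esub> s \<oplus>\<^bsub>sect P V\<^esub> cut V h \<odot>\<^bsub>sect P V\<^esub> s)"
      using U V gh' cutA[OF V(1,3)] by (intro sheafification_add_germ) (simp_all add: sheafification_smult_germ sect_smult_closed)
    moreover have "((g \<oplus>\<^bsub>?R\<^esub> h) \<odot>\<^bsub>?S\<^esub> \<sigma>) x = germ P x V (cut V (\<lambda>x. g x + h x) \<odot>\<^bsub>sect P V\<^esub> s)"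
      using U V gh' by (simp add: sheafification_smult_germ)
    ultimately show "((g \<oplus>\<^bsub>?R\<^esub> h) \<odot>\<^bsub>?S\<^esub> \<sigma>) x = (g \<odot>\<^bsub>?S\<^esub> \<sigma> \<oplus>\<^bsub>?S\<^esub> h \<odot>\<^bsub>?S\<^esub> \<sigma>) x"
      using V.smult_l_distr[of "cut V g" "cut V h" s] V cutA[OF V(1,3)] by (simp add: cut)
  qed (use \<sigma> gh' U in \<open>simp_all add: sheafification_smult_closed sheafification_add_closed\<close>)
  fix \<tau> assume \<tau>: "\<tau> \<in> carrier ?S"
  show "g \<odot>\<^bsub>?S\<^esub> (\<sigma> \<oplus>\<^bsub>?S\<^esub> \<tau>) = g \<odot>\<^bsub>?S\<^esub> \<sigma> \<oplus>\<^bsub>?S\<^esub> g \<odot>\<^bsub>?S\<^esub> \<tau>"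
  proof (rule section_eqI)
    fix x assume x: "x \<in> U"
    obtain V s t where V: "open V" "x \<in> V" "V \<subseteq> U" "s \<in> carrier (sect P V)" "t \<in> carrier (sect P V)"
      "\<forall>y\<in>V. \<sigma> y = germ P y V s" "\<forall>y\<in>V. \<tau> y = germ P y V t"
      using section_local2[OF \<sigma> \<tau> x] .
    interpret V: module "function_ring A V" "sect P V" using V(1) by (rule sect_module)
    have "(g \<odot>\<^bsub>?S\<^esub> (\<sigma> \<oplus>\<^bsub>?S\<^esub> \<tau>)) x = germ P x V (cut V g \<odot>\<^bsub>sect P V\<^esub> (s \<oplus>\<^bsub>sect P V\<^esub> t))"
      using U V gh' by (intro sheafification_smult_germ) (simp_all add: sheafification_add_germ)
    moreover have "(g \<odot>\<^bsub>?S\<^esub> \<sigma> \<oplus>\<^bsub>?S\<^esub> g \<odot>\<^bsub>?S\<^esub> \<tau>) x =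
        germ P x V (cut V g \<odot>\<^bsub>sect P V\<^esub> s \<oplus>\<^bsub>sect P V\<^esub> cut V g \<odot>\<^bsub>sect P V\<^esub> t)"
      using U V gh' cutA[OF V(1,3)] by (intro sheafification_add_germ) (simp_all add: sheafification_smult_germ sect_smult_closed)
    ultimately show "(g \<odot>\<^bsub>?S\<^esub> (\<sigma> \<oplus>\<^bsub>?S\<^esub> \<tau>)) x = (g \<odot>\<^bsub>?S\<^esub> \<sigma> \<oplus>\<^bsub>?S\<^esub> g \<odot>\<^bsub>?S\<^esub> \<tau>) x"
      using V.smult_r_distr[of "cut V g" s t] V cutA[OF V(1,3)] by simp
  qed (use \<sigma> \<tau> gh' U in \<open>simp_all add: sheafification_smult_closed sheafification_add_closed\<close>)
next
  fix \<sigma> assume \<sigma>: "\<sigma> \<in> carrier ?S"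
  have one: "cut U (\<lambda>x. 1) \<in> A U" using U by (rule const_closed)
  show "\<one>\<^bsub>?R\<^esub> \<odot>\<^bsub>?S\<^esub> \<sigma> = \<sigma>"
  proof (rule section_eqI)
    fix x assume "x \<in> U"
    with \<sigma> obtain V s where V: "open V" "x \<in> V" "V \<subseteq> U" "s \<in> carrier (sect P V)"
      "\<forall>y\<in>V. \<sigma> y = germ P y V s" by (rule section_local)
    interpret V: module "function_ring A V" "sect P V" using V(1) by (rule sect_module)
    show "(\<one>\<^bsub>?R\<^esub> \<odot>\<^bsub>?S\<^esub> \<sigma>) x = \<sigma> x"
      using V.smult_one[of s] one U V by (simp add: sheafification_smult_germ cut_cut)
  qed (use \<sigma> one U in \<open>simp_all add: sheafification_smult_closed\<close>)
qed (use U in \<open>simp_all add: cring_function_ring abelian_group_sheafification sheafification_smult_closed\<close>)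

section \<open>The sheafification as a sheaf of modules\<close>

lemma res_sheafification: "res (sheafification P) U V \<sigma> = (\<lambda>x. if x \<in> V then \<sigma> x else {})"
  by (simp add: sheafification_def)

lemma sheafification_res_closed:
  assumes "open V" "V \<subseteq> U" "\<sigma> \<in> carrier (sect (sheafification P) U)"
  shows "res (sheafification P) U V \<sigma> \<in> carrier (sect (sheafification P) V)"
proof (rule sectionsI)
  fix x assume x: "x \<in> V"
  then have "x \<in> U" using assms by blast
  obtain W s where W: "open W" "x \<in> W" "W \<subseteq> U" "s \<in> carrier (sect P W)"
      "\<forall>y\<in>W. \<sigma> y = germ P y W s" using section_local[OF assms(3) \<open>x \<in> U\<close>] .
  then show "\<exists>W t. open W \<and> x \<in> W \<and> W \<subseteq> V \<and> t \<in> carrier (sect P W) \<and>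
      (\<forall>y\<in>W. res (sheafification P) U V \<sigma> y = germ P y W t)"
    by (intro exI[of _ "W \<inter> V"] exI[of _ "res P W (W \<inter> V) s"])
       (use x assms in \<open>auto simp: open_Int res_closed germ_res res_sheafification\<close>)
qed (simp add: res_sheafification)

lemma presheaf_sheafification: "presheaf_of_modules A (sheafification P)"
  unfolding presheaf_of_modules_def
proof (intro conjI allI impI ballI)
  fix U :: "'p set" assume U: "open U"
  show "module (function_ring A U) (sect (sheafification P) U)" using U by (rule module_sheafification)
  show "res (sheafification P) U U s = s" if "s \<in> carrier (sect (sheafification P) U)" for s
    using section_outside[OF that] by (auto simp: res_sheafification fun_eq_iff)
  fix V :: "'p set" assume V: "open V" "V \<subseteq> U"
  show "res (sheafification P) U V \<in> carrier (sect (sheafification P) U) \<rightarrow> carrier (sect (sheafification P) V)"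
    using V by (auto simp: sheafification_res_closed)
  fix \<sigma> assume \<sigma>: "\<sigma> \<in> carrier (sect (sheafification P) U)"
  show "res (sheafification P) U V (\<sigma> \<oplus>\<^bsub>sect (sheafification P) U\<^esub> \<tau>) =
      res (sheafification P) U V \<sigma> \<oplus>\<^bsub>sect (sheafification P) V\<^esub> res (sheafification P) U V \<tau>" for \<tau>
    by (auto simp: sheafification_def fun_eq_iff)
  fix g assume g: "g \<in> A U"
  show "res (sheafification P) U V (g \<odot>\<^bsub>sect (sheafification P) U\<^esub> \<sigma>) =
      cut V g \<odot>\<^bsub>sect (sheafification P) V\<^esub> res (sheafification P) U V \<sigma>"
  proof (rule section_eqI)
    fix x assume x: "x \<in> V"
    then have "x \<in> U" using V by blast
    obtain W s where W: "open W" "x \<in> W" "W \<subseteq> U" "s \<in> carrier (sect P W)"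
      "\<forall>y\<in>W. \<sigma> y = germ P y W s" using section_local[OF \<sigma> \<open>x \<in> U\<close>] .
    \<comment> \<open>The representative is moved to V \<inter> W because scalar multiplication over
      V is computed from representatives on subsets of V.\<close>
    let ?s = "res P W (V \<inter> W) s"
    have s: "?s \<in> carrier (sect P (V \<inter> W))" "\<sigma> x = germ P x (V \<inter> W) ?s"
      using W V x by (auto simp: open_Int res_closed germ_res)
    have "cut V g \<in> A V" using U V g by (auto intro: cut_closed)
    with s show "res (sheafification P) U V (g \<odot>\<^bsub>sect (sheafification P) U\<^esub> \<sigma>) x =
        (cut V g \<odot>\<^bsub>sect (sheafification P) V\<^esub> res (sheafification P) U V \<sigma>) x"
      using x W V U g
      by (simp add: res_sheafification sheafification_smult_germ[of U g "V \<inter> W" x ?s]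
          sheafification_smult_germ[of V "cut V g" "V \<inter> W" x ?s] cut_cut le_infI1 open_Int)
  qed (use U V g \<sigma> in \<open>simp_all add: sheafification_smult_closed sheafification_res_closed cut_closed\<close>)
next
  fix U V W :: "'p set" and \<sigma> assume "W \<subseteq> V"
  then show "res (sheafification P) V W (res (sheafification P) U V \<sigma>) = res (sheafification P) U W \<sigma>"
    by (auto simp: res_sheafification fun_eq_iff)
qed

text \<open>Sections are functions into the stalks, so separation and gluing are pointwise, and
  being represented by presheaf sections is a local condition.\<close>

lemma sheaf_sheafification: "sheaf_of_modules A (sheafification P)"
  unfolding sheaf_of_modules_def
proof (intro conjI allI impI ballI presheaf_sheafification)
  fix \<U> :: "'p set set" assume op: "\<forall>U\<in>\<U>. open U"
  {
    fix \<sigma> \<tau> assume \<sigma>\<tau>: "\<sigma> \<in> carrier (sect (sheafification P) (\<Union>\<U>))" "\<tau> \<in> carrier (sect (sheafification P) (\<Union>\<U>))"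
      and eq: "\<forall>U\<in>\<U>. res (sheafification P) (\<Union>\<U>) U \<sigma> = res (sheafification P) (\<Union>\<U>) U \<tau>"
    show "\<sigma> = \<tau>"
    proof (rule section_eqI[OF \<sigma>\<tau>])
      fix x assume "x \<in> \<Union>\<U>"
      then obtain U where "U \<in> \<U>" "x \<in> U" by blast
      then show "\<sigma> x = \<tau> x" using fun_cong[OF bspec[OF eq], of U x] by (simp add: res_sheafification)
    qed
  }
  fix s assume s: "(\<forall>U\<in>\<U>. s U \<in> carrier (sect (sheafification P) U)) \<and>
    (\<forall>U\<in>\<U>. \<forall>V\<in>\<U>. res (sheafification P) U (U \<inter> V) (s U) = res (sheafification P) V (U \<inter> V) (s V))"
  \<comment> \<open>Compatible sections coincide wherever both are defined, and those whose domain
    misses x contribute the empty set, so the union is the common value.\<close>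
  define \<sigma> where "\<sigma> = (\<lambda>x. \<Union>U\<in>\<U>. s U x)"
  have \<sigma>: "\<sigma> x = s U x" if "U \<in> \<U>" "x \<in> U" for U x
  proof -
    have "s V x \<subseteq> s U x" if "V \<in> \<U>" for V
    proof (cases "x \<in> V")
      case True
      have "res (sheafification P) U (U \<inter> V) (s U) x = res (sheafification P) V (U \<inter> V) (s V) x"
        using s \<open>U \<in> \<U>\<close> that by metis
      then show ?thesis using True \<open>x \<in> U\<close> by (simp add: res_sheafification)
    next
      case False
      moreover have "s V \<in> carrier (sect (sheafification P) V)" using s that by blast
      ultimately have "s V x = {}" by (rule section_outside[rotated])
      then show ?thesis by simp
    qed
    then show ?thesis using that by (auto simp: \<sigma>_def)
  qed
  show "\<exists>t\<in>carrier (sect (sheafification P) (\<Union>\<U>)). \<forall>U\<in>\<U>. res (sheafification P) (\<Union>\<U>) U t = s U"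
  proof (intro bexI ballI)
    fix U assume "U \<in> \<U>"
    then have "s U \<in> carrier (sect (sheafification P) U)" using s by blast
    then have "s U x = {}" if "x \<notin> U" for x using that by (rule section_outside)
    then show "res (sheafification P) (\<Union>\<U>) U \<sigma> = s U"
      using \<sigma>[OF \<open>U \<in> \<U>\<close>] by (auto simp: res_sheafification fun_eq_iff)
  next
    show "\<sigma> \<in> carrier (sect (sheafification P) (\<Union>\<U>))"
    proof (rule sectionsI)
      fix x assume "x \<in> \<Union>\<U>"
      then obtain U where U: "U \<in> \<U>" "x \<in> U" by blast
      then have "s U \<in> carrier (sect (sheafification P) U)" using s by blast
      from section_local[OF this \<open>x \<in> U\<close>] obtain V t where V: "open V" "x \<in> V" "V \<subseteq> U" "t \<in> carrier (sect P V)"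
        "\<forall>y\<in>V. s U y = germ P y V t" .
      then show "\<exists>V t. open V \<and> x \<in> V \<and> V \<subseteq> \<Union>\<U> \<and> t \<in> carrier (sect P V) \<and> (\<forall>y\<in>V. \<sigma> y = germ P y V t)"
        using U \<sigma>[OF U(1)] by (intro exI[of _ V] exI[of _ t]) auto
    next
      fix x assume "x \<notin> \<Union>\<U>"
      then show "\<sigma> x = {}" using s section_outside by (fastforce simp: \<sigma>_def)
    qed
  qed
qed

lemma to_sheafification_add:
  assumes U: "open U" and st: "s \<in> carrier (sect P U)" "t \<in> carrier (sect P U)"
  shows "to_sheafification P U (s \<oplus>\<^bsub>sect P U\<^esub> t) =
    to_sheafification P U s \<oplus>\<^bsub>sect (sheafification P) U\<^esub> to_sheafification P U t"
  by (rule section_eqI[of _ U])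
     (use assms in \<open>simp_all add: to_sheafification_closed sect_add_closed sheafification_add_closed
        to_sheafification_apply sheafification_add_germ[of U _ s t]\<close>)

lemma to_sheafification_smult:
  assumes U: "open U" and "g \<in> A U" "s \<in> carrier (sect P U)"
  shows "to_sheafification P U (g \<odot>\<^bsub>sect P U\<^esub> s) = g \<odot>\<^bsub>sect (sheafification P) U\<^esub> to_sheafification P U s"
  by (rule section_eqI[of _ U])
     (use assms in \<open>simp_all add: to_sheafification_closed sect_smult_closed sheafification_smult_closed
        to_sheafification_apply sheafification_smult_germ[of U _ U _ s] cut_self\<close>)

lemma to_sheafification_res:
  assumes "open U" "open V" "V \<subseteq> U" "s \<in> carrier (sect P U)"
  shows "to_sheafification P V (res P U V s) = res (sheafification P) U V (to_sheafification P U s)"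
  using assms by (auto simp: to_sheafification_def res_sheafification germ_res fun_eq_iff)

text \<open>Turns a local representative into an equality of sections, as needed for passing from
  germs to cosets of tensors in \<open>tensor_eqI\<close>.\<close>

lemma res_eq_to_sheafification:
  assumes "\<And>y. y \<in> V \<Longrightarrow> \<sigma> y = germ P y V t"
  shows "res (sheafification P) U V \<sigma> = to_sheafification P V t"
  using assms by (auto simp: res_sheafification to_sheafification_def fun_eq_iff)

end

section \<open>The universal property of the tensor product of sheaves\<close>

text \<open>
  Morphisms over the open set \<open>X\<close>, without the extensionality imposed by \<open>additive_morphisms\<close>.
  Local versions are needed since a 1-form \<open>\<alpha>\<close> on \<open>X\<close> gives rise to the morphism
  \<open>\<tau> \<mapsto> \<alpha> \<and> \<tau>\<close> over \<open>X\<close> only.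
\<close>

definition additive_on ::
  "'p::topological_space set \<Rightarrow> ('p, 'r, 's) module_presheaf \<Rightarrow> ('p, 'r, 't) module_presheaf
     \<Rightarrow> ('p set \<Rightarrow> 's \<Rightarrow> 't) \<Rightarrow> bool" where
  "additive_on X F H \<psi> \<longleftrightarrow>
     (\<forall>U. open U \<longrightarrow> U \<subseteq> X \<longrightarrow> (\<forall>s\<in>carrier (sect F U). \<psi> U s \<in> carrier (sect H U) \<and>
        (\<forall>t\<in>carrier (sect F U). \<psi> U (s \<oplus>\<^bsub>sect F U\<^esub> t) = \<psi> U s \<oplus>\<^bsub>sect H U\<^esub> \<psi> U t) \<and>
        (\<forall>V. open V \<longrightarrow> V \<subseteq> U \<longrightarrow> \<psi> V (res F U V s) = res H U V (\<psi> U s))))"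

text \<open>Scalars are asked to pass from one argument to the other, not out of b. This is the
  balance condition of the tensor product, and it is satisfied by the prescription extending a
  connection, which is not linear.\<close>

definition biadditive_on ::
  "('p::topological_space set \<Rightarrow> ('p \<Rightarrow> 'k) set) \<Rightarrow> 'p set \<Rightarrow> ('p, 'p \<Rightarrow> 'k, 's) module_presheaf
     \<Rightarrow> ('p, 'p \<Rightarrow> 'k, 't) module_presheaf \<Rightarrow> ('p, 'p \<Rightarrow> 'k, 'u) module_presheaf
     \<Rightarrow> ('p set \<Rightarrow> 's \<Rightarrow> 't \<Rightarrow> 'u) \<Rightarrow> bool" where
  "biadditive_on A X F G H b \<longleftrightarrow>
     (\<forall>U. open U \<longrightarrow> U \<subseteq> X \<longrightarrow> (\<forall>s\<in>carrier (sect F U). \<forall>t\<in>carrier (sect G U).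
        b U s t \<in> carrier (sect H U) \<and>
        (\<forall>s'\<in>carrier (sect F U). b U (s \<oplus>\<^bsub>sect F U\<^esub> s') t = b U s t \<oplus>\<^bsub>sect H U\<^esub> b U s' t) \<and>
        (\<forall>t'\<in>carrier (sect G U). b U s (t \<oplus>\<^bsub>sect G U\<^esub> t') = b U s t \<oplus>\<^bsub>sect H U\<^esub> b U s t') \<and>
        (\<forall>g\<in>A U. b U (g \<odot>\<^bsub>sect F U\<^esub> s) t = b U s (g \<odot>\<^bsub>sect G U\<^esub> t)) \<and>
        (\<forall>V. open V \<longrightarrow> V \<subseteq> U \<longrightarrow> b V (res F U V s) (res G U V t) = res H U V (b U s t))))"

lemma additive_onD:
  assumes "additive_on X F H \<psi>" "open U" "U \<subseteq> X" "s \<in> carrier (sect F U)"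
  shows "\<psi> U s \<in> carrier (sect H U)"
    and "t \<in> carrier (sect F U) \<Longrightarrow> \<psi> U (s \<oplus>\<^bsub>sect F U\<^esub> t) = \<psi> U s \<oplus>\<^bsub>sect H U\<^esub> \<psi> U t"
    and "open V \<Longrightarrow> V \<subseteq> U \<Longrightarrow> \<psi> V (res F U V s) = res H U V (\<psi> U s)"
  using assms unfolding additive_on_def by blast+

lemma additive_on_subset: "additive_on X F H \<psi> \<Longrightarrow> Y \<subseteq> X \<Longrightarrow> additive_on Y F H \<psi>"
  unfolding additive_on_def by blast

lemma biadditive_onD:
  assumes "biadditive_on A X F G H b" "open U" "U \<subseteq> X" "s \<in> carrier (sect F U)" "t \<in> carrier (sect G U)"
  shows "b U s t \<in> carrier (sect H U)"
    and "s' \<in> carrier (sect F U) \<Longrightarrow> b U (s \<oplus>\<^bsub>sect F U\<^esub> s') t = b U s t \<oplus>\<^bsub>sect H U\<^esub> b U s' t"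
    and "t' \<in> carrier (sect G U) \<Longrightarrow> b U s (t \<oplus>\<^bsub>sect G U\<^esub> t') = b U s t \<oplus>\<^bsub>sect H U\<^esub> b U s t'"
    and "g \<in> A U \<Longrightarrow> b U (g \<odot>\<^bsub>sect F U\<^esub> s) t = b U s (g \<odot>\<^bsub>sect G U\<^esub> t)"
    and "open V \<Longrightarrow> V \<subseteq> U \<Longrightarrow> b V (res F U V s) (res G U V t) = res H U V (b U s t)"
  using assms unfolding biadditive_on_def by simp_all

lemma additive_on_morphism: "\<psi> \<in> additive_morphisms F H \<Longrightarrow> additive_on UNIV F H \<psi>"
  unfolding additive_morphisms_def additive_on_def by (auto simp: PiE_iff split: if_splits)

lemma additive_morphism_PiE:
  assumes "\<phi> \<in> additive_morphisms F H"
  shows "\<phi> U \<in> (if open U then carrier (sect F U) else {}) \<rightarrow>\<^sub>E carrier (sect H U)"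
  using assms unfolding additive_morphisms_def mem_Collect_eq by (elim conjE, elim allE)

lemma sheaf_eqI:
  assumes H: "sheaf_of_modules A H" and U: "open U"
    and st: "s \<in> carrier (sect H U)" "t \<in> carrier (sect H U)"
    and loc: "\<And>x. x \<in> U \<Longrightarrow> \<exists>V. open V \<and> x \<in> V \<and> V \<subseteq> U \<and> res H U V s = res H U V t"
  shows "s = t"
proof -
  \<comment> \<open>The cover consists of all open subsets on which s and t agree, which avoids
    choosing one for each point.\<close>
  define \<U> where "\<U> = {V. open V \<and> V \<subseteq> U \<and> res H U V s = res H U V t}"
  have "\<Union>\<U> = U" using loc by (fastforce simp: \<U>_def)
  moreover have "\<forall>V\<in>\<U>. open V" by (simp add: \<U>_def)
  ultimately show ?thesis
    using H st unfolding sheaf_of_modules_def by (metis (mono_tags, lifting) \<U>_def mem_Collect_eq)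
qed

lemma sheaf_glue:
  assumes H: "sheaf_of_modules A H" and "\<forall>U\<in>\<U>. open U" "\<forall>U\<in>\<U>. s U \<in> carrier (sect H U)"
    and "\<And>U V. U \<in> \<U> \<Longrightarrow> V \<in> \<U> \<Longrightarrow> res H U (U \<inter> V) (s U) = res H V (U \<inter> V) (s V)"
  obtains t where "t \<in> carrier (sect H (\<Union>\<U>))" "\<forall>U\<in>\<U>. res H (\<Union>\<U>) U t = s U"
  using assms unfolding sheaf_of_modules_def by metis

section \<open>Extending morphisms from a presheaf to its sheafification\<close>

context module_presheaf_on begin

text \<open>A section of the sheafification is locally given by sections t of P; their images under
  \<phi> agree on overlaps and glue in the sheaf H.\<close>

lemma sheafification_lift:
  assumes H: "sheaf_of_modules A H" and \<phi>: "additive_on X P H \<phi>"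
  obtains \<psi> where "additive_on X (sheafification P) H \<psi>"
    "\<forall>U s. open U \<longrightarrow> U \<subseteq> X \<longrightarrow> s \<in> carrier (sect P U) \<longrightarrow> \<psi> U (to_sheafification P U s) = \<phi> U s"
proof -
  interpret H: module_presheaf_on A H
    using H by unfold_locales (simp add: sheaf_of_modules_def)
  note \<phi>D = additive_onD[OF \<phi>]
  \<comment> \<open>In a presheaf that is not separated, equal germs do not give equal sections. But
    \<phi> carries such sections to elements of the sheaf H that agree locally, hence are
    equal.\<close>
  have \<phi>_eq: "\<phi> V t = \<phi> V t'"
    if V: "open V" "V \<subseteq> X" and t: "t \<in> carrier (sect P V)" "t' \<in> carrier (sect P V)"
      and eq: "\<And>y. y \<in> V \<Longrightarrow> germ P y V t = germ P y V t'" for V t t'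
  proof (rule sheaf_eqI[OF H V(1)])
    fix x assume "x \<in> V"
    from germ_eqD[OF eq[OF this] V(1) this t(2)] obtain W where
      "open W" "x \<in> W" "W \<subseteq> V \<inter> V" "res P V W t = res P V W t'" .
    then show "\<exists>W. open W \<and> x \<in> W \<and> W \<subseteq> V \<and> res H V W (\<phi> V t) = res H V W (\<phi> V t')"
      using \<phi>D(3)[OF V t(1), of W] \<phi>D(3)[OF V t(2), of W] by (intro exI[of _ W]) simp
  qed (use \<phi>D(1)[OF V] t in auto)
  \<comment> \<open>The glued element is characterised by all local representatives, not only by
    those used for gluing. Additivity and naturality of the chosen \<psi> can then be tested on any
    convenient representative.\<close>
  define good where "good U \<sigma> h \<longleftrightarrow> h \<in> carrier (sect H U) \<and> (\<forall>V t. open V \<longrightarrow> V \<subseteq> U \<longrightarrow>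
      t \<in> carrier (sect P V) \<longrightarrow> (\<forall>y\<in>V. \<sigma> y = germ P y V t) \<longrightarrow> res H U V h = \<phi> V t)" for U \<sigma> h
  have good_ex: "\<exists>h. good U \<sigma> h"
    if U: "open U" "U \<subseteq> X" and \<sigma>: "\<sigma> \<in> carrier (sect (sheafification P) U)" for U \<sigma>
  proof -
    define \<U> where "\<U> = {V. open V \<and> V \<subseteq> U \<and> (\<exists>t\<in>carrier (sect P V). \<forall>y\<in>V. \<sigma> y = germ P y V t)}"
    have "\<forall>V\<in>\<U>. \<exists>t\<in>carrier (sect P V). \<forall>y\<in>V. \<sigma> y = germ P y V t" by (simp add: \<U>_def)
    then obtain T where T: "\<And>V. V \<in> \<U> \<Longrightarrow> T V \<in> carrier (sect P V)"
      "\<And>V y. V \<in> \<U> \<Longrightarrow> y \<in> V \<Longrightarrow> \<sigma> y = germ P y V (T V)" by metis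
    have op: "open V" "V \<subseteq> U" "V \<subseteq> X" if "V \<in> \<U>" for V using that U by (auto simp: \<U>_def)
    have "\<Union>\<U> = U"
    proof
      show "\<Union>\<U> \<subseteq> U" by (auto simp: \<U>_def)
      show "U \<subseteq> \<Union>\<U>"
      proof
        fix x assume "x \<in> U"
        then obtain V s where "open V" "x \<in> V" "V \<subseteq> U" "s \<in> carrier (sect P V)" "\<forall>y\<in>V. \<sigma> y = germ P y V s"
          using section_local[OF \<sigma>] by metis
        then show "x \<in> \<Union>\<U>" by (auto simp: \<U>_def)
      qed
    qed
    have comp: "res H V (V \<inter> W) (\<phi> V (T V)) = res H W (V \<inter> W) (\<phi> W (T W))" if V: "V \<in> \<U>" and W: "W \<in> \<U>" for V W
    proof -
      have o: "open (V \<inter> W)" using op[OF V] op[OF W] by auto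
      have "\<phi> (V \<inter> W) (res P V (V \<inter> W) (T V)) = \<phi> (V \<inter> W) (res P W (V \<inter> W) (T W))"
        using o op[OF V] op[OF W] T(1)[OF V] T(1)[OF W] T(2)[OF V, symmetric] T(2)[OF W, symmetric]
        by (intro \<phi>_eq) (auto simp: res_closed germ_res)
      then show ?thesis
        using \<phi>D(3)[OF op(1,3)[OF V] T(1)[OF V] o] \<phi>D(3)[OF op(1,3)[OF W] T(1)[OF W] o] by simp
    qed
    have "\<forall>V\<in>\<U>. open V" "\<forall>V\<in>\<U>. \<phi> V (T V) \<in> carrier (sect H V)"
      by (simp add: op(1)) (intro ballI \<phi>D(1) op T(1))
    then obtain h where "h \<in> carrier (sect H (\<Union>\<U>))" "\<forall>V\<in>\<U>. res H (\<Union>\<U>) V h = \<phi> V (T V)"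
      by (rule sheaf_glue[OF H _ _ comp])
    then have h: "h \<in> carrier (sect H U)" "\<forall>V\<in>\<U>. res H U V h = \<phi> V (T V)"
      unfolding \<open>\<Union>\<U> = U\<close> .
    have "res H U V h = \<phi> V t" if V: "open V" "V \<subseteq> U" "t \<in> carrier (sect P V)" "\<forall>y\<in>V. \<sigma> y = germ P y V t" for V t
    proof -
      have VU: "V \<in> \<U>" using V by (auto simp: \<U>_def)
      have "\<phi> V (T V) = \<phi> V t"
        using V T(2)[OF VU, symmetric] by (intro \<phi>_eq op[OF VU] T(1)[OF VU]) auto
      then show ?thesis using h(2) VU by simp
    qed
    with h(1) show ?thesis by (auto simp: good_def)
  qed
  define \<psi> where "\<psi> U \<sigma> = (SOME h. good U \<sigma> h)" for U \<sigma>
  have \<psi>: "good U \<sigma> (\<psi> U \<sigma>)"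
    if "open U" "U \<subseteq> X" "\<sigma> \<in> carrier (sect (sheafification P) U)" for U \<sigma>
    unfolding \<psi>_def using someI_ex[OF good_ex[OF that]] .
  have \<psi>_cl: "\<psi> U \<sigma> \<in> carrier (sect H U)"
    if "open U" "U \<subseteq> X" "\<sigma> \<in> carrier (sect (sheafification P) U)" for U \<sigma>
    using \<psi>[OF that] by (simp add: good_def)
  have \<psi>_res: "res H U V (\<psi> U \<sigma>) = \<phi> V t"
    if "open U" "U \<subseteq> X" "\<sigma> \<in> carrier (sect (sheafification P) U)" "open V" "V \<subseteq> U"
      "t \<in> carrier (sect P V)" "\<forall>y\<in>V. \<sigma> y = germ P y V t" for U V \<sigma> t
    using \<psi>[OF that(1-3)] that(4-) by (simp add: good_def)
  show ?thesis
  proof (rule that)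
    show "additive_on X (sheafification P) H \<psi>"
      unfolding additive_on_def
    proof (intro allI impI ballI conjI)
      fix U \<sigma> assume U: "open U" "U \<subseteq> X" and \<sigma>: "\<sigma> \<in> carrier (sect (sheafification P) U)"
      show "\<psi> U \<sigma> \<in> carrier (sect H U)" using U \<sigma> by (rule \<psi>_cl)
      {
        fix \<tau> assume \<tau>: "\<tau> \<in> carrier (sect (sheafification P) U)"
        note sum = sheafification_add_closed[OF \<sigma> \<tau>]
        show "\<psi> U (\<sigma> \<oplus>\<^bsub>sect (sheafification P) U\<^esub> \<tau>) = \<psi> U \<sigma> \<oplus>\<^bsub>sect H U\<^esub> \<psi> U \<tau>"
        proof (rule sheaf_eqI[OF H U(1)])
          fix x assume x: "x \<in> U"
          obtain V s t where V: "open V" "x \<in> V" "V \<subseteq> U" "s \<in> carrier (sect P V)" "t \<in> carrier (sect P V)"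
            "\<forall>y\<in>V. \<sigma> y = germ P y V s" "\<forall>y\<in>V. \<tau> y = germ P y V t"
            using section_local2[OF \<sigma> \<tau> x] .
          have "V \<subseteq> X" using V U by blast
          have "res H U V (\<psi> U (\<sigma> \<oplus>\<^bsub>sect (sheafification P) U\<^esub> \<tau>)) = \<phi> V (s \<oplus>\<^bsub>sect P V\<^esub> t)"
            using V by (intro \<psi>_res[OF U sum V(1,3)]) (simp_all add: sect_add_closed sheafification_add_germ)
          also have "\<dots> = \<phi> V s \<oplus>\<^bsub>sect H V\<^esub> \<phi> V t" using \<phi>D(2)[OF V(1) \<open>V \<subseteq> X\<close>] V by simp
          also have "\<phi> V s = res H U V (\<psi> U \<sigma>)" using \<psi>_res[OF U \<sigma> V(1,3,4,6)] by simp
          also have "\<phi> V t = res H U V (\<psi> U \<tau>)" using \<psi>_res[OF U \<tau> V(1,3,5,7)] by simp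
          also have "res H U V (\<psi> U \<sigma>) \<oplus>\<^bsub>sect H V\<^esub> res H U V (\<psi> U \<tau>) =
              res H U V (\<psi> U \<sigma> \<oplus>\<^bsub>sect H U\<^esub> \<psi> U \<tau>)"
            using V U \<sigma> \<tau> by (simp add: H.res_add \<psi>_cl)
          finally show "\<exists>V. open V \<and> x \<in> V \<and> V \<subseteq> U \<and>
              res H U V (\<psi> U (\<sigma> \<oplus>\<^bsub>sect (sheafification P) U\<^esub> \<tau>)) = res H U V (\<psi> U \<sigma> \<oplus>\<^bsub>sect H U\<^esub> \<psi> U \<tau>)"
            using V by blast
        qed (use U \<sigma> \<tau> sum in \<open>simp_all add: \<psi>_cl H.sect_add_closed\<close>)
      }
      fix W assume W: "open W" "W \<subseteq> U"
      then have WX: "W \<subseteq> X" using U by blast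
      note r = sheafification_res_closed[OF W \<sigma>]
      show "\<psi> W (res (sheafification P) U W \<sigma>) = res H U W (\<psi> U \<sigma>)"
      proof (rule sheaf_eqI[OF H W(1)])
        fix x assume x: "x \<in> W"
        obtain V s where V: "open V" "x \<in> V" "V \<subseteq> W" "s \<in> carrier (sect P V)"
            "\<forall>y\<in>V. res (sheafification P) U W \<sigma> y = germ P y V s"
          using section_local[OF r x] .
        have s: "\<forall>y\<in>V. \<sigma> y = germ P y V s" using V(3,5) by (metis res_sheafification subsetD)
        have "V \<subseteq> U" using V W by blast
        have "res H W V (\<psi> W (res (sheafification P) U W \<sigma>)) = \<phi> V s"
          by (rule \<psi>_res[OF W(1) WX r V(1,3,4,5)])
        also have "\<dots> = res H U V (\<psi> U \<sigma>)"
          using \<psi>_res[OF U \<sigma> V(1) \<open>V \<subseteq> U\<close> V(4) s] by simp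
        also have "\<dots> = res H W V (res H U W (\<psi> U \<sigma>))"
          using U W V \<sigma> by (simp add: H.res_res \<psi>_cl)
        finally show "\<exists>V. open V \<and> x \<in> V \<and> V \<subseteq> W \<and>
            res H W V (\<psi> W (res (sheafification P) U W \<sigma>)) = res H W V (res H U W (\<psi> U \<sigma>))"
          using V by blast
      qed (use U \<sigma> W WX r in \<open>simp_all add: \<psi>_cl H.res_closed\<close>)
    qed
    show "\<forall>U s. open U \<longrightarrow> U \<subseteq> X \<longrightarrow> s \<in> carrier (sect P U) \<longrightarrow> \<psi> U (to_sheafification P U s) = \<phi> U s"
    proof (intro allI impI)
      fix U s assume U: "open U" "U \<subseteq> X" and s: "s \<in> carrier (sect P U)"
      have t: "to_sheafification P U s \<in> carrier (sect (sheafification P) U)"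
        using U s by (simp add: to_sheafification_closed)
      \<comment> \<open>For the image of a presheaf section, s itself is a representative on the
        whole of U.\<close>
      have "res H U U (\<psi> U (to_sheafification P U s)) = \<phi> U s"
        using U s by (intro \<psi>_res[OF U t]) (simp_all add: to_sheafification_apply)
      then show "\<psi> U (to_sheafification P U s) = \<phi> U s" using U t by (simp add: H.res_id \<psi>_cl)
    qed
  qed
qed

end

section \<open>Tensor products of presheaves and of sheaves\<close>

locale module_presheaf_pair =
  F: module_presheaf_on A F + G: module_presheaf_on A G
  for A :: "'p::topological_space set \<Rightarrow> ('p \<Rightarrow> 'k::field) set"
    and F :: "('p, 'p \<Rightarrow> 'k, 's) module_presheaf" and G :: "('p, 'p \<Rightarrow> 'k, 't) module_presheaf"
begin

abbreviation "T \<equiv> tensor_presheaf A F G"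

lemma module_pair_sect: "open U \<Longrightarrow> module_pair (function_ring A U) (sect F U) (sect G U)"
  by (intro module_pair.intro F.sect_module G.sect_module)

text \<open>Restriction is semilinear over the ring map \<open>cut V\<close>; as an instance of
  \<open>module_pair_map\<close> it is well defined on tensors.\<close>

lemma module_pair_map_res:
  assumes "open U" "open V" "V \<subseteq> U"
  shows "module_pair_map (function_ring A U) (sect F U) (sect G U)
    (function_ring A V) (sect F V) (sect G V) (res F U V) (res G U V) (cut V)"
  by (intro module_pair_map.intro module_pair_sect module_pair_map_axioms.intro)
     (use assms in \<open>simp_all add: F.res_closed G.res_closed F.res_add G.res_add F.res_smult G.res_smult F.cut_closed\<close>)

lemma sect_T: "sect T U = tensor_product (function_ring A U) (sect F U) (sect G U)"
  by (simp add: tensor_presheaf_def)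

lemma res_T:
  assumes "open U" "open V" "V \<subseteq> U"
  shows "res T U V (tensor_class (function_ring A U) (sect F U) (sect G U) w) =
    tensor_class (function_ring A V) (sect F V) (sect G V)
      (frag_extend (\<lambda>(s, t). frag_of (res F U V s, res G U V t)) w)"
proof -
  interpret m: module_pair_map "function_ring A U" "sect F U" "sect G U"
    "function_ring A V" "sect F V" "sect G V" "res F U V" "res G U V" "cut V"
    using assms by (rule module_pair_map_res)
  show ?thesis using m.tensor_class_frag_map[of w] by (simp add: tensor_presheaf_def m.frag_map_def)
qed

text \<open>The identities for restriction hold for representatives in the free abelian group and
  are checked there on basis elements.\<close>

lemma presheaf_T: "presheaf_of_modules A T"
  unfolding presheaf_of_modules_def
proof (intro conjI allI impI ballI)
  fix U :: "'p set" assume U: "open U"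
  interpret U: module_pair "function_ring A U" "sect F U" "sect G U" using U by (rule module_pair_sect)
  let ?c = "\<lambda>U. tensor_class (function_ring A U) (sect F U) (sect G U)"
  let ?r = "\<lambda>U V. frag_extend (\<lambda>(s, t). frag_of (res F U V s, res G U V t))"
  show "module (function_ring A U) (sect T U)" unfolding sect_T by (rule U.module_tensor_product)
  {
    fix C assume "C \<in> carrier (sect T U)"
    then obtain w where w: "Poly_Mapping.keys w \<subseteq> U.basis" "C = ?c U w"
      unfolding sect_T by (rule U.tensor_product_cases)
    have "?r U U w = w"
      using w(1) by (induction rule: U.tensor_product_induct)
        (simp_all add: U F.res_id G.res_id frag_extend_diff)
    then show "res T U U C = C" using U by (simp add: w res_T)
  }
  fix V :: "'p set" assume V: "open V" "V \<subseteq> U"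
  interpret V: module_pair "function_ring A V" "sect F V" "sect G V" using V(1) by (rule module_pair_sect)
  interpret m: module_pair_map "function_ring A U" "sect F U" "sect G U"
    "function_ring A V" "sect F V" "sect G V" "res F U V" "res G U V" "cut V"
    using U V by (rule module_pair_map_res)
  note rUV = res_T[OF U V]
  show "res T U V \<in> carrier (sect T U) \<rightarrow> carrier (sect T V)"
  proof
    fix C assume "C \<in> carrier (sect T U)"
    then obtain w where w: "Poly_Mapping.keys w \<subseteq> U.basis" "C = ?c U w"
      unfolding sect_T by (rule U.tensor_product_cases)
    show "res T U V C \<in> carrier (sect T V)"
      unfolding w(2) rUV sect_T using m.keys_frag_map[OF w(1)] unfolding m.frag_map_def
      by (rule V.tensor_class_closed)
  qed
  fix C assume "C \<in> carrier (sect T U)"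
  then obtain w where w: "Poly_Mapping.keys w \<subseteq> U.basis" "C = ?c U w"
    unfolding sect_T by (rule U.tensor_product_cases)
  {
    fix C' assume "C' \<in> carrier (sect T U)"
    then obtain w' where w': "Poly_Mapping.keys w' \<subseteq> U.basis" "C' = ?c U w'"
      unfolding sect_T by (rule U.tensor_product_cases)
    show "res T U V (C \<oplus>\<^bsub>sect T U\<^esub> C') = res T U V C \<oplus>\<^bsub>sect T V\<^esub> res T U V C'"
      by (simp add: w w' rUV sect_T U.tensor_product_add V.tensor_product_add frag_extend_add)
  }
  fix g assume g: "g \<in> A U"
  have cg: "cut V g \<in> A V" using U V g by (rule F.cut_closed)
  have "?r U V (frag_extend (\<lambda>(s, t). frag_of (g \<odot>\<^bsub>sect F U\<^esub> s, t)) w) =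
      frag_extend (\<lambda>(s, t). frag_of (cut V g \<odot>\<^bsub>sect F V\<^esub> s, t)) (?r U V w)"
    using w(1) by (induction rule: U.tensor_product_induct)
      (use U V g in \<open>simp_all add: F.res_smult frag_extend_diff\<close>)
  then show "res T U V (g \<odot>\<^bsub>sect T U\<^esub> C) = cut V g \<odot>\<^bsub>sect T V\<^esub> res T U V C"
    using g cg by (simp add: w rUV sect_T U.tensor_product_smult V.tensor_product_smult)
next
  fix U V W :: "'p set" and C
  assume o: "open U" "open V" "open W" "W \<subseteq> V" "V \<subseteq> U" and C: "C \<in> carrier (sect T U)"
  interpret U: module_pair "function_ring A U" "sect F U" "sect G U" using o(1) by (rule module_pair_sect)
  obtain w where w: "Poly_Mapping.keys w \<subseteq> U.basis"
    "C = tensor_class (function_ring A U) (sect F U) (sect G U) w"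
    using C unfolding sect_T by (rule U.tensor_product_cases)
  have "W \<subseteq> U" using o by blast
  have "frag_extend (\<lambda>(s, t). frag_of (res F V W s, res G V W t))
      (frag_extend (\<lambda>(s, t). frag_of (res F U V s, res G U V t)) w) =
      frag_extend (\<lambda>(s, t). frag_of (res F U W s, res G U W t)) w"
    using w(1) by (induction rule: U.tensor_product_induct)
      (use o in \<open>simp_all add: F.res_res G.res_res frag_extend_diff\<close>)
  then show "res T V W (res T U V C) = res T U W C"
    using o \<open>W \<subseteq> U\<close> by (simp add: w res_T)
qed

sublocale T: module_presheaf_on A T
  by unfold_locales (rule presheaf_T)

abbreviation "S \<equiv> tensor_sheaf A F G"

lemma sheaf_S: "sheaf_of_modules A S"
  unfolding tensor_sheaf_def by (rule T.sheaf_sheafification)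

sublocale S: module_presheaf_on A S
  using sheaf_S by unfold_locales (simp add: sheaf_of_modules_def)

lemma pure_class_closed:
  assumes "open U" "s \<in> carrier (sect F U)" "t \<in> carrier (sect G U)"
  shows "tensor_class (function_ring A U) (sect F U) (sect G U) (frag_of (s, t)) \<in> carrier (sect T U)"
  unfolding sect_T by (rule module_pair.tensor_class_closed[OF module_pair_sect]) (use assms in simp_all)

lemma pure_tensor_closed:
  "open U \<Longrightarrow> s \<in> carrier (sect F U) \<Longrightarrow> t \<in> carrier (sect G U) \<Longrightarrow>
    pure_tensor A F G U s t \<in> carrier (sect S U)"
  unfolding pure_tensor_def tensor_sheaf_def by (intro T.to_sheafification_closed pure_class_closed)

lemma pure_tensor_add_left:
  assumes "open U" "s \<in> carrier (sect F U)" "s' \<in> carrier (sect F U)" "t \<in> carrier (sect G U)"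
  shows "pure_tensor A F G U (s \<oplus>\<^bsub>sect F U\<^esub> s') t =
    pure_tensor A F G U s t \<oplus>\<^bsub>sect S U\<^esub> pure_tensor A F G U s' t"
proof -
  interpret U: module_pair "function_ring A U" "sect F U" "sect G U" using assms(1) by (rule module_pair_sect)
  show ?thesis
    unfolding pure_tensor_def U.tensor_class_pure(1)[OF assms(2-4)] sect_T[symmetric] tensor_sheaf_def
    using assms by (intro T.to_sheafification_add pure_class_closed)
qed

lemma pure_tensor_add_right:
  assumes "open U" "s \<in> carrier (sect F U)" "t \<in> carrier (sect G U)" "t' \<in> carrier (sect G U)"
  shows "pure_tensor A F G U s (t \<oplus>\<^bsub>sect G U\<^esub> t') =
    pure_tensor A F G U s t \<oplus>\<^bsub>sect S U\<^esub> pure_tensor A F G U s t'"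
proof -
  interpret U: module_pair "function_ring A U" "sect F U" "sect G U" using assms(1) by (rule module_pair_sect)
  show ?thesis
    unfolding pure_tensor_def U.tensor_class_pure(2)[OF assms(2-4)] sect_T[symmetric] tensor_sheaf_def
    using assms by (intro T.to_sheafification_add pure_class_closed)
qed

lemma pure_tensor_smult:
  assumes "open U" "g \<in> A U" "s \<in> carrier (sect F U)" "t \<in> carrier (sect G U)"
  shows "pure_tensor A F G U (g \<odot>\<^bsub>sect F U\<^esub> s) t = g \<odot>\<^bsub>sect S U\<^esub> pure_tensor A F G U s t"
proof -
  interpret U: module_pair "function_ring A U" "sect F U" "sect G U" using assms(1) by (rule module_pair_sect)
  have "tensor_class (function_ring A U) (sect F U) (sect G U) (frag_of (g \<odot>\<^bsub>sect F U\<^esub> s, t)) =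
      g \<odot>\<^bsub>sect T U\<^esub> tensor_class (function_ring A U) (sect F U) (sect G U) (frag_of (s, t))"
    using assms by (simp add: sect_T U.tensor_product_smult)
  then show ?thesis
    unfolding pure_tensor_def tensor_sheaf_def
    using assms by (simp add: T.to_sheafification_smult pure_class_closed)
qed

lemma pure_tensor_balanced:
  assumes "open U" "g \<in> A U" "s \<in> carrier (sect F U)" "t \<in> carrier (sect G U)"
  shows "pure_tensor A F G U (g \<odot>\<^bsub>sect F U\<^esub> s) t = pure_tensor A F G U s (g \<odot>\<^bsub>sect G U\<^esub> t)"
  unfolding pure_tensor_def
  using module_pair.tensor_class_pure(3)[OF module_pair_sect[OF assms(1)], of g s t] assms by simp

lemma pure_tensor_res:
  assumes "open U" "open V" "V \<subseteq> U" "s \<in> carrier (sect F U)" "t \<in> carrier (sect G U)"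
  shows "res S U V (pure_tensor A F G U s t) = pure_tensor A F G V (res F U V s) (res G U V t)"
  unfolding pure_tensor_def tensor_sheaf_def
  using T.to_sheafification_res[OF assms(1-3) pure_class_closed[OF assms(1,4,5)]]
  by (simp add: res_T[OF assms(1-3)])

text \<open>Two universal properties in succession: that of the tensor product of modules on each
  open set, then that of sheafification. In between, the maps on different open sets have to be
  shown compatible.\<close>

lemma tensor_lift_exists:
  assumes H: "sheaf_of_modules A H" and b: "biadditive_on A X F G H b"
  obtains \<psi> where "additive_on X S H \<psi>"
    "\<forall>U s t. open U \<longrightarrow> U \<subseteq> X \<longrightarrow> s \<in> carrier (sect F U) \<longrightarrow> t \<in> carrier (sect G U) \<longrightarrow>
      \<psi> U (pure_tensor A F G U s t) = b U s t"
proof -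
  interpret H: module_presheaf_on A H
    using H by unfold_locales (simp add: sheaf_of_modules_def)
  note bD = biadditive_onD[OF b]
  let ?c = "\<lambda>U. tensor_class (function_ring A U) (sect F U) (sect G U)"
  \<comment> \<open>\<open>Q U\<close> records what the universal property for modules provides, so
    that one map for each open set can be selected by choice.\<close>
  define Q where "Q U \<phi> \<longleftrightarrow> \<phi> \<in> carrier (sect T U) \<rightarrow> carrier (sect H U) \<and>
      (\<forall>C\<in>carrier (sect T U). \<forall>C'\<in>carrier (sect T U). \<phi> (C \<oplus>\<^bsub>sect T U\<^esub> C') = \<phi> C \<oplus>\<^bsub>sect H U\<^esub> \<phi> C') \<and>
      (\<forall>s\<in>carrier (sect F U). \<forall>t\<in>carrier (sect G U). \<phi> (?c U (frag_of (s, t))) = b U s t)" for U \<phi>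
  have "\<exists>\<phi>. Q U \<phi>" if U: "open U" "U \<subseteq> X" for U
  proof -
    interpret U: module_pair "function_ring A U" "sect F U" "sect G U" using U(1) by (rule module_pair_sect)
    have bl: "b U (s \<oplus>\<^bsub>sect F U\<^esub> s') t = b U s t \<oplus>\<^bsub>sect H U\<^esub> b U s' t"
      if "s \<in> carrier (sect F U)" "s' \<in> carrier (sect F U)" "t \<in> carrier (sect G U)" for s s' t
      using bD(2)[OF U that(1,3,2)] .
    have bs: "b U (g \<odot>\<^bsub>sect F U\<^esub> s) t = b U s (g \<odot>\<^bsub>sect G U\<^esub> t)"
      if "g \<in> carrier (function_ring A U)" "s \<in> carrier (sect F U)" "t \<in> carrier (sect G U)" for g s t
      using bD(4)[OF U that(2,3)] that(1) by simp
    obtain \<phi> where "\<phi> \<in> carrier (sect T U) \<rightarrow> carrier (sect H U)"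
      "\<forall>C\<in>carrier (sect T U). \<forall>C'\<in>carrier (sect T U).
        \<phi> (C \<oplus>\<^bsub>sect T U\<^esub> C') = \<phi> C \<oplus>\<^bsub>sect H U\<^esub> \<phi> C'"
      "\<forall>s\<in>carrier (sect F U). \<forall>t\<in>carrier (sect G U). \<phi> (?c U (frag_of (s, t))) = b U s t"
      unfolding sect_T
      by (rule U.tensor_product_universal[OF H.sect_abelian_group[OF U(1)] bD(1)[OF U] bl bD(3)[OF U] bs])
    then show ?thesis unfolding Q_def by (intro exI[of _ \<phi>]) simp
  qed
  then have "\<forall>U. \<exists>\<phi>. open U \<and> U \<subseteq> X \<longrightarrow> Q U \<phi>" by blast
  from choice[OF this] obtain \<phi> where \<phi>': "\<forall>U. open U \<and> U \<subseteq> X \<longrightarrow> Q U (\<phi> U)" ..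
  then have \<phi>:
    "\<And>U C. open U \<Longrightarrow> U \<subseteq> X \<Longrightarrow> C \<in> carrier (sect T U) \<Longrightarrow> \<phi> U C \<in> carrier (sect H U)"
    "\<And>U C C'. open U \<Longrightarrow> U \<subseteq> X \<Longrightarrow> C \<in> carrier (sect T U) \<Longrightarrow> C' \<in> carrier (sect T U) \<Longrightarrow>
      \<phi> U (C \<oplus>\<^bsub>sect T U\<^esub> C') = \<phi> U C \<oplus>\<^bsub>sect H U\<^esub> \<phi> U C'"
    "\<And>U s t. open U \<Longrightarrow> U \<subseteq> X \<Longrightarrow> s \<in> carrier (sect F U) \<Longrightarrow> t \<in> carrier (sect G U) \<Longrightarrow>
      \<phi> U (?c U (frag_of (s, t))) = b U s t"
    unfolding Q_def Pi_iff by simp_all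
  \<comment> \<open>The maps were chosen independently for each open set. They commute with
    restriction because they do so on pure tensors, which generate.\<close>
  have nat: "\<phi> V (res T U V C) = res H U V (\<phi> U C)"
    if U: "open U" "U \<subseteq> X" and C: "C \<in> carrier (sect T U)" and V: "open V" "V \<subseteq> U" for U V C
  proof -
    interpret U: module_pair "function_ring A U" "sect F U" "sect G U" using U(1) by (rule module_pair_sect)
    have VX: "V \<subseteq> X" using U V by blast
    interpret HV: abelian_group "sect H V" using V(1) by (rule H.sect_abelian_group)
    obtain w where w: "Poly_Mapping.keys w \<subseteq> U.basis" "C = ?c U w"
      using C unfolding sect_T by (rule U.tensor_product_cases)
    have "\<phi> V (res T U V (?c U w)) = res H U V (\<phi> U (?c U w))"
      using w(1)
    proof (induction rule: U.tensor_product_induct)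
      case (pure s t)
      then show ?case using U V VX
        by (simp add: res_T \<phi>(3) F.res_closed G.res_closed bD(5))
    next
      case zero
      have z: "\<zero>\<^bsub>sect T U\<^esub> = ?c U 0" by (simp add: sect_T U.tensor_product_zero)
      have *: "\<phi> U \<zero>\<^bsub>sect T U\<^esub> = \<zero>\<^bsub>sect H U\<^esub>" if U: "open U" "U \<subseteq> X" for U
      proof -
        interpret TU: abelian_group "sect T U" using U(1) by (rule T.sect_abelian_group)
        interpret HU: abelian_group "sect H U" using U(1) by (rule H.sect_abelian_group)
        have "\<phi> U \<zero>\<^bsub>sect T U\<^esub> \<oplus>\<^bsub>sect H U\<^esub> \<phi> U \<zero>\<^bsub>sect T U\<^esub> = \<phi> U \<zero>\<^bsub>sect T U\<^esub>"
          using \<phi>(2)[OF U, of "\<zero>\<^bsub>sect T U\<^esub>" "\<zero>\<^bsub>sect T U\<^esub>"] by simp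
        then show ?thesis using \<phi>(1)[OF U, of "\<zero>\<^bsub>sect T U\<^esub>"] by simp
      qed
      show ?case
        unfolding z[symmetric] using U V VX by (simp add: T.res_zero H.res_zero *)
    next
      case (diff v w)
      have k: "Poly_Mapping.keys (v - w) \<subseteq> U.basis" using diff keys_diff[of v w] by blast
      let ?d = "?c U (v - w)"
      have cl: "?d \<in> carrier (sect T U)" "?c U w \<in> carrier (sect T U)" "?c U v \<in> carrier (sect T U)"
        using k diff by (auto simp: sect_T intro: U.tensor_class_closed)
      \<comment> \<open>The maps are known to respect sums, not differences, so v is written as (v -
        w) + w and the common summand is cancelled afterwards.\<close>
      have sum: "?c U v = ?d \<oplus>\<^bsub>sect T U\<^esub> ?c U w" by (simp add: sect_T U.tensor_product_add)
      note cl' = cl[THEN T.res_closed[OF U(1) V]]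
      have "\<phi> V (res T U V ?d) \<oplus>\<^bsub>sect H V\<^esub> \<phi> V (res T U V (?c U w)) = \<phi> V (res T U V (?c U v))"
        unfolding sum using U V VX cl cl' by (simp add: T.res_add \<phi>(2))
      moreover have "res H U V (\<phi> U ?d) \<oplus>\<^bsub>sect H V\<^esub> res H U V (\<phi> U (?c U w)) = res H U V (\<phi> U (?c U v))"
        unfolding sum using U V cl by (simp add: \<phi> H.res_add)
      ultimately have "\<phi> V (res T U V ?d) \<oplus>\<^bsub>sect H V\<^esub> \<phi> V (res T U V (?c U w)) =
          res H U V (\<phi> U ?d) \<oplus>\<^bsub>sect H V\<^esub> \<phi> V (res T U V (?c U w))"
        using diff by simp
      then show ?case
        using HV.add.right_cancel cl cl' U V VX \<phi>(1) H.res_closed by metis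
    qed
    then show ?thesis by (simp add: w)
  qed
  have "additive_on X T H \<phi>"
    unfolding additive_on_def by (intro allI impI ballI conjI \<phi>(1,2) nat)
  from T.sheafification_lift[OF H this] obtain \<psi> where \<psi>: "additive_on X (sheafification T) H \<psi>"
    "\<forall>U C. open U \<longrightarrow> U \<subseteq> X \<longrightarrow> C \<in> carrier (sect T U) \<longrightarrow> \<psi> U (to_sheafification T U C) = \<phi> U C" .
  show ?thesis
    by (rule that[of \<psi>])
       (use \<psi> \<phi>(3) in \<open>simp_all add: tensor_sheaf_def pure_tensor_def pure_class_closed\<close>)
qed

text \<open>Near each point a section is the image of a coset, that is of an integer combination of
  pure tensors over a smaller open set. Agreement is therefore assumed over all smaller open sets,
  and separatedness of H carries the local equality back to U.\<close>

lemma tensor_eqI: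
  assumes H: "sheaf_of_modules A H" and \<psi>: "additive_on X S H \<psi>" and \<psi>': "additive_on X S H \<psi>'"
    and eq: "\<And>U s t. open U \<Longrightarrow> U \<subseteq> X \<Longrightarrow> s \<in> carrier (sect F U) \<Longrightarrow> t \<in> carrier (sect G U) \<Longrightarrow>
      \<psi> U (pure_tensor A F G U s t) = \<psi>' U (pure_tensor A F G U s t)"
    and U: "open U" "U \<subseteq> X" and \<tau>: "\<tau> \<in> carrier (sect S U)"
  shows "\<psi> U \<tau> = \<psi>' U \<tau>"
proof (rule sheaf_eqI[OF H U(1)])
  interpret H: module_presheaf_on A H
    using H by unfold_locales (simp add: sheaf_of_modules_def)
  note D = additive_onD[OF \<psi>] and D' = additive_onD[OF \<psi>']
  show "\<psi> U \<tau> \<in> carrier (sect H U)" "\<psi>' U \<tau> \<in> carrier (sect H U)"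
    using D(1)[OF U \<tau>] D'(1)[OF U \<tau>] .
  fix x assume x: "x \<in> U"
  have \<tau>': "\<tau> \<in> carrier (sect (sheafification T) U)" using \<tau> by (simp add: tensor_sheaf_def)
  obtain V C where V: "open V" "x \<in> V" "V \<subseteq> U" "C \<in> carrier (sect T V)" "\<forall>y\<in>V. \<tau> y = germ T y V C"
    using T.section_local[OF \<tau>' x] .
  have VX: "V \<subseteq> X" using V U by blast
  interpret V: module_pair "function_ring A V" "sect F V" "sect G V" using V(1) by (rule module_pair_sect)
  interpret HV: abelian_group "sect H V" using V(1) by (rule H.sect_abelian_group)
  interpret SV: abelian_group "sect S V" using V(1) by (rule S.sect_abelian_group)
  let ?c = "\<lambda>w. to_sheafification T V (tensor_class (function_ring A V) (sect F V) (sect G V) w)"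
  obtain w where w: "Poly_Mapping.keys w \<subseteq> V.basis" "C = tensor_class (function_ring A V) (sect F V) (sect G V) w"
    using V(4) unfolding sect_T by (rule V.tensor_product_cases)
  have c_cl: "?c w \<in> carrier (sect S V)" if "Poly_Mapping.keys w \<subseteq> V.basis" for w
    unfolding tensor_sheaf_def
    by (intro T.to_sheafification_closed V(1)) (simp add: sect_T V.tensor_class_closed[OF that])
  have "\<psi> V (?c w) = \<psi>' V (?c w)"
    using w(1)
  proof (induction rule: V.tensor_product_induct)
    case (pure s t)
    then show ?case using eq[OF V(1) VX pure] by (simp add: pure_tensor_def)
  next
    case zero
    have z: "?c 0 = \<zero>\<^bsub>sect S V\<^esub>"
      by (simp add: tensor_sheaf_def T.sheafification_zero sect_T V.tensor_product_zero)
    have "f V \<zero>\<^bsub>sect S V\<^esub> = \<zero>\<^bsub>sect H V\<^esub>" if "additive_on X S H f" for f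
      using additive_onD(2)[OF that V(1) VX SV.zero_closed SV.zero_closed]
        additive_onD(1)[OF that V(1) VX SV.zero_closed] by simp
    with \<psi> \<psi>' show ?case unfolding z by metis
  next
    case (diff v w)
    have k: "Poly_Mapping.keys (v - w) \<subseteq> V.basis" using diff keys_diff[of v w] by blast
    note cl = c_cl[OF k] c_cl[OF diff(2)] c_cl[OF diff(1)]
    have T_cl: "tensor_class (function_ring A V) (sect F V) (sect G V) u \<in> carrier (sect T V)"
      if "Poly_Mapping.keys u \<subseteq> V.basis" for u
      using V.tensor_class_closed[OF that] by (simp add: sect_T)
    have "tensor_class (function_ring A V) (sect F V) (sect G V) v =
        tensor_class (function_ring A V) (sect F V) (sect G V) (v - w) \<oplus>\<^bsub>sect T V\<^esub>
        tensor_class (function_ring A V) (sect F V) (sect G V) w" by (simp add: sect_T V.tensor_product_add)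
    then have sum: "?c v = ?c (v - w) \<oplus>\<^bsub>sect S V\<^esub> ?c w"
      unfolding tensor_sheaf_def using T.to_sheafification_add[OF V(1) T_cl[OF k] T_cl[OF diff(2)]] by simp
    have "\<psi> V (?c (v - w)) \<oplus>\<^bsub>sect H V\<^esub> \<psi> V (?c w) = \<psi>' V (?c (v - w)) \<oplus>\<^bsub>sect H V\<^esub> \<psi> V (?c w)"
      using diff(3,4) unfolding sum D(2)[OF V(1) VX cl(1,2)] D'(2)[OF V(1) VX cl(1,2)] by simp
    then show ?case
      using HV.add.right_cancel D(1)[OF V(1) VX] D'(1)[OF V(1) VX] cl by metis
  qed
  moreover have "res S U V \<tau> = ?c w"
    unfolding tensor_sheaf_def w(2)[symmetric] using V(5) by (intro T.res_eq_to_sheafification) blast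
  ultimately show "\<exists>V. open V \<and> x \<in> V \<and> V \<subseteq> U \<and> res H U V (\<psi> U \<tau>) = res H U V (\<psi>' U \<tau>)"
    using V(1-3) D(3)[OF U \<tau> V(1,3)] D'(3)[OF U \<tau> V(1,3)] by metis
qed

text \<open>From here to \<open>additive_morphisms_eqI\<close>, F and G are source and target of
  morphisms rather than factors of a tensor product.\<close>

lemma additive_on_add:
  assumes "additive_on X F G \<phi>" "additive_on X F G \<psi>"
  shows "additive_on X F G (\<lambda>U s. \<phi> U s \<oplus>\<^bsub>sect G U\<^esub> \<psi> U s)"
  unfolding additive_on_def
proof (intro allI impI ballI conjI)
  fix U s assume U: "open U" "U \<subseteq> X" and s: "s \<in> carrier (sect F U)"
  interpret U: abelian_group "sect G U" using U(1) by (rule G.sect_abelian_group)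
  note D = additive_onD[OF assms(1) U] and D' = additive_onD[OF assms(2) U]
  show "\<phi> U s \<oplus>\<^bsub>sect G U\<^esub> \<psi> U s \<in> carrier (sect G U)" using D(1)[OF s] D'(1)[OF s] by simp
  show "\<phi> U (s \<oplus>\<^bsub>sect F U\<^esub> t) \<oplus>\<^bsub>sect G U\<^esub> \<psi> U (s \<oplus>\<^bsub>sect F U\<^esub> t) =
      \<phi> U s \<oplus>\<^bsub>sect G U\<^esub> \<psi> U s \<oplus>\<^bsub>sect G U\<^esub> (\<phi> U t \<oplus>\<^bsub>sect G U\<^esub> \<psi> U t)" if t: "t \<in> carrier (sect F U)" for t
    using D(1)[OF s] D'(1)[OF s] D(1)[OF t] D'(1)[OF t] D(2)[OF s t] D'(2)[OF s t] by (simp add: U.a_ac)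
  show "\<phi> V (res F U V s) \<oplus>\<^bsub>sect G V\<^esub> \<psi> V (res F U V s) = res G U V (\<phi> U s \<oplus>\<^bsub>sect G U\<^esub> \<psi> U s)"
    if V: "open V" "V \<subseteq> U" for V
    using D(1)[OF s] D'(1)[OF s] D(3)[OF s V] D'(3)[OF s V] U V by (simp add: G.res_add)
qed

text \<open>The fixed scalar g is cut down to each U, which makes the rescaled family commute with
  restriction. Together with \<open>additive_on_smult_arg\<close> this turns linearity of \<phi>
  into an equality of two additive maps.\<close>

lemma additive_on_smult:
  assumes "additive_on X F G \<phi>" "open X" "g \<in> A X"
  shows "additive_on X F G (\<lambda>U s. cut U g \<odot>\<^bsub>sect G U\<^esub> \<phi> U s)"
  unfolding additive_on_def
proof (intro allI impI ballI conjI)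
  fix U s assume U: "open U" "U \<subseteq> X" and s: "s \<in> carrier (sect F U)"
  interpret U: module "function_ring A U" "sect G U" using U(1) by (rule G.sect_module)
  note D = additive_onD[OF assms(1) U]
  have g: "cut U g \<in> A U" using assms(2) U assms(3) by (rule F.cut_closed)
  show "cut U g \<odot>\<^bsub>sect G U\<^esub> \<phi> U s \<in> carrier (sect G U)" using D(1)[OF s] g by simp
  show "cut U g \<odot>\<^bsub>sect G U\<^esub> \<phi> U (s \<oplus>\<^bsub>sect F U\<^esub> t) =
      cut U g \<odot>\<^bsub>sect G U\<^esub> \<phi> U s \<oplus>\<^bsub>sect G U\<^esub> cut U g \<odot>\<^bsub>sect G U\<^esub> \<phi> U t" if t: "t \<in> carrier (sect F U)" for t
    using D(1)[OF s] D(1)[OF t] D(2)[OF s t] g by (simp add: U.smult_r_distr)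
  show "cut V g \<odot>\<^bsub>sect G V\<^esub> \<phi> V (res F U V s) = res G U V (cut U g \<odot>\<^bsub>sect G U\<^esub> \<phi> U s)"
    if V: "open V" "V \<subseteq> U" for V
    using D(1)[OF s] D(3)[OF s V] U V g by (simp add: G.res_smult cut_cut)
qed

lemma additive_on_smult_arg:
  assumes "additive_on X F G \<phi>" "open X" "g \<in> A X"
  shows "additive_on X F G (\<lambda>U s. \<phi> U (cut U g \<odot>\<^bsub>sect F U\<^esub> s))"
  unfolding additive_on_def
proof (intro allI impI ballI conjI)
  fix U s assume U: "open U" "U \<subseteq> X" and s: "s \<in> carrier (sect F U)"
  interpret U: module "function_ring A U" "sect F U" using U(1) by (rule F.sect_module)
  note D = additive_onD[OF assms(1) U]
  have g: "cut U g \<in> A U" using assms(2) U assms(3) by (rule F.cut_closed)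
  have gs: "cut U g \<odot>\<^bsub>sect F U\<^esub> s \<in> carrier (sect F U)" using g s by simp
  show "\<phi> U (cut U g \<odot>\<^bsub>sect F U\<^esub> s) \<in> carrier (sect G U)" using D(1)[OF gs] .
  show "\<phi> U (cut U g \<odot>\<^bsub>sect F U\<^esub> (s \<oplus>\<^bsub>sect F U\<^esub> t)) =
      \<phi> U (cut U g \<odot>\<^bsub>sect F U\<^esub> s) \<oplus>\<^bsub>sect G U\<^esub> \<phi> U (cut U g \<odot>\<^bsub>sect F U\<^esub> t)" if t: "t \<in> carrier (sect F U)" for t
    using D(2)[OF gs, of "cut U g \<odot>\<^bsub>sect F U\<^esub> t"] s t g by (simp add: U.smult_r_distr)
  show "\<phi> V (cut V g \<odot>\<^bsub>sect F V\<^esub> res F U V s) = res G U V (\<phi> U (cut U g \<odot>\<^bsub>sect F U\<^esub> s))"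
    if V: "open V" "V \<subseteq> U" for V
    using D(3)[OF gs V] U V g s by (simp add: F.res_smult cut_cut)
qed

text \<open>Puts a family into the extensional form of \<open>additive_morphisms\<close>, where
  uniqueness means equality in HOL, as a definite description demands.\<close>

lemma additive_on_restrict:
  assumes "additive_on UNIV F G \<phi>"
  shows "(\<lambda>U. restrict (\<phi> U) (if open U then carrier (sect F U) else {})) \<in> additive_morphisms F G"
  unfolding additive_morphisms_def
proof (intro CollectI conjI allI impI ballI)
  fix U
  show "restrict (\<phi> U) (if open U then carrier (sect F U) else {})
      \<in> (if open U then carrier (sect F U) else {}) \<rightarrow>\<^sub>E carrier (sect G U)"
    using additive_onD(1)[OF assms] by auto
  fix s assume U: "open U" and s: "s \<in> carrier (sect F U)"
  note D = additive_onD[OF assms U subset_UNIV s]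
  show "restrict (\<phi> U) (if open U then carrier (sect F U) else {}) (s \<oplus>\<^bsub>sect F U\<^esub> t) =
      restrict (\<phi> U) (if open U then carrier (sect F U) else {}) s \<oplus>\<^bsub>sect G U\<^esub>
      restrict (\<phi> U) (if open U then carrier (sect F U) else {}) t" if "t \<in> carrier (sect F U)" for t
    using U s that D(2)[OF that] by (simp add: F.sect_add_closed)
  show "restrict (\<phi> V) (if open V then carrier (sect F V) else {}) (res F U V s) =
      res G U V (restrict (\<phi> U) (if open U then carrier (sect F U) else {}) s)" if "open V" "V \<subseteq> U" for V
    using U s that D(3)[OF that] by (simp add: F.res_closed)
qed

lemma additive_morphisms_eqI:
  assumes "\<phi> \<in> additive_morphisms F G" "\<psi> \<in> additive_morphisms F G"
    and "\<And>U s. open U \<Longrightarrow> s \<in> carrier (sect F U) \<Longrightarrow> \<phi> U s = \<psi> U s"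
  shows "\<phi> = \<psi>"
proof
  fix U
  have "\<phi> U \<in> (if open U then carrier (sect F U) else {}) \<rightarrow>\<^sub>E carrier (sect G U)"
    "\<psi> U \<in> (if open U then carrier (sect F U) else {}) \<rightarrow>\<^sub>E carrier (sect G U)"
    by (rule additive_morphism_PiE[OF assms(1)], rule additive_morphism_PiE[OF assms(2)])
  then show "\<phi> U = \<psi> U"
    by (rule PiE_ext) (use assms(3) in \<open>auto split: if_splits\<close>)
qed

lemma pair_S: "presheaf_of_modules A H \<Longrightarrow> module_presheaf_pair A S H"
  by (intro module_presheaf_pair.intro S.module_presheaf_on_axioms module_presheaf_on.intro
      F.function_presheaf_axioms module_presheaf_on_axioms.intro)

text \<open>Existence is \<open>tensor_lift_exists\<close> made extensional, uniqueness is
  \<open>tensor_eqI\<close> over the whole space.\<close>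

lemma tensor_lift:
  assumes H: "sheaf_of_modules A H" and b: "biadditive_on A UNIV F G H b"
  shows "tensor_lift A F G H b \<in> additive_morphisms S H"
    and "\<And>U s t. open U \<Longrightarrow> s \<in> carrier (sect F U) \<Longrightarrow> t \<in> carrier (sect G U) \<Longrightarrow>
      tensor_lift A F G H b U (pure_tensor A F G U s t) = b U s t"
proof -
  interpret SH: module_presheaf_pair A S H
    using H by (intro pair_S) (simp add: sheaf_of_modules_def)
  obtain \<psi> where \<psi>: "additive_on UNIV S H \<psi>"
    "\<forall>U s t. open U \<longrightarrow> U \<subseteq> UNIV \<longrightarrow> s \<in> carrier (sect F U) \<longrightarrow> t \<in> carrier (sect G U) \<longrightarrow>
      \<psi> U (pure_tensor A F G U s t) = b U s t"
    by (rule tensor_lift_exists[OF H b])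
  define \<phi> where "\<phi> = (\<lambda>U. restrict (\<psi> U) (if open U then carrier (sect S U) else {}))"
  have "\<phi> \<in> additive_morphisms S H \<and> (\<forall>U. open U \<longrightarrow> (\<forall>s\<in>carrier (sect F U). \<forall>t\<in>carrier (sect G U).
      \<phi> U (pure_tensor A F G U s t) = b U s t))"
    unfolding \<phi>_def using SH.additive_on_restrict[OF \<psi>(1)] \<psi>(2) by (simp add: pure_tensor_closed)
  moreover have "\<phi>' = \<phi>" if "\<phi>' \<in> additive_morphisms S H \<and> (\<forall>U. open U \<longrightarrow> (\<forall>s\<in>carrier (sect F U). \<forall>t\<in>carrier (sect G U).
      \<phi>' U (pure_tensor A F G U s t) = b U s t))" for \<phi>'
  proof (rule SH.additive_morphisms_eqI)
    show "\<phi>' U s = \<phi> U s" if "open U" "s \<in> carrier (sect S U)" for U s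
      by (rule tensor_eqI[OF H additive_on_morphism additive_on_morphism _ that(1) subset_UNIV that(2)])
         (use \<open>\<phi>' \<in> _ \<and> _\<close> calculation in auto)
  qed (use that calculation in auto)
  ultimately have "tensor_lift A F G H b \<in> additive_morphisms S H \<and> (\<forall>U. open U \<longrightarrow>
      (\<forall>s\<in>carrier (sect F U). \<forall>t\<in>carrier (sect G U).
      tensor_lift A F G H b U (pure_tensor A F G U s t) = b U s t))"
    unfolding tensor_lift_def by (rule theI)
  then show "tensor_lift A F G H b \<in> additive_morphisms S H"
    and "\<And>U s t. open U \<Longrightarrow> s \<in> carrier (sect F U) \<Longrightarrow> t \<in> carrier (sect G U) \<Longrightarrow>
      tensor_lift A F G H b U (pure_tensor A F G U s t) = b U s t" by auto
qed

end

section \<open>Vector fields and forms\<close>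

lemma list_cases2:
  obtains (Nil) "Xs = []" | (one) X where "Xs = [X]" | (two) X Y where "Xs = [X, Y]"
  | (more) "length Xs > 2"
  by (cases Xs rule: remdups_adj.cases; cases "tl (tl Xs)") auto

lemma permutes_two: "{\<pi>. \<pi> permutes {..<2::nat}} = {id, Transposition.transpose 0 1}"
proof -
  have *: "{..<2::nat} = {0, 1}" by auto
  show ?thesis unfolding * permutes_doubleton_iff by auto
qed

text \<open>For k = l = 1 the factorials are 1, and the identity and the transposition contribute
  with opposite signs.\<close>

lemma wedge_1_1:
  "wedge 1 1 \<alpha> \<beta> V Xs x = (case Xs of [X, Y] \<Rightarrow> \<alpha> V [X] x * \<beta> V [Y] x - \<alpha> V [Y] x * \<beta> V [X] x | _ \<Rightarrow> 0)"
proof (cases "length Xs = 2")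
  case True
  then obtain X Y where Xs: "Xs = [X, Y]"
    by (cases Xs rule: list_cases2) auto
  \<comment> \<open>The two permutations must be distinct for the sum over the set of both to split
    into two terms.\<close>
  have ne: "id \<noteq> Transposition.transpose (0::nat) 1"
    by (metis One_nat_def id_apply n_not_Suc_n transpose_apply_first)
  have "wedge 1 1 \<alpha> \<beta> V Xs x = (\<Sum>\<pi>\<in>{id, Transposition.transpose 0 1}. of_int (sign \<pi>) *
      \<alpha> V (map (\<lambda>i. Xs ! \<pi> i) [0..<1]) x * \<beta> V (map (\<lambda>i. Xs ! \<pi> i) [1..<1 + 1]) x)"
    using True by (simp only: wedge_def one_add_one permutes_two refl if_True fact_1 mult_1 div_by_1)
  also have "\<dots> = \<alpha> V [X] x * \<beta> V [Y] x - \<alpha> V [Y] x * \<beta> V [X] x"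
    using ne by (simp add: Xs sign_swap_id)
  finally show ?thesis by (simp add: Xs)
next
  case False
  then show ?thesis by (auto simp: wedge_def split: list.splits)
qed

lemma cut_add: "cut V (\<lambda>x. f x + g x) = (\<lambda>x. cut V f x + cut V (g :: _ \<Rightarrow> 'k::monoid_add) x)"
  by (auto simp: cut_def)

lemma cut_diff: "cut V (\<lambda>x. f x - g x) = (\<lambda>x. cut V f x - cut V (g :: _ \<Rightarrow> 'k::group_add) x)"
  by (auto simp: cut_def)

lemma cut_mult: "cut V (\<lambda>x. f x * g x) = (\<lambda>x. cut V f x * cut V (g :: _ \<Rightarrow> 'k::mult_zero) x)"
  by (auto simp: cut_def)

lemma cut_zero [simp]: "cut V (\<lambda>x. 0) = (\<lambda>x. 0)"
  by (auto simp: cut_def)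

section \<open>Vector fields and the Lie bracket\<close>

context function_presheaf begin

lemma diff_closed: "open U \<Longrightarrow> f \<in> A U \<Longrightarrow> g \<in> A U \<Longrightarrow> (\<lambda>x. f x - g x) \<in> A U"
  using add_closed[of U f "\<lambda>x. - g x"] uminus_closed[of U g] by simp

lemma vector_field_mem:
  assumes "X \<in> vector_fields A U"
  shows "X V f \<in> (if open V \<and> V \<subseteq> U \<and> f \<in> A V then A V else {\<lambda>x. 0})"
  using assms unfolding vector_fields_def mem_Collect_eq by (elim conjE, elim allE)

lemma vector_field_closed:
  "X \<in> vector_fields A U \<Longrightarrow> open V \<Longrightarrow> V \<subseteq> U \<Longrightarrow> f \<in> A V \<Longrightarrow> X V f \<in> A V"
  using vector_field_mem[of X U V f] by simp

lemma vector_field_outside: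
  "X \<in> vector_fields A U \<Longrightarrow> \<not> (open V \<and> V \<subseteq> U \<and> f \<in> A V) \<Longrightarrow> X V f = (\<lambda>x. 0)"
  using vector_field_mem[of X U V f] by (simp only: if_False singleton_iff)

lemma vector_field_rules:
  assumes "X \<in> vector_fields A U" "open V" "V \<subseteq> U" "f \<in> A V"
  shows vector_field_add: "g \<in> A V \<Longrightarrow> X V (\<lambda>x. f x + g x) = (\<lambda>x. X V f x + X V g x)"
    and vector_field_scale: "X V (\<lambda>x. c * f x) = (\<lambda>x. c * X V f x)"
    and vector_field_mult: "g \<in> A V \<Longrightarrow> X V (\<lambda>x. f x * g x) = (\<lambda>x. X V f x * g x + f x * X V g x)"
    and vector_field_cut: "open W \<Longrightarrow> W \<subseteq> V \<Longrightarrow> X W (cut W f) = cut W (X V f)"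
  using assms unfolding vector_fields_def by simp_all

lemma vector_field_zero: "X \<in> vector_fields A U \<Longrightarrow> X V (\<lambda>x. 0) = (\<lambda>x. 0)"
  using vector_field_scale[of X U V "\<lambda>x. 0" 0] vector_field_outside[of X U V "\<lambda>x. 0"] zero_closed[of V]
  by (cases "open V \<and> V \<subseteq> U") auto

lemma vector_fieldsI:
  assumes "\<And>V f. open V \<Longrightarrow> V \<subseteq> U \<Longrightarrow> f \<in> A V \<Longrightarrow> X V f \<in> A V"
    and "\<And>V f. \<not> (open V \<and> V \<subseteq> U \<and> f \<in> A V) \<Longrightarrow> X V f = (\<lambda>x. 0)"
    and "\<And>V f g. open V \<Longrightarrow> V \<subseteq> U \<Longrightarrow> f \<in> A V \<Longrightarrow> g \<in> A V \<Longrightarrow> X V (\<lambda>x. f x + g x) = (\<lambda>x. X V f x + X V g x)"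
    and "\<And>V c f. open V \<Longrightarrow> V \<subseteq> U \<Longrightarrow> f \<in> A V \<Longrightarrow> X V (\<lambda>x. c * f x) = (\<lambda>x. c * X V f x)"
    and "\<And>V f g. open V \<Longrightarrow> V \<subseteq> U \<Longrightarrow> f \<in> A V \<Longrightarrow> g \<in> A V \<Longrightarrow>
      X V (\<lambda>x. f x * g x) = (\<lambda>x. X V f x * g x + f x * X V g x)"
    and "\<And>V W f. open V \<Longrightarrow> open W \<Longrightarrow> W \<subseteq> V \<Longrightarrow> V \<subseteq> U \<Longrightarrow> f \<in> A V \<Longrightarrow> X W (cut W f) = cut W (X V f)"
  shows "X \<in> vector_fields A U"
  unfolding vector_fields_def using assms by simp

lemma vf_restrict_closed:
  assumes "X \<in> vector_fields A U" "W \<subseteq> U"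
  shows "vf_restrict W X \<in> vector_fields A W"
proof -
  have sub: "V \<subseteq> U" if "V \<subseteq> W" for V using that assms(2) by blast
  show ?thesis
    by (rule vector_fieldsI)
       (use assms(1) sub in \<open>auto simp: vf_restrict_def vector_field_closed vector_field_add vector_field_scale
          vector_field_mult vector_field_cut dest: vector_field_outside\<close>)
qed

lemma vf_add_closed:
  assumes "X \<in> vector_fields A U" "Y \<in> vector_fields A U"
  shows "vf_add X Y \<in> vector_fields A U"
  unfolding vf_add_def
  by (rule vector_fieldsI; (simp only: vector_field_outside[OF assms(1)] vector_field_outside[OF assms(2)]; fail)?)
     (use assms in \<open>simp_all add: vector_field_closed add_closed vector_field_add vector_field_scale
          vector_field_mult vector_field_cut[of _ U] vector_field_outside cut_add algebra_simps\<close>)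

lemma vf_smult_closed:
  assumes X: "X \<in> vector_fields A U" and U: "open U" and g: "g \<in> A U"
  shows "vf_smult g X \<in> vector_fields A U"
proof -
  have cg: "cut V g \<in> A V" if "open V" "V \<subseteq> U" for V using U that g by (rule cut_closed)
  show ?thesis
    unfolding vf_smult_def
    by (rule vector_fieldsI)
       (use X cg in \<open>simp_all add: vector_field_closed mult_closed vector_field_add vector_field_scale
          vector_field_mult vector_field_cut[of _ U] vector_field_outside cut_mult cut_cut algebra_simps\<close>)
qed

text \<open>The two mixed terms are together symmetric in X and Y, so they cancel in the bracket,
  which is therefore a derivation again.\<close>

lemma vector_field_comp_mult:
  assumes X: "X \<in> vector_fields A U" and Y: "Y \<in> vector_fields A U"
    and V: "open V" "V \<subseteq> U" and f: "f \<in> A V" and g: "g \<in> A V"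
  shows "X V (Y V (\<lambda>x. f x * g x)) =
    (\<lambda>x. (X V (Y V f) x * g x + Y V f x * X V g x) + (X V f x * Y V g x + f x * X V (Y V g) x))"
proof -
  have Yc: "Y V f \<in> A V" "Y V g \<in> A V"
    using Y V f g by (simp_all add: vector_field_closed)
  show ?thesis
    unfolding vector_field_mult[OF Y V f g]
    using vector_field_add[OF X V mult_closed[OF V(1) Yc(1) g] mult_closed[OF V(1) f Yc(2)]]
      vector_field_mult[OF X V Yc(1) g] vector_field_mult[OF X V f Yc(2)] by simp
qed

lemma lie_bracket_closed:
  assumes X: "X \<in> vector_fields A U" and Y: "Y \<in> vector_fields A U"
  shows "lie_bracket X Y \<in> vector_fields A U"
  unfolding lie_bracket_def
proof (rule vector_fieldsI)
  fix V f g assume V: "open V" "V \<subseteq> U" and fg: "f \<in> A V" "g \<in> A V"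
  then show "(\<lambda>x. X V (Y V (\<lambda>x. f x * g x)) x - Y V (X V (\<lambda>x. f x * g x)) x) =
      (\<lambda>x. (X V (Y V f) x - Y V (X V f) x) * g x + f x * (X V (Y V g) x - Y V (X V g) x))"
    unfolding vector_field_comp_mult[OF X Y V fg] vector_field_comp_mult[OF Y X V fg]
    by (simp add: algebra_simps)
qed (use X Y in \<open>simp_all add: vector_field_closed diff_closed vector_field_add vector_field_scale
       vector_field_cut[of _ U] vector_field_outside vector_field_zero cut_diff algebra_simps\<close>)

text \<open>Written as a multiple by the zero function, so that linearity of a form over A gives the
  value 0 on it.\<close>

lemma lie_bracket_self: "lie_bracket X X = vf_smult (\<lambda>x. 0) (X :: ('p, 'k) vector_field)"
  by (simp add: lie_bracket_def vf_smult_def)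

text \<open>The sign is expressed by the constant function -1 on U because forms are linear over A;
  this is how it is pulled out of a 1-form in \<open>ext_deriv_closed\<close>.\<close>

lemma lie_bracket_swap: "lie_bracket Y X = vf_smult (cut U (\<lambda>x. -1)) (lie_bracket X Y)"
  if XY: "X \<in> vector_fields A U" "Y \<in> vector_fields A U" and "open U"
proof (intro ext)
  fix V f x
  show "lie_bracket Y X V f x = vf_smult (cut U (\<lambda>x. -1)) (lie_bracket X Y) V f x"
  proof (cases "open V \<and> V \<subseteq> U \<and> f \<in> A V \<and> x \<in> V")
    case True
    then show ?thesis by (auto simp: vf_smult_def lie_bracket_def cut_def)
  next
    case False
    \<comment> \<open>Where the cut-off constant vanishes or the normalisation of vector fields
      applies, both sides are 0, as both brackets are vector fields on U.\<close>
    have zero: "Z V f x = 0" if "Z \<in> vector_fields A U" for Z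
    proof (cases "open V \<and> V \<subseteq> U \<and> f \<in> A V")
      case True
      with False vector_field_closed[OF that, of V f] zero_outside[of V "Z V f" x] show ?thesis by simp
    next
      case False
      from vector_field_outside[OF that this] show ?thesis by simp
    qed
    show ?thesis
      using zero[OF lie_bracket_closed[OF XY]] zero[OF lie_bracket_closed[OF XY(2,1)]] by (simp add: vf_smult_def)
  qed
qed

lemma lie_bracket_vf_add:
  assumes X: "X \<in> vector_fields A U" "X' \<in> vector_fields A U" and Y: "Y \<in> vector_fields A U"
  shows "lie_bracket (vf_add X X') Y = vf_add (lie_bracket X Y) (lie_bracket X' Y)"
proof (intro ext)
  fix V f x
  show "lie_bracket (vf_add X X') Y V f x = vf_add (lie_bracket X Y) (lie_bracket X' Y) V f x"
  proof (cases "open V \<and> V \<subseteq> U \<and> f \<in> A V")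
    case True
    then show ?thesis
      using X Y by (simp add: lie_bracket_def vf_add_def vector_field_add[OF Y] vector_field_closed)
  next
    case False
    then show ?thesis
      using X Y by (simp add: lie_bracket_def vf_add_def vector_field_outside vector_field_zero)
  qed
qed

text \<open>Y also differentiates the coefficient g, which produces the extra multiple of X. That
  term cancels the derivative of g in \<open>ext_deriv_closed\<close>.\<close>

lemma lie_bracket_vf_smult:
  assumes X: "X \<in> vector_fields A U" and Y: "Y \<in> vector_fields A U" and U: "open U" and g: "g \<in> A U"
  shows "lie_bracket (vf_smult g X) Y = vf_add (vf_smult g (lie_bracket X Y)) (vf_smult (\<lambda>x. - Y U g x) X)"
proof (intro ext)
  fix V f x
  show "lie_bracket (vf_smult g X) Y V f x =
      vf_add (vf_smult g (lie_bracket X Y)) (vf_smult (\<lambda>x. - Y U g x) X) V f x"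
  proof (cases "open V \<and> V \<subseteq> U \<and> f \<in> A V")
    case True
    then have V: "open V" "V \<subseteq> U" and f: "f \<in> A V" by auto
    have cg: "cut V g \<in> A V" using U V g by (rule cut_closed)
    \<comment> \<open>Y commutes with restriction, so the derivative of g over V is the restriction
      of the one over U.\<close>
    have "Y V (cut V g) = cut V (Y U g)" using vector_field_cut[OF Y U order_refl g V] .
    moreover have "cut V (\<lambda>x. - Y U g x) = (\<lambda>x. - cut V (Y U g) x)" by (auto simp: cut_def)
    ultimately show ?thesis
      using X Y V f cg
      by (simp add: lie_bracket_def vf_add_def vf_smult_def vector_field_mult[OF Y] vector_field_closed algebra_simps)
  next
    case False
    then show ?thesis
      using X Y by (simp add: lie_bracket_def vf_add_def vf_smult_def vector_field_outside vector_field_zero)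
  qed
qed

lemma lie_bracket_restrict:
  assumes X: "X \<in> vector_fields A U" and Y: "Y \<in> vector_fields A U"
  shows "lie_bracket (vf_restrict W X) (vf_restrict W Y) = vf_restrict W (lie_bracket X Y)"
  by (auto simp: lie_bracket_def vf_restrict_def fun_eq_iff)

section \<open>Differential forms as a presheaf of modules\<close>

lemma form_mem:
  assumes "\<omega> \<in> differential_forms A k U"
  shows "\<omega> V Xs \<in> (if open V \<and> V \<subseteq> U \<and> set Xs \<subseteq> vector_fields A V \<and> length Xs = k then A V else {\<lambda>x. 0})"
  using assms unfolding differential_forms_def mem_Collect_eq by (elim conjE, elim allE)

lemma form_closed:
  "\<omega> \<in> differential_forms A k U \<Longrightarrow> open V \<Longrightarrow> V \<subseteq> U \<Longrightarrow> set Xs \<subseteq> vector_fields A V \<Longrightarrow> length Xs = k \<Longrightarrow>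
    \<omega> V Xs \<in> A V"
  using form_mem[of \<omega> k U V Xs] by simp

lemma form_outside:
  "\<omega> \<in> differential_forms A k U \<Longrightarrow> \<not> (open V \<and> V \<subseteq> U \<and> set Xs \<subseteq> vector_fields A V \<and> length Xs = k) \<Longrightarrow>
    \<omega> V Xs = (\<lambda>x. 0)"
  using form_mem[of \<omega> k U V Xs] by (simp only: if_False singleton_iff)

text \<open>Used where a form is multiplied by a cut-off constant 1 or -1: constant and cut-off
  differ only at points where the form vanishes.\<close>

lemma form_zero_off:
  assumes "\<omega> \<in> differential_forms A k U" "x \<notin> U \<inter> V"
  shows "\<omega> V Xs x = 0"
  using form_closed[OF assms(1), of V Xs] form_outside[OF assms(1), of V Xs] zero_outside[of V "\<omega> V Xs" x] assms(2)
  by (cases "open V \<and> V \<subseteq> U \<and> set Xs \<subseteq> vector_fields A V \<and> length Xs = k") auto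

lemma form_rules:
  assumes "\<omega> \<in> differential_forms A k U" "open V" "V \<subseteq> U" "set Xs \<subseteq> vector_fields A V" "length Xs = k"
  shows form_add: "i < k \<Longrightarrow> X \<in> vector_fields A V \<Longrightarrow> Y \<in> vector_fields A V \<Longrightarrow>
      \<omega> V (Xs[i := vf_add X Y]) = (\<lambda>x. \<omega> V (Xs[i := X]) x + \<omega> V (Xs[i := Y]) x)"
    and form_smult: "i < k \<Longrightarrow> g \<in> A V \<Longrightarrow> X \<in> vector_fields A V \<Longrightarrow>
      \<omega> V (Xs[i := vf_smult g X]) = (\<lambda>x. g x * \<omega> V (Xs[i := X]) x)"
    and form_alternating: "i < k \<Longrightarrow> j < k \<Longrightarrow> i \<noteq> j \<Longrightarrow> Xs ! i = Xs ! j \<Longrightarrow> \<omega> V Xs = (\<lambda>x. 0)"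
    and form_restrict: "open W \<Longrightarrow> W \<subseteq> V \<Longrightarrow> \<omega> W (map (vf_restrict W) Xs) = cut W (\<omega> V Xs)"
proof -
  have "(\<forall>i<k. \<forall>X\<in>vector_fields A V. \<forall>Y\<in>vector_fields A V.
        \<omega> V (Xs[i := vf_add X Y]) = (\<lambda>x. \<omega> V (Xs[i := X]) x + \<omega> V (Xs[i := Y]) x)) \<and>
      (\<forall>i<k. \<forall>g\<in>A V. \<forall>X\<in>vector_fields A V. \<omega> V (Xs[i := vf_smult g X]) = (\<lambda>x. g x * \<omega> V (Xs[i := X]) x)) \<and>
      (\<forall>i<k. \<forall>j<k. i \<noteq> j \<longrightarrow> Xs ! i = Xs ! j \<longrightarrow> \<omega> V Xs = (\<lambda>x. 0)) \<and>
      (\<forall>W. open W \<longrightarrow> W \<subseteq> V \<longrightarrow> \<omega> W (map (vf_restrict W) Xs) = cut W (\<omega> V Xs))"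
    using assms unfolding differential_forms_def by simp
  note this[THEN conjunct1] this[THEN conjunct2, THEN conjunct1] this[THEN conjunct2, THEN conjunct2]
  then show "i < k \<Longrightarrow> X \<in> vector_fields A V \<Longrightarrow> Y \<in> vector_fields A V \<Longrightarrow>
      \<omega> V (Xs[i := vf_add X Y]) = (\<lambda>x. \<omega> V (Xs[i := X]) x + \<omega> V (Xs[i := Y]) x)"
    "i < k \<Longrightarrow> g \<in> A V \<Longrightarrow> X \<in> vector_fields A V \<Longrightarrow>
      \<omega> V (Xs[i := vf_smult g X]) = (\<lambda>x. g x * \<omega> V (Xs[i := X]) x)"
    "i < k \<Longrightarrow> j < k \<Longrightarrow> i \<noteq> j \<Longrightarrow> Xs ! i = Xs ! j \<Longrightarrow> \<omega> V Xs = (\<lambda>x. 0)"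
    "open W \<Longrightarrow> W \<subseteq> V \<Longrightarrow> \<omega> W (map (vf_restrict W) Xs) = cut W (\<omega> V Xs)"
    by simp_all
qed

lemma formI:
  assumes "\<And>V Xs. open V \<Longrightarrow> V \<subseteq> U \<Longrightarrow> set Xs \<subseteq> vector_fields A V \<Longrightarrow> length Xs = k \<Longrightarrow> \<omega> V Xs \<in> A V"
    and "\<And>V Xs. \<not> (open V \<and> V \<subseteq> U \<and> set Xs \<subseteq> vector_fields A V \<and> length Xs = k) \<Longrightarrow> \<omega> V Xs = (\<lambda>x. 0)"
    and "\<And>V Xs i X Y. open V \<Longrightarrow> V \<subseteq> U \<Longrightarrow> set Xs \<subseteq> vector_fields A V \<Longrightarrow> length Xs = k \<Longrightarrow> i < k \<Longrightarrow>
      X \<in> vector_fields A V \<Longrightarrow> Y \<in> vector_fields A V \<Longrightarrow>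
      \<omega> V (Xs[i := vf_add X Y]) = (\<lambda>x. \<omega> V (Xs[i := X]) x + \<omega> V (Xs[i := Y]) x)"
    and "\<And>V Xs i g X. open V \<Longrightarrow> V \<subseteq> U \<Longrightarrow> set Xs \<subseteq> vector_fields A V \<Longrightarrow> length Xs = k \<Longrightarrow> i < k \<Longrightarrow>
      g \<in> A V \<Longrightarrow> X \<in> vector_fields A V \<Longrightarrow> \<omega> V (Xs[i := vf_smult g X]) = (\<lambda>x. g x * \<omega> V (Xs[i := X]) x)"
    and "\<And>V Xs i j. open V \<Longrightarrow> V \<subseteq> U \<Longrightarrow> set Xs \<subseteq> vector_fields A V \<Longrightarrow> length Xs = k \<Longrightarrow> i < k \<Longrightarrow> j < k \<Longrightarrow>
      i \<noteq> j \<Longrightarrow> Xs ! i = Xs ! j \<Longrightarrow> \<omega> V Xs = (\<lambda>x. 0)"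
    and "\<And>V Xs W. open V \<Longrightarrow> V \<subseteq> U \<Longrightarrow> set Xs \<subseteq> vector_fields A V \<Longrightarrow> length Xs = k \<Longrightarrow> open W \<Longrightarrow> W \<subseteq> V \<Longrightarrow>
      \<omega> W (map (vf_restrict W) Xs) = cut W (\<omega> V Xs)"
  shows "\<omega> \<in> differential_forms A k U"
  unfolding differential_forms_def mem_Collect_eq
proof (intro conjI allI impI ballI)
  fix V Xs
  show "\<omega> V Xs \<in> (if open V \<and> V \<subseteq> U \<and> set Xs \<subseteq> vector_fields A V \<and> length Xs = k then A V else {\<lambda>x. 0})"
    using assms(1,2)[of V Xs] by simp
qed (use assms(3-6) in simp_all)

lemma form_sheaf_simps [simp]:
  "carrier (sect (form_sheaf A k) U) = differential_forms A k U"
  "\<zero>\<^bsub>sect (form_sheaf A k) U\<^esub> = (\<lambda>V Xs x. 0)"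
  "\<omega> \<oplus>\<^bsub>sect (form_sheaf A k) U\<^esub> \<eta> = (\<lambda>V Xs x. \<omega> V Xs x + \<eta> V Xs x)"
  "g \<odot>\<^bsub>sect (form_sheaf A k) U\<^esub> \<omega> = (\<lambda>V Xs x. cut V g x * \<omega> V Xs x)"
  by (simp_all add: form_sheaf_def)

lemma res_form_sheaf: "res (form_sheaf A k) U V \<omega> = (\<lambda>W Xs. if W \<subseteq> V then \<omega> W Xs else (\<lambda>x. 0))"
  by (simp add: form_sheaf_def)

lemma form_sheaf_add_closed:
  assumes "\<omega> \<in> differential_forms A k U" "\<eta> \<in> differential_forms A k U"
  shows "(\<lambda>V Xs x. \<omega> V Xs x + \<eta> V Xs x) \<in> differential_forms A k U"
  by (rule formI)
     (use assms in \<open>simp_all add: form_closed[of _ k U] add_closed form_outside[of _ k U] form_add[of _ k U]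
        form_smult[of _ k U] form_alternating[of _ k U] form_restrict[of _ k U] cut_add distrib_left add_ac\<close>)

lemma form_sheaf_smult_closed:
  assumes U: "open U" and g: "g \<in> A U" and \<omega>: "\<omega> \<in> differential_forms A k U"
  shows "(\<lambda>V Xs x. cut V g x * \<omega> V Xs x) \<in> differential_forms A k U"
proof -
  have "cut V g \<in> A V" if "open V" "V \<subseteq> U" for V using U that g by (rule cut_closed)
  then show ?thesis
    by (intro formI)
       (use \<omega> in \<open>simp_all add: form_closed[of _ k U] mult_closed form_outside[of _ k U] form_add[of _ k U]
          form_smult[of _ k U] form_alternating[of _ k U] form_restrict[of _ k U] cut_mult cut_cut algebra_simps\<close>)
qed

lemma form_sheaf_zero_closed: "(\<lambda>V Xs x. 0) \<in> differential_forms A k U"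
  by (rule formI) (simp_all add: zero_closed)

lemma presheaf_form_sheaf: "presheaf_of_modules A (form_sheaf A k)"
  unfolding presheaf_of_modules_def
proof (intro conjI allI impI ballI)
  fix U :: "'p set" assume U: "open U"
  show "module (function_ring A U) (sect (form_sheaf A k) U)"
  proof (rule moduleI)
    show "cring (function_ring A U)" using U by (rule cring_function_ring)
    show "abelian_group (sect (form_sheaf A k) U)"
    proof (rule abelian_groupI)
      fix \<omega> assume \<omega>: "\<omega> \<in> carrier (sect (form_sheaf A k) U)"
      have "(\<lambda>V Xs x. cut V (cut U (\<lambda>x. -1)) x * \<omega> V Xs x) \<in> differential_forms A k U"
        using U \<omega> const_closed[OF U] by (intro form_sheaf_smult_closed) auto
      moreover have "cut V (cut U (\<lambda>x. -1)) x * \<omega> V Xs x + \<omega> V Xs x = 0" for V Xs x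
        using \<omega> form_zero_off[of \<omega> k U x V Xs] by (auto simp: cut_def)
      ultimately show "\<exists>\<eta>\<in>carrier (sect (form_sheaf A k) U). \<eta> \<oplus>\<^bsub>sect (form_sheaf A k) U\<^esub> \<omega> = \<zero>\<^bsub>sect (form_sheaf A k) U\<^esub>"
        by (intro bexI[of _ "\<lambda>V Xs x. cut V (cut U (\<lambda>x. -1)) x * \<omega> V Xs x"]) simp_all
    qed (simp_all add: form_sheaf_add_closed form_sheaf_zero_closed add_ac)
    fix \<omega> assume \<omega>: "\<omega> \<in> carrier (sect (form_sheaf A k) U)"
    show "\<one>\<^bsub>function_ring A U\<^esub> \<odot>\<^bsub>sect (form_sheaf A k) U\<^esub> \<omega> = \<omega>"
    proof (intro ext)
      fix V Xs x
      show "(\<one>\<^bsub>function_ring A U\<^esub> \<odot>\<^bsub>sect (form_sheaf A k) U\<^esub> \<omega>) V Xs x = \<omega> V Xs x"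
        using \<omega> form_zero_off[of \<omega> k U x V Xs] by (auto simp: cut_def)
    qed
  qed (use U in \<open>simp_all add: form_sheaf_smult_closed cut_add cut_mult distrib_left distrib_right mult.assoc\<close>)
  {
    fix \<omega> assume "\<omega> \<in> carrier (sect (form_sheaf A k) U)"
    \<comment> \<open>Forms on U are normalised to 0 at sets not contained in U, so cutting down to
      subsets of U changes nothing.\<close>
    then show "res (form_sheaf A k) U U \<omega> = \<omega>"
      using form_outside[of \<omega> k U] by (auto simp: res_form_sheaf fun_eq_iff)
  }
  fix V assume V: "open V" "V \<subseteq> U"
  show "res (form_sheaf A k) U V \<in> carrier (sect (form_sheaf A k) U) \<rightarrow> carrier (sect (form_sheaf A k) V)"
  proof
    fix \<omega> assume \<omega>: "\<omega> \<in> carrier (sect (form_sheaf A k) U)"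
    have sub: "W \<subseteq> U" if "W \<subseteq> V" for W using that V by blast
    have "(\<lambda>W Xs. if W \<subseteq> V then \<omega> W Xs else (\<lambda>x. 0)) \<in> differential_forms A k V"
    proof (rule formI)
      fix W Xs
      show "(if W \<subseteq> V then \<omega> W Xs else (\<lambda>x. 0)) = (\<lambda>x. 0)"
        if "\<not> (open W \<and> W \<subseteq> V \<and> set Xs \<subseteq> vector_fields A W \<and> length Xs = k)"
        using \<omega> that form_outside[of \<omega> k U W Xs] by auto
    next
      fix W Xs W'
      assume "open W" "W \<subseteq> V" "set Xs \<subseteq> vector_fields A W" "length Xs = k" "open W'" "W' \<subseteq> W"
      moreover from this have "W' \<subseteq> V" by blast
      ultimately show "(if W' \<subseteq> V then \<omega> W' (map (vf_restrict W') Xs) else (\<lambda>x. 0)) =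
          cut W' (if W \<subseteq> V then \<omega> W Xs else (\<lambda>x. 0))"
        using \<omega> sub by (simp add: form_restrict[of _ k U])
    qed (use \<omega> sub in \<open>simp_all add: form_closed[of _ k U] form_add[of _ k U] form_smult[of _ k U] form_alternating[of _ k U]\<close>)
    then show "res (form_sheaf A k) U V \<omega> \<in> carrier (sect (form_sheaf A k) V)" by (simp add: res_form_sheaf)
  qed
  fix \<omega> assume "\<omega> \<in> carrier (sect (form_sheaf A k) U)"
  show "res (form_sheaf A k) U V (\<omega> \<oplus>\<^bsub>sect (form_sheaf A k) U\<^esub> \<eta>) =
      res (form_sheaf A k) U V \<omega> \<oplus>\<^bsub>sect (form_sheaf A k) V\<^esub> res (form_sheaf A k) U V \<eta>" for \<eta>
    by (simp add: res_form_sheaf fun_eq_iff)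
  show "res (form_sheaf A k) U V (g \<odot>\<^bsub>sect (form_sheaf A k) U\<^esub> \<omega>) =
      cut V g \<odot>\<^bsub>sect (form_sheaf A k) V\<^esub> res (form_sheaf A k) U V \<omega>" for g
    by (simp add: res_form_sheaf fun_eq_iff cut_cut)
next
  fix U V W :: "'p set" and \<omega> assume "W \<subseteq> V"
  then show "res (form_sheaf A k) V W (res (form_sheaf A k) U V \<omega>) = res (form_sheaf A k) U W \<omega>"
    by (auto simp: res_form_sheaf fun_eq_iff)
qed

end

section \<open>Exterior derivative and wedge product in low degree\<close>

lemma length_drop_nth: "i < length Xs \<Longrightarrow> length (drop_nth i Xs) = length Xs - 1"
  by (simp add: drop_nth_def)

section \<open>Forms of degree 1 and 2 and the exterior derivative\<close>

context function_presheaf begin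

lemma one_form_closed: "\<omega> \<in> differential_forms A 1 U \<Longrightarrow> open V \<Longrightarrow> V \<subseteq> U \<Longrightarrow> X \<in> vector_fields A V \<Longrightarrow>
    \<omega> V [X] \<in> A V"
  by (rule form_closed) simp_all

lemma one_form_rules:
  assumes "\<omega> \<in> differential_forms A 1 U" "open V" "V \<subseteq> U" "X \<in> vector_fields A V"
  shows one_form_add: "Y \<in> vector_fields A V \<Longrightarrow> \<omega> V [vf_add X Y] = (\<lambda>x. \<omega> V [X] x + \<omega> V [Y] x)"
    and one_form_smult: "g \<in> A V \<Longrightarrow> \<omega> V [vf_smult g X] = (\<lambda>x. g x * \<omega> V [X] x)"
    and one_form_restrict: "open W \<Longrightarrow> W \<subseteq> V \<Longrightarrow> \<omega> W [vf_restrict W X] = cut W (\<omega> V [X])"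
  using form_add[OF assms(1-3), of "[X]" 0 X Y] form_smult[OF assms(1-3), of "[X]" 0 g X]
    form_restrict[OF assms(1-3), of "[X]" W] assms(4) by simp_all

text \<open>The alternation condition concerns two different positions and is empty for a single
  argument.\<close>

lemma one_formI:
  assumes closed: "\<And>V X. open V \<Longrightarrow> V \<subseteq> U \<Longrightarrow> X \<in> vector_fields A V \<Longrightarrow> \<omega> V [X] \<in> A V"
    and outside: "\<And>V Xs. \<not> (open V \<and> V \<subseteq> U \<and> set Xs \<subseteq> vector_fields A V \<and> length Xs = 1) \<Longrightarrow> \<omega> V Xs = (\<lambda>x. 0)"
    and add: "\<And>V X Y. open V \<Longrightarrow> V \<subseteq> U \<Longrightarrow> X \<in> vector_fields A V \<Longrightarrow> Y \<in> vector_fields A V \<Longrightarrow>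
      \<omega> V [vf_add X Y] = (\<lambda>x. \<omega> V [X] x + \<omega> V [Y] x)"
    and smult: "\<And>V g X. open V \<Longrightarrow> V \<subseteq> U \<Longrightarrow> g \<in> A V \<Longrightarrow> X \<in> vector_fields A V \<Longrightarrow>
      \<omega> V [vf_smult g X] = (\<lambda>x. g x * \<omega> V [X] x)"
    and restrict: "\<And>V X W. open V \<Longrightarrow> V \<subseteq> U \<Longrightarrow> X \<in> vector_fields A V \<Longrightarrow> open W \<Longrightarrow> W \<subseteq> V \<Longrightarrow>
      \<omega> W [vf_restrict W X] = cut W (\<omega> V [X])"
  shows "\<omega> \<in> differential_forms A 1 U"
proof (rule formI)
  have one: "\<exists>X. Xs = [X]" if "length Xs = 1" for Xs :: "('p, 'k) vector_field list"
    using that by (cases Xs) auto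
  fix V and Xs :: "('p, 'k) vector_field list"
  assume *: "open V" "V \<subseteq> U" "set Xs \<subseteq> vector_fields A V" "length Xs = 1"
  obtain X where X: "Xs = [X]" using one[OF *(4)] by blast
  then have X': "X \<in> vector_fields A V" using * by simp
  show "\<omega> V Xs \<in> A V" unfolding X by (rule closed[OF *(1,2) X'])
  show "\<omega> W (map (vf_restrict W) Xs) = cut W (\<omega> V Xs)" if "open W" "W \<subseteq> V" for W
    using restrict[OF *(1,2) X' that] by (simp add: X)
  fix i assume "i < (1::nat)"
  then have i: "i = 0" by simp
  show "\<omega> V (Xs[i := vf_add Y Z]) = (\<lambda>x. \<omega> V (Xs[i := Y]) x + \<omega> V (Xs[i := Z]) x)"
    if "Y \<in> vector_fields A V" "Z \<in> vector_fields A V" for Y Z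
    using add[OF *(1,2) that] by (simp add: X i)
  show "\<omega> V (Xs[i := vf_smult g Y]) = (\<lambda>x. g x * \<omega> V (Xs[i := Y]) x)"
    if "g \<in> A V" "Y \<in> vector_fields A V" for g Y
    using smult[OF *(1,2) that] by (simp add: X i)
  show "\<omega> V Xs = (\<lambda>x. 0)" if "j < 1" "i \<noteq> j" for j
    using that i by simp
qed (rule outside)

lemma two_form_eqI:
  assumes \<omega>: "\<omega> \<in> differential_forms A 2 U" and \<eta>: "\<eta> \<in> differential_forms A 2 U"
    and eq: "\<And>V X Y. open V \<Longrightarrow> V \<subseteq> U \<Longrightarrow> X \<in> vector_fields A V \<Longrightarrow> Y \<in> vector_fields A V \<Longrightarrow>
      \<omega> V [X, Y] = \<eta> V [X, Y]"
  shows "\<omega> = \<eta>"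
proof (intro ext)
  fix V Xs x
  show "\<omega> V Xs x = \<eta> V Xs x"
  proof (cases "open V \<and> V \<subseteq> U \<and> set Xs \<subseteq> vector_fields A V \<and> length Xs = 2")
    case True
    then obtain X Y where "Xs = [X, Y]" by (cases Xs rule: list_cases2) auto
    with True eq[of V X Y] show ?thesis by simp
  next
    case False
    then show ?thesis using form_outside[OF \<omega> False] form_outside[OF \<eta> False] by simp
  qed
qed

text \<open>Antisymmetry reduces the conditions on the second argument to those on the first.\<close>

lemma two_formI:
  assumes closed: "\<And>V X Y. open V \<Longrightarrow> V \<subseteq> U \<Longrightarrow> X \<in> vector_fields A V \<Longrightarrow> Y \<in> vector_fields A V \<Longrightarrow> \<omega> V [X, Y] \<in> A V"
    and outside: "\<And>V Xs. \<not> (open V \<and> V \<subseteq> U \<and> set Xs \<subseteq> vector_fields A V \<and> length Xs = 2) \<Longrightarrow> \<omega> V Xs = (\<lambda>x. 0)"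
    and add: "\<And>V X Y Z. open V \<Longrightarrow> V \<subseteq> U \<Longrightarrow> X \<in> vector_fields A V \<Longrightarrow> Y \<in> vector_fields A V \<Longrightarrow> Z \<in> vector_fields A V \<Longrightarrow>
      \<omega> V [vf_add X Y, Z] = (\<lambda>x. \<omega> V [X, Z] x + \<omega> V [Y, Z] x)"
    and smult: "\<And>V g X Z. open V \<Longrightarrow> V \<subseteq> U \<Longrightarrow> g \<in> A V \<Longrightarrow> X \<in> vector_fields A V \<Longrightarrow> Z \<in> vector_fields A V \<Longrightarrow>
      \<omega> V [vf_smult g X, Z] = (\<lambda>x. g x * \<omega> V [X, Z] x)"
    and swap: "\<And>V X Y. open V \<Longrightarrow> V \<subseteq> U \<Longrightarrow> X \<in> vector_fields A V \<Longrightarrow> Y \<in> vector_fields A V \<Longrightarrow>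
      \<omega> V [Y, X] = (\<lambda>x. - \<omega> V [X, Y] x)"
    and self: "\<And>V X. open V \<Longrightarrow> V \<subseteq> U \<Longrightarrow> X \<in> vector_fields A V \<Longrightarrow> \<omega> V [X, X] = (\<lambda>x. 0)"
    and restrict: "\<And>V X Y W. open V \<Longrightarrow> V \<subseteq> U \<Longrightarrow> X \<in> vector_fields A V \<Longrightarrow> Y \<in> vector_fields A V \<Longrightarrow> open W \<Longrightarrow> W \<subseteq> V \<Longrightarrow>
      \<omega> W [vf_restrict W X, vf_restrict W Y] = cut W (\<omega> V [X, Y])"
  shows "\<omega> \<in> differential_forms A 2 U"
proof (rule formI)
  have two: "\<exists>X Y. Xs = [X, Y]" if "length Xs = 2" for Xs :: "('p, 'k) vector_field list"
    using that by (cases Xs rule: list_cases2) auto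
  fix V and Xs :: "('p, 'k) vector_field list"
  assume *: "open V" "V \<subseteq> U" "set Xs \<subseteq> vector_fields A V" "length Xs = 2"
  obtain X Y where X: "Xs = [X, Y]" using two[OF *(4)] by blast
  then have X': "X \<in> vector_fields A V" "Y \<in> vector_fields A V" using * by simp_all
  show "\<omega> V Xs \<in> A V" unfolding X by (rule closed[OF *(1,2) X'])
  show "\<omega> W (map (vf_restrict W) Xs) = cut W (\<omega> V Xs)" if "open W" "W \<subseteq> V" for W
    using restrict[OF *(1,2) X' that] by (simp add: X)
  fix i assume "i < (2::nat)"
  then consider (0) "i = 0" | (1) "i = 1" by linarith
  note i = this
  show "\<omega> V (Xs[i := vf_add Z Z']) = (\<lambda>x. \<omega> V (Xs[i := Z]) x + \<omega> V (Xs[i := Z']) x)"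
    if Z: "Z \<in> vector_fields A V" "Z' \<in> vector_fields A V" for Z Z'
    using i
  proof cases
    case 0
    then show ?thesis using add[OF *(1,2) Z X'(2)] by (simp add: X)
  next
    case 1
    then show ?thesis
      using add[OF *(1,2) Z X'(1)] swap[OF *(1,2) vf_add_closed[OF Z] X'(1)]
        swap[OF *(1,2) Z(1) X'(1)] swap[OF *(1,2) Z(2) X'(1)] by (simp add: X)
  qed
  show "\<omega> V (Xs[i := vf_smult g Z]) = (\<lambda>x. g x * \<omega> V (Xs[i := Z]) x)"
    if g: "g \<in> A V" and Z: "Z \<in> vector_fields A V" for g Z
    using i
  proof cases
    case 0
    then show ?thesis using smult[OF *(1,2) g Z X'(2)] by (simp add: X)
  next
    case 1
    then show ?thesis
      using smult[OF *(1,2) g Z X'(1)] swap[OF *(1,2) vf_smult_closed[OF Z *(1) g] X'(1)]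
        swap[OF *(1,2) Z X'(1)] by (simp add: X)
  qed
  \<comment> \<open>Antisymmetry alone gives that twice the value at a repeated argument is 0. The
    characteristic of the field is arbitrary here, hence the separate premise
    \<open>self\<close>.\<close>
  show "\<omega> V Xs = (\<lambda>x. 0)" if "j < 2" "i \<noteq> j" "Xs ! i = Xs ! j" for j
  proof -
    have "X = Y" using i that by cases (cases j; simp add: X)+
    then show ?thesis using self[OF *(1,2) X'(1)] by (simp add: X)
  qed
qed (rule outside)

text \<open>The guard in the Koszul formula covers openness of V and the entries of the list. The
  rest of the normalisation comes from \<omega>, which is 0 at lists of the wrong length and at sets
  not inside U, and from vector fields sending 0 to 0.\<close>

lemma ext_deriv_outside:
  assumes \<omega>: "\<omega> \<in> differential_forms A k U"
    and out: "\<not> (open V \<and> V \<subseteq> U \<and> set Xs \<subseteq> vector_fields A V \<and> length Xs = Suc k)"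
  shows "ext_deriv A \<omega> V Xs = (\<lambda>x. 0)"
proof (cases "open V \<and> set Xs \<subseteq> vector_fields A V")
  case True
  \<comment> \<open>Natural subtraction makes the empty list look like a list of length one. It is
    excluded here, and for it both sums in the formula are empty.\<close>
  have z: "\<omega> V Ys = (\<lambda>x. 0)" if "length Ys = length Xs - 1" "Xs \<noteq> []" for Ys
  proof (rule form_outside[OF \<omega>])
    have "length Ys = k \<Longrightarrow> length Xs = Suc k" using that by (cases Xs) auto
    then show "\<not> (open V \<and> V \<subseteq> U \<and> set Ys \<subseteq> vector_fields A V \<and> length Ys = k)"
      using True out by blast
  qed
  have "(Xs ! i) V (\<omega> V (drop_nth i Xs)) = (\<lambda>x. 0)" if "i < length Xs" for i
  proof -
    have "Xs ! i \<in> vector_fields A V" using that True by auto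
    moreover have "\<omega> V (drop_nth i Xs) = (\<lambda>x. 0)" using that by (intro z) (auto simp: length_drop_nth)
    ultimately show ?thesis by (simp add: vector_field_zero)
  qed
  moreover have "\<omega> V (lie_bracket (Xs ! i) (Xs ! j) # drop_nth i (drop_nth j Xs)) = (\<lambda>x. 0)"
    if "j < length Xs" "i < j" for i j
    using that by (intro z) (auto simp: length_drop_nth)
  ultimately show ?thesis by (simp add: ext_deriv_def fun_eq_iff)
next
  case False
  then show ?thesis unfolding ext_deriv_def by (simp only: if_False)
qed

lemma ext_deriv_one:
  "open V \<Longrightarrow> X \<in> vector_fields A V \<Longrightarrow> ext_deriv A \<omega> V [X] = X V (\<omega> V [])"
  by (simp add: ext_deriv_def drop_nth_def)

lemma ext_deriv_two:
  "open V \<Longrightarrow> X \<in> vector_fields A V \<Longrightarrow> Y \<in> vector_fields A V \<Longrightarrow>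
    ext_deriv A \<omega> V [X, Y] = (\<lambda>x. X V (\<omega> V [Y]) x - Y V (\<omega> V [X]) x - \<omega> V [lie_bracket X Y] x)"
  by (simp add: ext_deriv_def drop_nth_def fun_eq_iff lessThan_Suc)

lemma function_form_closed:
  assumes "open U" "f \<in> A U"
  shows "function_form U f \<in> differential_forms A 0 U"
proof (rule formI)
  fix V and Xs :: "('p, 'k) vector_field list" assume "open V" "V \<subseteq> U" "length Xs = 0"
  then show "function_form U f V Xs \<in> A V"
    using cut_closed[OF assms(1) _ _ assms(2), of V] by (simp add: function_form_def)
qed (auto simp: function_form_def cut_cut)

lemma ext_deriv_function_form_eval:
  assumes "open V" "V \<subseteq> U" "X \<in> vector_fields A V"
  shows "ext_deriv A (function_form U f) V [X] = X V (cut V f)"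
  using assms by (simp add: ext_deriv_one function_form_def)

text \<open>The value of df at X is X applied to f, so linearity of df in X is the pointwise
  definition of the operations on vector fields, and naturality is the locality of X.\<close>

lemma ext_deriv_function_form_closed:
  assumes U: "open U" and f: "f \<in> A U"
  shows "ext_deriv A (function_form U f) \<in> differential_forms A 1 U"
proof (rule one_formI)
  show "ext_deriv A (function_form U f) V Xs = (\<lambda>x. 0)"
    if "\<not> (open V \<and> V \<subseteq> U \<and> set Xs \<subseteq> vector_fields A V \<and> length Xs = 1)" for V Xs
    using ext_deriv_outside[OF function_form_closed[OF assms]] that by simp
  fix V X assume V: "open V" "V \<subseteq> U" and X: "X \<in> vector_fields A V"
  have cf: "cut V f \<in> A V" using U V f by (rule cut_closed)
  show "ext_deriv A (function_form U f) V [X] \<in> A V"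
    using V X cf by (simp add: ext_deriv_function_form_eval vector_field_closed)
  show "ext_deriv A (function_form U f) V [vf_add X Y] =
      (\<lambda>x. ext_deriv A (function_form U f) V [X] x + ext_deriv A (function_form U f) V [Y] x)"
    if "Y \<in> vector_fields A V" for Y
    using V X that by (simp add: ext_deriv_function_form_eval vf_add_closed, simp add: vf_add_def)
  show "ext_deriv A (function_form U f) V [vf_smult g X] = (\<lambda>x. g x * ext_deriv A (function_form U f) V [X] x)"
    if "g \<in> A V" for g
    using V X that by (simp add: ext_deriv_function_form_eval vf_smult_closed, simp add: vf_smult_def cut_self)
  show "ext_deriv A (function_form U f) W [vf_restrict W X] = cut W (ext_deriv A (function_form U f) V [X])"
    if W: "open W" "W \<subseteq> V" for W
  proof -
    have "W \<subseteq> U" using W V by blast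
    have "ext_deriv A (function_form U f) W [vf_restrict W X] = X W (cut W (cut V f))"
      using W X \<open>W \<subseteq> U\<close>
      by (simp add: ext_deriv_function_form_eval vf_restrict_closed, simp add: vf_restrict_def cut_cut)
    also have "\<dots> = cut W (X V (cut V f))" by (rule vector_field_cut[OF X V(1) order_refl cf W])
    finally show ?thesis using V X by (simp add: ext_deriv_function_form_eval)
  qed
qed

text \<open>The point is linearity over A in the arguments: each term of the formula alone may
  differentiate a coefficient, and the bracket term compensates.\<close>

lemma ext_deriv_closed:
  assumes \<omega>: "\<omega> \<in> differential_forms A 1 U"
  shows "ext_deriv A \<omega> \<in> differential_forms A 2 U"
proof (rule two_formI)
  show "ext_deriv A \<omega> V Xs = (\<lambda>x. 0)"
    if "\<not> (open V \<and> V \<subseteq> U \<and> set Xs \<subseteq> vector_fields A V \<and> length Xs = 2)" for V Xs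
    using ext_deriv_outside[OF \<omega>, of V Xs] that by (simp add: numeral_2_eq_2)
  fix V X assume V: "open V" "V \<subseteq> U" and X: "X \<in> vector_fields A V"
  note \<omega>X = one_form_closed[OF \<omega> V X]
  {
    have "\<omega> V [lie_bracket X X] = (\<lambda>x. 0)"
      using one_form_smult[OF \<omega> V X zero_closed[OF V(1)]] by (simp add: lie_bracket_self)
    then show "ext_deriv A \<omega> V [X, X] = (\<lambda>x. 0)" using V X by (simp add: ext_deriv_two)
  }
  fix Y assume Y: "Y \<in> vector_fields A V"
  note \<omega>Y = one_form_closed[OF \<omega> V Y]
  note XY = lie_bracket_closed[OF X Y] and \<omega>XY = one_form_closed[OF \<omega> V lie_bracket_closed[OF X Y]]
  show "ext_deriv A \<omega> V [X, Y] \<in> A V"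
    using V X Y \<omega>X \<omega>Y \<omega>XY by (simp add: ext_deriv_two diff_closed vector_field_closed)
  show "ext_deriv A \<omega> V [Y, X] = (\<lambda>x. - ext_deriv A \<omega> V [X, Y] x)"
  proof -
    have m1: "cut V (\<lambda>x. - 1) \<in> A V" using V(1) by (rule const_closed)
    have "\<omega> V [lie_bracket Y X] = (\<lambda>x. cut V (\<lambda>x. - 1) x * \<omega> V [lie_bracket X Y] x)"
      unfolding lie_bracket_swap[OF X Y V(1)] by (rule one_form_smult[OF \<omega> V XY m1])
    also have "\<dots> = (\<lambda>x. - \<omega> V [lie_bracket X Y] x)"
      using zero_outside[OF V(1) \<omega>XY] by (auto simp: cut_def fun_eq_iff)
    finally show ?thesis using V X Y by (simp add: ext_deriv_two algebra_simps)
  qed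
  show "ext_deriv A \<omega> V [vf_smult g X, Y] = (\<lambda>x. g x * ext_deriv A \<omega> V [X, Y] x)" if g: "g \<in> A V" for g
  proof -
    have Yg: "(\<lambda>x. - Y V g x) \<in> A V" using V g Y by (simp add: uminus_closed vector_field_closed)
    \<comment> \<open>The derivative of g along Y, times the value of \<omega> at X, enters once
      through the bracket and once, with the opposite sign, through the derivative along Y of the
      value at \<open>vf_smult g X\<close>.\<close>
    have "\<omega> V [lie_bracket (vf_smult g X) Y] = (\<lambda>x. g x * \<omega> V [lie_bracket X Y] x + - Y V g x * \<omega> V [X] x)"
      unfolding lie_bracket_vf_smult[OF X Y V(1) g]
      using one_form_add[OF \<omega> V vf_smult_closed[OF XY V(1) g] vf_smult_closed[OF X V(1) Yg]]
        one_form_smult[OF \<omega> V XY g] one_form_smult[OF \<omega> V X Yg] by simp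
    moreover have "Y V (\<omega> V [vf_smult g X]) = (\<lambda>x. Y V g x * \<omega> V [X] x + g x * Y V (\<omega> V [X]) x)"
      unfolding one_form_smult[OF \<omega> V X g] by (rule vector_field_mult[OF Y V(1) order_refl g \<omega>X])
    moreover have "vf_smult g X V (\<omega> V [Y]) = (\<lambda>x. g x * X V (\<omega> V [Y]) x)"
      using V g by (simp add: vf_smult_def cut_self)
    ultimately show ?thesis
      using V X Y g by (simp add: ext_deriv_two vf_smult_closed algebra_simps)
  qed
  show "ext_deriv A \<omega> W [vf_restrict W X, vf_restrict W Y] = cut W (ext_deriv A \<omega> V [X, Y])"
    if W: "open W" "W \<subseteq> V" for W
  proof -
    have "vf_restrict W X W (\<omega> W [vf_restrict W Y]) = cut W (X V (\<omega> V [Y]))"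
      unfolding one_form_restrict[OF \<omega> V Y W] using vector_field_cut[OF X V(1) order_refl \<omega>Y W]
      by (simp add: vf_restrict_def)
    moreover have "vf_restrict W Y W (\<omega> W [vf_restrict W X]) = cut W (Y V (\<omega> V [X]))"
      unfolding one_form_restrict[OF \<omega> V X W] using vector_field_cut[OF Y V(1) order_refl \<omega>X W]
      by (simp add: vf_restrict_def)
    moreover have "\<omega> W [lie_bracket (vf_restrict W X) (vf_restrict W Y)] = cut W (\<omega> V [lie_bracket X Y])"
      unfolding lie_bracket_restrict[OF X Y] by (rule one_form_restrict[OF \<omega> V XY W])
    ultimately show ?thesis
      using V W X Y by (simp add: ext_deriv_two vf_restrict_closed cut_diff)
  qed
  fix Z assume Z: "Z \<in> vector_fields A V"
  note \<omega>Z = one_form_closed[OF \<omega> V Z]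
  show "ext_deriv A \<omega> V [vf_add X Y, Z] = (\<lambda>x. ext_deriv A \<omega> V [X, Z] x + ext_deriv A \<omega> V [Y, Z] x)"
  proof -
    have "\<omega> V [lie_bracket (vf_add X Y) Z] = (\<lambda>x. \<omega> V [lie_bracket X Z] x + \<omega> V [lie_bracket Y Z] x)"
      unfolding lie_bracket_vf_add[OF X Y Z]
      by (rule one_form_add[OF \<omega> V lie_bracket_closed[OF X Z] lie_bracket_closed[OF Y Z]])
    moreover have "Z V (\<omega> V [vf_add X Y]) = (\<lambda>x. Z V (\<omega> V [X]) x + Z V (\<omega> V [Y]) x)"
      unfolding one_form_add[OF \<omega> V X Y] by (rule vector_field_add[OF Z V(1) order_refl \<omega>X \<omega>Y])
    moreover have "vf_add X Y V (\<omega> V [Z]) = (\<lambda>x. X V (\<omega> V [Z]) x + Y V (\<omega> V [Z]) x)"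
      by (simp add: vf_add_def)
    ultimately show ?thesis
      using V X Y Z by (simp add: ext_deriv_two vf_add_closed algebra_simps)
  qed
qed

lemma ext_deriv_add:
  assumes \<omega>: "\<omega> \<in> differential_forms A 1 U" and \<eta>: "\<eta> \<in> differential_forms A 1 U"
  shows "ext_deriv A (\<lambda>V Xs x. \<omega> V Xs x + \<eta> V Xs x) = (\<lambda>V Xs x. ext_deriv A \<omega> V Xs x + ext_deriv A \<eta> V Xs x)"
proof (rule two_form_eqI[OF ext_deriv_closed[OF form_sheaf_add_closed[OF \<omega> \<eta>]]
      form_sheaf_add_closed[OF ext_deriv_closed[OF \<omega>] ext_deriv_closed[OF \<eta>]]])
  fix V X Y assume V: "open V" "V \<subseteq> U" and XY: "X \<in> vector_fields A V" "Y \<in> vector_fields A V"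
  have "Z V (\<lambda>x. \<omega> V [Z'] x + \<eta> V [Z'] x) = (\<lambda>x. Z V (\<omega> V [Z']) x + Z V (\<eta> V [Z']) x)"
    if "Z \<in> vector_fields A V" "Z' \<in> vector_fields A V" for Z Z'
    using vector_field_add[OF that(1) V(1) order_refl one_form_closed[OF \<omega> V that(2)] one_form_closed[OF \<eta> V that(2)]] .
  then show "ext_deriv A (\<lambda>V Xs x. \<omega> V Xs x + \<eta> V Xs x) V [X, Y] =
      (\<lambda>x. ext_deriv A \<omega> V [X, Y] x + ext_deriv A \<eta> V [X, Y] x)"
    using V XY by (simp add: ext_deriv_two algebra_simps)
qed

lemma ext_deriv_res:
  assumes U: "open U" "open V" "V \<subseteq> U" and \<omega>: "\<omega> \<in> differential_forms A 1 U"
  shows "ext_deriv A (res (form_sheaf A 1) U V \<omega>) = res (form_sheaf A 2) U V (ext_deriv A \<omega>)"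
proof -
  interpret F1: module_presheaf_on A "form_sheaf A 1" by unfold_locales (rule presheaf_form_sheaf)
  interpret F2: module_presheaf_on A "form_sheaf A 2" by unfold_locales (rule presheaf_form_sheaf)
  have 1: "res (form_sheaf A 1) U V \<omega> \<in> differential_forms A 1 V"
    using F1.res_closed[OF U] \<omega> by simp
  have 2: "res (form_sheaf A 2) U V (ext_deriv A \<omega>) \<in> differential_forms A 2 V"
    using F2.res_closed[OF U] ext_deriv_closed[OF \<omega>] by simp
  show ?thesis
    by (rule two_form_eqI[OF ext_deriv_closed[OF 1] 2]) (simp add: ext_deriv_two res_form_sheaf)
qed

end

text \<open>Characteristic 0 enters because \<open>wedge\<close> divides by factorials.\<close>

locale function_presheaf_char_0 = function_presheaf A
  for A :: "'p::topological_space set \<Rightarrow> ('p \<Rightarrow> 'k::field_char_0) set"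
begin

lemma wedge_eval: "wedge 1 1 \<alpha> \<beta> V [X, Y] = (\<lambda>x. \<alpha> V [X] x * \<beta> V [Y] x - \<alpha> V [Y] x * \<beta> V [X] x)"
  by (simp add: wedge_1_1[unfolded One_nat_def] fun_eq_iff)

lemma wedge_closed:
  assumes \<alpha>: "\<alpha> \<in> differential_forms A 1 U" and \<beta>: "\<beta> \<in> differential_forms A 1 U"
  shows "wedge 1 1 \<alpha> \<beta> \<in> differential_forms A 2 U"
proof (rule two_formI)
  fix V Xs assume out: "\<not> (open V \<and> V \<subseteq> U \<and> set Xs \<subseteq> vector_fields A V \<and> length Xs = 2)"
  show "wedge 1 1 \<alpha> \<beta> V Xs = (\<lambda>x. 0)"
  proof (cases "length Xs = 2")
    case True
    then obtain X Y where Xs: "Xs = [X, Y]" by (cases Xs rule: list_cases2) auto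
    have "\<not> (open V \<and> V \<subseteq> U \<and> set [X] \<subseteq> vector_fields A V \<and> length [X] = 1) \<or>
        \<not> (open V \<and> V \<subseteq> U \<and> set [Y] \<subseteq> vector_fields A V \<and> length [Y] = 1)" using out by (auto simp: Xs)
    then have "\<alpha> V [X] = (\<lambda>x. 0) \<and> \<beta> V [X] = (\<lambda>x. 0) \<or> \<alpha> V [Y] = (\<lambda>x. 0) \<and> \<beta> V [Y] = (\<lambda>x. 0)"
      using form_outside[OF \<alpha>] form_outside[OF \<beta>] by metis
    then show ?thesis unfolding Xs wedge_eval by auto
  next
    case False
    show ?thesis unfolding wedge_1_1 fun_eq_iff using False by (auto split: list.splits)
  qed
next
  fix V X Y assume V: "open V" "V \<subseteq> U" and XY: "X \<in> vector_fields A V" "Y \<in> vector_fields A V"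
  note c = one_form_closed[OF \<alpha> V] one_form_closed[OF \<beta> V]
  show "wedge 1 1 \<alpha> \<beta> V [X, Y] \<in> A V"
    unfolding wedge_eval using V XY c by (simp add: diff_closed mult_closed)
  show "wedge 1 1 \<alpha> \<beta> V [Y, X] = (\<lambda>x. - wedge 1 1 \<alpha> \<beta> V [X, Y] x)"
    unfolding wedge_eval by simp
  show "wedge 1 1 \<alpha> \<beta> W [vf_restrict W X, vf_restrict W Y] = cut W (wedge 1 1 \<alpha> \<beta> V [X, Y])"
    if "open W" "W \<subseteq> V" for W
    unfolding wedge_eval cut_diff cut_mult one_form_restrict[OF \<alpha> V XY(1) that] one_form_restrict[OF \<alpha> V XY(2) that]
      one_form_restrict[OF \<beta> V XY(1) that] one_form_restrict[OF \<beta> V XY(2) that] ..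
  show "wedge 1 1 \<alpha> \<beta> V [vf_smult g X, Y] = (\<lambda>x. g x * wedge 1 1 \<alpha> \<beta> V [X, Y] x)" if "g \<in> A V" for g
    unfolding wedge_eval one_form_smult[OF \<alpha> V XY(1) that] one_form_smult[OF \<beta> V XY(1) that]
    by (simp add: algebra_simps)
  show "wedge 1 1 \<alpha> \<beta> V [vf_add X Y, Z] = (\<lambda>x. wedge 1 1 \<alpha> \<beta> V [X, Z] x + wedge 1 1 \<alpha> \<beta> V [Y, Z] x)"
    if "Z \<in> vector_fields A V" for Z
    unfolding wedge_eval one_form_add[OF \<alpha> V XY] one_form_add[OF \<beta> V XY]
    by (simp add: algebra_simps)
next
  fix V X
  show "wedge 1 1 \<alpha> \<beta> V [X, X] = (\<lambda>x. 0)" unfolding wedge_eval by simp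
qed

lemma wedge_bilinear:
  shows wedge_add_left: "wedge 1 1 (\<lambda>V Xs x. \<alpha> V Xs x + \<alpha>' V Xs x) \<beta> =
      (\<lambda>V Xs x. wedge 1 1 \<alpha> \<beta> V Xs x + wedge 1 1 \<alpha>' \<beta> V Xs x)"
    and wedge_add_right: "wedge 1 1 \<alpha> (\<lambda>V Xs x. \<beta> V Xs x + \<beta>' V Xs x) =
      (\<lambda>V Xs x. wedge 1 1 \<alpha> \<beta> V Xs x + wedge 1 1 \<alpha> \<beta>' V Xs x)"
    and wedge_smult_left: "wedge 1 1 (\<lambda>V Xs x. cut V g x * \<alpha> V Xs x) \<beta> =
      (\<lambda>V Xs x. cut V g x * wedge 1 1 \<alpha> \<beta> V Xs x)"
    and wedge_smult_right: "wedge 1 1 \<alpha> (\<lambda>V Xs x. cut V g x * \<beta> V Xs x) =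
      (\<lambda>V Xs x. cut V g x * wedge 1 1 \<alpha> \<beta> V Xs x)"
  unfolding fun_eq_iff wedge_1_1 by (simp_all add: algebra_simps split: list.splits)

lemma wedge_res: "wedge 1 1 (res (form_sheaf A 1) U V \<alpha>) (res (form_sheaf A 1) U V \<beta>) =
    res (form_sheaf A 2) U V (wedge 1 1 \<alpha> \<beta>)"
  unfolding fun_eq_iff res_form_sheaf wedge_1_1 by (simp split: list.splits add: wedge_1_1[unfolded One_nat_def])

text \<open>The Leibniz rule, with the wedge product moved to the left so that no subtraction occurs.\<close>

lemma ext_deriv_smult:
  assumes U: "open U" and g: "g \<in> A U" and \<beta>: "\<beta> \<in> differential_forms A 1 U"
  shows "(\<lambda>V Xs x. ext_deriv A (\<lambda>V Xs x. cut V g x * \<beta> V Xs x) V Xs x +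
      wedge 1 1 \<beta> (ext_deriv A (function_form U g)) V Xs x) = (\<lambda>V Xs x. cut V g x * ext_deriv A \<beta> V Xs x)"
proof (rule two_form_eqI)
  note g\<beta> = form_sheaf_smult_closed[OF assms] and dg = ext_deriv_function_form_closed[OF U g]
  show "(\<lambda>V Xs x. ext_deriv A (\<lambda>V Xs x. cut V g x * \<beta> V Xs x) V Xs x +
      wedge 1 1 \<beta> (ext_deriv A (function_form U g)) V Xs x) \<in> differential_forms A 2 U"
    by (intro form_sheaf_add_closed ext_deriv_closed wedge_closed g\<beta> dg \<beta>)
  show "(\<lambda>V Xs x. cut V g x * ext_deriv A \<beta> V Xs x) \<in> differential_forms A 2 U"
    by (intro form_sheaf_smult_closed U g ext_deriv_closed \<beta>)
  fix V X Y assume V: "open V" "V \<subseteq> U" and XY: "X \<in> vector_fields A V" "Y \<in> vector_fields A V"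
  have cg: "cut V g \<in> A V" using U V g by (rule cut_closed)
  \<comment> \<open>The terms with derivatives of g left over by the product rule, (X g) times
    \<beta> at Y minus (Y g) times \<beta> at X, are the negative of the wedge product of \<beta>
    and dg at X, Y.\<close>
  have m: "Z V (\<lambda>x. cut V g x * \<beta> V [Z'] x) = (\<lambda>x. Z V (cut V g) x * \<beta> V [Z'] x + cut V g x * Z V (\<beta> V [Z']) x)"
    if "Z \<in> vector_fields A V" "Z' \<in> vector_fields A V" for Z Z'
    using vector_field_mult[OF that(1) V(1) order_refl cg one_form_closed[OF \<beta> V that(2)]] .
  show "(\<lambda>x. ext_deriv A (\<lambda>V Xs x. cut V g x * \<beta> V Xs x) V [X, Y] x +
      wedge 1 1 \<beta> (ext_deriv A (function_form U g)) V [X, Y] x) = (\<lambda>x. cut V g x * ext_deriv A \<beta> V [X, Y] x)"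
    unfolding wedge_eval ext_deriv_two[OF V(1) XY] ext_deriv_function_form_eval[OF V XY(1)]
      ext_deriv_function_form_eval[OF V XY(2)] m[OF XY] m[OF XY(2,1)]
    by (simp add: algebra_simps)
qed

end

section \<open>The wedge product of forms with values in a module\<close>

lemma additive_on_comp:
  assumes \<phi>: "additive_on X F G \<phi>" and \<psi>: "additive_on X G H \<psi>"
  shows "additive_on X F H (\<lambda>U s. \<psi> U (\<phi> U s))"
  unfolding additive_on_def
proof (intro allI impI ballI conjI)
  fix U s assume U: "open U" "U \<subseteq> X" and s: "s \<in> carrier (sect F U)"
  note D = additive_onD[OF \<phi> U s] and D' = additive_onD[OF \<psi> U]
  show "\<psi> U (\<phi> U s) \<in> carrier (sect H U)" by (rule D'(1)[OF D(1)])
  show "\<psi> U (\<phi> U (s \<oplus>\<^bsub>sect F U\<^esub> t)) = \<psi> U (\<phi> U s) \<oplus>\<^bsub>sect H U\<^esub> \<psi> U (\<phi> U t)" if "t \<in> carrier (sect F U)" for t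
    unfolding D(2)[OF that] by (rule D'(2)[OF D(1) additive_onD(1)[OF \<phi> U that]])
  show "\<psi> V (\<phi> V (res F U V s)) = res H U V (\<psi> U (\<phi> U s))" if "open V" "V \<subseteq> U" for V
    unfolding D(3)[OF that] by (rule D'(3)[OF D(1) that])
qed

text \<open>The definitions write the sign as a power of -1 acting by \<open>add_pow\<close>, the
  calculations use the group inverse; the two prescriptions are known to agree on sections, which is
  all that is compared here.\<close>

lemma biadditive_on_cong:
  assumes b: "biadditive_on A X F G H b"
    and F: "presheaf_of_modules A F" and G: "presheaf_of_modules A G"
    and eq: "\<And>U s t. open U \<Longrightarrow> U \<subseteq> X \<Longrightarrow> s \<in> carrier (sect F U) \<Longrightarrow> t \<in> carrier (sect G U) \<Longrightarrow> b' U s t = b U s t"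
    and A: "function_presheaf A"
  shows "biadditive_on A X F G H b'"
  unfolding biadditive_on_def
proof (intro allI impI ballI conjI)
  interpret module_presheaf_pair A F G
    using A F G by (intro module_presheaf_pair.intro module_presheaf_on.intro module_presheaf_on_axioms.intro)
  fix U s t assume U: "open U" "U \<subseteq> X" and s: "s \<in> carrier (sect F U)" and t: "t \<in> carrier (sect G U)"
  note D = biadditive_onD[OF b U s t]
  show "b' U s t \<in> carrier (sect H U)" using D(1) eq[OF U s t] by simp
  show "b' U (s \<oplus>\<^bsub>sect F U\<^esub> s') t = b' U s t \<oplus>\<^bsub>sect H U\<^esub> b' U s' t" if "s' \<in> carrier (sect F U)" for s'
    using D(2)[OF that] U s t that by (simp add: eq F.sect_add_closed)
  show "b' U s (t \<oplus>\<^bsub>sect G U\<^esub> t') = b' U s t \<oplus>\<^bsub>sect H U\<^esub> b' U s t'" if "t' \<in> carrier (sect G U)" for t'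
    using D(3)[OF that] U s t that by (simp add: eq G.sect_add_closed)
  show "b' U (g \<odot>\<^bsub>sect F U\<^esub> s) t = b' U s (g \<odot>\<^bsub>sect G U\<^esub> t)" if "g \<in> A U" for g
    using D(4)[OF that] U s t that by (simp add: eq F.sect_smult_closed G.sect_smult_closed)
  show "b' V (res F U V s) (res G U V t) = res H U V (b' U s t)" if V: "open V" "V \<subseteq> U" for V
  proof -
    have "V \<subseteq> X" using U V by blast
    then show ?thesis using D(5)[OF V] U s t V by (simp add: eq F.res_closed G.res_closed)
  qed
qed

lemma add_pow_minus_one:
  assumes "abelian_group M" "x \<in> carrier M"
  shows "add_pow M (-1::int) x = \<ominus>\<^bsub>M\<^esub> x"
proof -
  interpret abelian_group M by fact
  show ?thesis using assms(2) by (simp add: add_pow_int_lt)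
qed

lemma (in module_presheaf_on) res_uminus:
  assumes "open U" "open V" "V \<subseteq> U" "s \<in> carrier (sect P U)"
  shows "res P U V (\<ominus>\<^bsub>sect P U\<^esub> s) = \<ominus>\<^bsub>sect P V\<^esub> res P U V s"
proof -
  interpret U: abelian_group "sect P U" using assms(1) by (rule sect_abelian_group)
  interpret V: abelian_group "sect P V" using assms(2) by (rule sect_abelian_group)
  have "res P U V (\<ominus>\<^bsub>sect P U\<^esub> s) \<oplus>\<^bsub>sect P V\<^esub> res P U V s = \<zero>\<^bsub>sect P V\<^esub>"
    using assms by (simp add: res_add[symmetric] U.l_neg res_zero)
  then show ?thesis using assms by (intro V.minus_equality[symmetric]) (simp_all add: res_closed)
qed

text \<open>Fixing the left factor makes the tensor additive in the right one, so that
  \<open>tensor_eqI\<close> can be applied in the second argument. The factor s is restricted along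
  with the open set.\<close>

lemma (in module_presheaf_pair) additive_on_pure_tensor:
  assumes X: "open X" and s: "s \<in> carrier (sect F X)"
  shows "additive_on X G S (\<lambda>U t. pure_tensor A F G U (res F X U s) t)"
  unfolding additive_on_def
proof (intro allI impI ballI conjI)
  fix U t assume U: "open U" "U \<subseteq> X" and t: "t \<in> carrier (sect G U)"
  have sU: "res F X U s \<in> carrier (sect F U)" using X U s by (rule F.res_closed)
  show "pure_tensor A F G U (res F X U s) t \<in> carrier (sect S U)"
    using U(1) sU t by (rule pure_tensor_closed)
  show "pure_tensor A F G U (res F X U s) (t \<oplus>\<^bsub>sect G U\<^esub> t') =
      pure_tensor A F G U (res F X U s) t \<oplus>\<^bsub>sect S U\<^esub> pure_tensor A F G U (res F X U s) t'"
    if "t' \<in> carrier (sect G U)" for t'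
    using U(1) sU t that by (rule pure_tensor_add_right)
  show "pure_tensor A F G V (res F X V s) (res G U V t) = res S U V (pure_tensor A F G U (res F X U s) t)"
    if V: "open V" "V \<subseteq> U" for V
    using pure_tensor_res[OF U(1) V sU t] F.res_res[OF X U(1) V(1,2) U(2) s] by simp
qed

locale valued_forms = function_presheaf_char_0 A + F: module_presheaf_on A F
  for A :: "'p::topological_space set \<Rightarrow> ('p \<Rightarrow> 'k::field_char_0) set"
    and F :: "('p, 'p \<Rightarrow> 'k, 's) module_presheaf"
begin

abbreviation "\<Omega>\<^sub>1 \<equiv> form_sheaf A 1"
abbreviation "\<Omega>\<^sub>2 \<equiv> form_sheaf A 2"
abbreviation "S\<^sub>1 \<equiv> tensor_sheaf A \<Omega>\<^sub>1 F"
abbreviation "S\<^sub>2 \<equiv> tensor_sheaf A \<Omega>\<^sub>2 F"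
abbreviation "S\<^sub>1\<^sub>1 \<equiv> tensor_sheaf A \<Omega>\<^sub>1 S\<^sub>1"
abbreviation "p\<^sub>1 \<equiv> pure_tensor A \<Omega>\<^sub>1 F"
abbreviation "p\<^sub>2 \<equiv> pure_tensor A \<Omega>\<^sub>2 F"
abbreviation "p\<^sub>1\<^sub>1 \<equiv> pure_tensor A \<Omega>\<^sub>1 S\<^sub>1"

sublocale \<Omega>1: module_presheaf_on A "\<Omega>\<^sub>1" by unfold_locales (rule presheaf_form_sheaf)
sublocale \<Omega>2: module_presheaf_on A "\<Omega>\<^sub>2" by unfold_locales (rule presheaf_form_sheaf)
sublocale W1: module_presheaf_pair A "\<Omega>\<^sub>1" F ..
sublocale W2: module_presheaf_pair A "\<Omega>\<^sub>2" F ..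
sublocale W11: module_presheaf_pair A "\<Omega>\<^sub>1" "S\<^sub>1" ..
text \<open>This instance and the next two serve as pairs of source and target of morphisms, not as
  factors of a tensor product.\<close>

sublocale W112: module_presheaf_pair A "S\<^sub>1\<^sub>1" "S\<^sub>2" ..
sublocale W12: module_presheaf_pair A "S\<^sub>1" "S\<^sub>2" ..
sublocale W01: module_presheaf_pair A F "S\<^sub>1" ..

lemma res_one_form: "open U \<Longrightarrow> open V \<Longrightarrow> V \<subseteq> U \<Longrightarrow> \<omega> \<in> differential_forms A 1 U \<Longrightarrow>
    res \<Omega>\<^sub>1 U V \<omega> \<in> differential_forms A 1 V"
  using \<Omega>1.res_closed[of U V \<omega>] unfolding form_sheaf_simps .

lemma p2_rules:
  assumes "open U" "\<omega> \<in> differential_forms A 2 U" "\<sigma> \<in> carrier (sect F U)"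
  shows p2_closed: "p\<^sub>2 U \<omega> \<sigma> \<in> carrier (sect S\<^sub>2 U)"
    and p2_add_left: "\<eta> \<in> differential_forms A 2 U \<Longrightarrow>
      p\<^sub>2 U (\<lambda>V Xs x. \<omega> V Xs x + \<eta> V Xs x) \<sigma> = p\<^sub>2 U \<omega> \<sigma> \<oplus>\<^bsub>sect S\<^sub>2 U\<^esub> p\<^sub>2 U \<eta> \<sigma>"
    and p2_smult: "g \<in> A U \<Longrightarrow> p\<^sub>2 U (\<lambda>V Xs x. cut V g x * \<omega> V Xs x) \<sigma> = g \<odot>\<^bsub>sect S\<^sub>2 U\<^esub> p\<^sub>2 U \<omega> \<sigma>"
    and p2_balanced: "g \<in> A U \<Longrightarrow> p\<^sub>2 U (\<lambda>V Xs x. cut V g x * \<omega> V Xs x) \<sigma> = p\<^sub>2 U \<omega> (g \<odot>\<^bsub>sect F U\<^esub> \<sigma>)"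
  using W2.pure_tensor_closed[of U \<omega> \<sigma>] W2.pure_tensor_add_left[of U \<omega> \<eta> \<sigma>]
    W2.pure_tensor_smult[of U g \<omega> \<sigma>] W2.pure_tensor_balanced[of U g \<omega> \<sigma>] assms
  unfolding form_sheaf_simps by simp_all

text \<open>Scalars pass from \<beta> to \<sigma> because they come out of the wedge product and
  then cross the tensor sign. Since \<alpha> is restricted to each V, the prescription lives over
  the open subsets of U.\<close>

lemma biadditive_on_wedge:
  assumes U: "open U" and \<alpha>: "\<alpha> \<in> differential_forms A 1 U"
  shows "biadditive_on A U \<Omega>\<^sub>1 F S\<^sub>2 (\<lambda>V \<beta> \<sigma>. p\<^sub>2 V (wedge 1 1 (res \<Omega>\<^sub>1 U V \<alpha>) \<beta>) \<sigma>)"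
  unfolding biadditive_on_def
proof (intro allI impI ballI conjI)
  fix V \<beta> \<sigma> assume V: "open V" "V \<subseteq> U" and \<beta>': "\<beta> \<in> carrier (sect \<Omega>\<^sub>1 V)" and \<sigma>: "\<sigma> \<in> carrier (sect F V)"
  have \<beta>: "\<beta> \<in> differential_forms A 1 V" using \<beta>' unfolding form_sheaf_simps .
  let ?\<alpha> = "res \<Omega>\<^sub>1 U V \<alpha>"
  have \<alpha>V: "?\<alpha> \<in> differential_forms A 1 V" using U V \<alpha> by (rule res_one_form)
  note w = wedge_closed[OF \<alpha>V \<beta>]
  show "p\<^sub>2 V (wedge 1 1 ?\<alpha> \<beta>) \<sigma> \<in> carrier (sect S\<^sub>2 V)" using V(1) w \<sigma> by (rule p2_closed)
  show "p\<^sub>2 V (wedge 1 1 ?\<alpha> (\<beta> \<oplus>\<^bsub>sect \<Omega>\<^sub>1 V\<^esub> \<beta>2)) \<sigma> =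
      p\<^sub>2 V (wedge 1 1 ?\<alpha> \<beta>) \<sigma> \<oplus>\<^bsub>sect S\<^sub>2 V\<^esub> p\<^sub>2 V (wedge 1 1 ?\<alpha> \<beta>2) \<sigma>" if "\<beta>2 \<in> carrier (sect \<Omega>\<^sub>1 V)" for \<beta>2
  proof -
    have "\<beta>2 \<in> differential_forms A 1 V" using that unfolding form_sheaf_simps .
    from p2_add_left[OF V(1) w \<sigma> wedge_closed[OF \<alpha>V this]] show ?thesis
      unfolding form_sheaf_simps wedge_add_right .
  qed
  show "p\<^sub>2 V (wedge 1 1 ?\<alpha> \<beta>) (\<sigma> \<oplus>\<^bsub>sect F V\<^esub> \<sigma>') =
      p\<^sub>2 V (wedge 1 1 ?\<alpha> \<beta>) \<sigma> \<oplus>\<^bsub>sect S\<^sub>2 V\<^esub> p\<^sub>2 V (wedge 1 1 ?\<alpha> \<beta>) \<sigma>'" if "\<sigma>' \<in> carrier (sect F V)" for \<sigma>'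
    using V(1) _ \<sigma> that by (rule W2.pure_tensor_add_right) (simp only: form_sheaf_simps w)
  show "p\<^sub>2 V (wedge 1 1 ?\<alpha> (g \<odot>\<^bsub>sect \<Omega>\<^sub>1 V\<^esub> \<beta>)) \<sigma> = p\<^sub>2 V (wedge 1 1 ?\<alpha> \<beta>) (g \<odot>\<^bsub>sect F V\<^esub> \<sigma>)" if "g \<in> A V" for g
    unfolding form_sheaf_simps wedge_smult_right by (rule p2_balanced[OF V(1) w \<sigma> that])
  show "p\<^sub>2 W (wedge 1 1 (res \<Omega>\<^sub>1 U W \<alpha>) (res \<Omega>\<^sub>1 V W \<beta>)) (res F V W \<sigma>) =
      res S\<^sub>2 V W (p\<^sub>2 V (wedge 1 1 ?\<alpha> \<beta>) \<sigma>)" if W: "open W" "W \<subseteq> V" for W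
  proof -
    have "wedge 1 1 ?\<alpha> \<beta> \<in> carrier (sect \<Omega>\<^sub>2 V)" unfolding form_sheaf_simps by (rule w)
    from W2.pure_tensor_res[OF V(1) W this \<sigma>] have
      "res S\<^sub>2 V W (p\<^sub>2 V (wedge 1 1 ?\<alpha> \<beta>) \<sigma>) =
        p\<^sub>2 W (wedge 1 1 (res \<Omega>\<^sub>1 V W ?\<alpha>) (res \<Omega>\<^sub>1 V W \<beta>)) (res F V W \<sigma>)" unfolding wedge_res .
    also have "res \<Omega>\<^sub>1 V W ?\<alpha> = res \<Omega>\<^sub>1 U W \<alpha>"
      by (rule \<Omega>1.res_res[OF U V(1) W V(2)]) (simp only: form_sheaf_simps \<alpha>)
    finally show ?thesis ..
  qed
qed

text \<open>SOME rather than THE, because \<open>additive_on\<close> leaves the values at arguments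
  that are not sections undetermined.\<close>

definition left_wedge where
  "left_wedge U \<alpha> = (SOME \<psi>. additive_on U S\<^sub>1 S\<^sub>2 \<psi> \<and>
     (\<forall>V \<beta> \<sigma>. open V \<longrightarrow> V \<subseteq> U \<longrightarrow> \<beta> \<in> carrier (sect \<Omega>\<^sub>1 V) \<longrightarrow> \<sigma> \<in> carrier (sect F V) \<longrightarrow>
        \<psi> V (p\<^sub>1 V \<beta> \<sigma>) = p\<^sub>2 V (wedge 1 1 (res \<Omega>\<^sub>1 U V \<alpha>) \<beta>) \<sigma>))"

lemma left_wedge:
  assumes U: "open U" and \<alpha>: "\<alpha> \<in> differential_forms A 1 U"
  shows "additive_on U S\<^sub>1 S\<^sub>2 (left_wedge U \<alpha>)"
    and "\<And>V \<beta> \<sigma>. open V \<Longrightarrow> V \<subseteq> U \<Longrightarrow> \<beta> \<in> differential_forms A 1 V \<Longrightarrow> \<sigma> \<in> carrier (sect F V) \<Longrightarrow>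
        left_wedge U \<alpha> V (p\<^sub>1 V \<beta> \<sigma>) = p\<^sub>2 V (wedge 1 1 (res \<Omega>\<^sub>1 U V \<alpha>) \<beta>) \<sigma>"
proof -
  let ?Q = "\<lambda>\<psi>. additive_on U S\<^sub>1 S\<^sub>2 \<psi> \<and>
     (\<forall>V \<beta> \<sigma>. open V \<longrightarrow> V \<subseteq> U \<longrightarrow> \<beta> \<in> carrier (sect \<Omega>\<^sub>1 V) \<longrightarrow> \<sigma> \<in> carrier (sect F V) \<longrightarrow>
        \<psi> V (p\<^sub>1 V \<beta> \<sigma>) = p\<^sub>2 V (wedge 1 1 (res \<Omega>\<^sub>1 U V \<alpha>) \<beta>) \<sigma>)"
  have "\<exists>\<psi>. ?Q \<psi>"
    using W1.tensor_lift_exists[OF W2.sheaf_S biadditive_on_wedge[OF U \<alpha>]] by metis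
  from someI_ex[OF this] have Q: "?Q (left_wedge U \<alpha>)" unfolding left_wedge_def .
  from Q show "additive_on U S\<^sub>1 S\<^sub>2 (left_wedge U \<alpha>)" ..
  from Q show "\<And>V \<beta> \<sigma>. open V \<Longrightarrow> V \<subseteq> U \<Longrightarrow> \<beta> \<in> differential_forms A 1 V \<Longrightarrow> \<sigma> \<in> carrier (sect F V) \<Longrightarrow>
        left_wedge U \<alpha> V (p\<^sub>1 V \<beta> \<sigma>) = p\<^sub>2 V (wedge 1 1 (res \<Omega>\<^sub>1 U V \<alpha>) \<beta>) \<sigma>"
    unfolding form_sheaf_simps by blast
qed

text \<open>On sections the choice is immaterial: an additive map with the right values on pure
  tensors agrees with \<open>left_wedge\<close>. All properties in the variable \<alpha> are proved
  by exhibiting such a map \<psi>.\<close>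

lemma left_wedge_eqI:
  assumes U: "open U" and \<alpha>: "\<alpha> \<in> differential_forms A 1 U" and V: "open V" "V \<subseteq> U"
    and \<psi>: "additive_on V S\<^sub>1 S\<^sub>2 \<psi>"
    and eq: "\<And>W \<beta> \<sigma>. open W \<Longrightarrow> W \<subseteq> V \<Longrightarrow> \<beta> \<in> differential_forms A 1 W \<Longrightarrow> \<sigma> \<in> carrier (sect F W) \<Longrightarrow>
        \<psi> W (p\<^sub>1 W \<beta> \<sigma>) = p\<^sub>2 W (wedge 1 1 (res \<Omega>\<^sub>1 U W \<alpha>) \<beta>) \<sigma>"
    and \<tau>: "\<tau> \<in> carrier (sect S\<^sub>1 V)"
  shows "left_wedge U \<alpha> V \<tau> = \<psi> V \<tau>"
proof (rule W1.tensor_eqI[OF W2.sheaf_S additive_on_subset[OF left_wedge(1)[OF U \<alpha>] V(2)] \<psi> _ V(1) order_refl \<tau>])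
  fix W \<beta> \<sigma> assume W: "open W" "W \<subseteq> V" and \<beta>: "\<beta> \<in> carrier (sect \<Omega>\<^sub>1 W)" and \<sigma>: "\<sigma> \<in> carrier (sect F W)"
  have \<beta>': "\<beta> \<in> differential_forms A 1 W" using \<beta> unfolding form_sheaf_simps .
  have "W \<subseteq> U" using W V by blast
  show "left_wedge U \<alpha> W (p\<^sub>1 W \<beta> \<sigma>) = \<psi> W (p\<^sub>1 W \<beta> \<sigma>)"
    unfolding left_wedge(2)[OF U \<alpha> W(1) \<open>W \<subseteq> U\<close> \<beta>' \<sigma>] eq[OF W \<beta>' \<sigma>] ..
qed

text \<open>Rescaling \<alpha>, the result or the argument gives three additive maps with the same
  values on pure tensors. The first equation makes the wedge morphism linear, the second is the
  balance condition for lifting in \<alpha>.\<close>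

lemma left_wedge_smult:
  assumes U: "open U" and \<alpha>: "\<alpha> \<in> differential_forms A 1 U" and g: "g \<in> A U"
    and \<tau>: "\<tau> \<in> carrier (sect S\<^sub>1 U)"
  shows "left_wedge U (\<lambda>V Xs x. cut V g x * \<alpha> V Xs x) U \<tau> = g \<odot>\<^bsub>sect S\<^sub>2 U\<^esub> left_wedge U \<alpha> U \<tau>"
    and "left_wedge U (\<lambda>V Xs x. cut V g x * \<alpha> V Xs x) U \<tau> = left_wedge U \<alpha> U (g \<odot>\<^bsub>sect S\<^sub>1 U\<^esub> \<tau>)"
proof -
  note lw = left_wedge[OF U \<alpha>]
  have g\<alpha>: "(\<lambda>V Xs x. cut V g x * \<alpha> V Xs x) \<in> differential_forms A 1 U"
    using U g \<alpha> by (rule form_sheaf_smult_closed)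
  have r: "res \<Omega>\<^sub>1 U W (\<lambda>V Xs x. cut V g x * \<alpha> V Xs x) = (\<lambda>V Xs x. cut V (cut W g) x * res \<Omega>\<^sub>1 U W \<alpha> V Xs x)"
    if "open W" "W \<subseteq> U" for W
    by (simp add: res_form_sheaf fun_eq_iff cut_cut)
  have cg: "cut W g \<in> A W" if "open W" "W \<subseteq> U" for W using U that g by (rule cut_closed)
  have cU: "cut U g = g" using U g by (rule cut_self)
  have "left_wedge U (\<lambda>V Xs x. cut V g x * \<alpha> V Xs x) U \<tau> = cut U g \<odot>\<^bsub>sect S\<^sub>2 U\<^esub> left_wedge U \<alpha> U \<tau>"
  proof (rule left_wedge_eqI[OF U g\<alpha> U order_refl W12.additive_on_smult[OF lw(1) U g] _ \<tau>])
    fix W \<beta> \<sigma> assume W: "open W" "W \<subseteq> U" and \<beta>: "\<beta> \<in> differential_forms A 1 W" and \<sigma>: "\<sigma> \<in> carrier (sect F W)"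
    show "cut W g \<odot>\<^bsub>sect S\<^sub>2 W\<^esub> left_wedge U \<alpha> W (p\<^sub>1 W \<beta> \<sigma>) =
        p\<^sub>2 W (wedge 1 1 (res \<Omega>\<^sub>1 U W (\<lambda>V Xs x. cut V g x * \<alpha> V Xs x)) \<beta>) \<sigma>"
      unfolding r[OF W] wedge_smult_left lw(2)[OF W \<beta> \<sigma>]
      by (rule p2_smult[OF W(1) wedge_closed[OF res_one_form[OF U W \<alpha>] \<beta>] \<sigma> cg[OF W], symmetric])
  qed
  then show "left_wedge U (\<lambda>V Xs x. cut V g x * \<alpha> V Xs x) U \<tau> = g \<odot>\<^bsub>sect S\<^sub>2 U\<^esub> left_wedge U \<alpha> U \<tau>"
    unfolding cU .
  have "left_wedge U (\<lambda>V Xs x. cut V g x * \<alpha> V Xs x) U \<tau> = left_wedge U \<alpha> U (cut U g \<odot>\<^bsub>sect S\<^sub>1 U\<^esub> \<tau>)"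
  proof (rule left_wedge_eqI[OF U g\<alpha> U order_refl W12.additive_on_smult_arg[OF lw(1) U g] _ \<tau>])
    fix W \<beta> \<sigma> assume W: "open W" "W \<subseteq> U" and \<beta>: "\<beta> \<in> differential_forms A 1 W" and \<sigma>: "\<sigma> \<in> carrier (sect F W)"
    have \<beta>': "\<beta> \<in> carrier (sect \<Omega>\<^sub>1 W)" unfolding form_sheaf_simps by (rule \<beta>)
    have "cut W g \<odot>\<^bsub>sect S\<^sub>1 W\<^esub> p\<^sub>1 W \<beta> \<sigma> = p\<^sub>1 W (\<lambda>V Xs x. cut V (cut W g) x * \<beta> V Xs x) \<sigma>"
      using W1.pure_tensor_smult[OF W(1) cg[OF W] \<beta>' \<sigma>] unfolding form_sheaf_simps ..
    then show "left_wedge U \<alpha> W (cut W g \<odot>\<^bsub>sect S\<^sub>1 W\<^esub> p\<^sub>1 W \<beta> \<sigma>) =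
        p\<^sub>2 W (wedge 1 1 (res \<Omega>\<^sub>1 U W (\<lambda>V Xs x. cut V g x * \<alpha> V Xs x)) \<beta>) \<sigma>"
      unfolding r[OF W] wedge_smult_left
      by (simp only: lw(2)[OF W form_sheaf_smult_closed[OF W(1) cg[OF W] \<beta>] \<sigma>] wedge_smult_right)
  qed
  then show "left_wedge U (\<lambda>V Xs x. cut V g x * \<alpha> V Xs x) U \<tau> = left_wedge U \<alpha> U (g \<odot>\<^bsub>sect S\<^sub>1 U\<^esub> \<tau>)"
    unfolding cU .
qed

text \<open>Additivity in \<tau> is built into \<open>left_wedge\<close>; what concerns \<alpha>, or
  \<alpha> and \<tau> together, follows from its uniqueness.\<close>

lemma biadditive_on_left_wedge:
  "biadditive_on A UNIV \<Omega>\<^sub>1 S\<^sub>1 S\<^sub>2 (\<lambda>U \<alpha> \<tau>. left_wedge U \<alpha> U \<tau>)"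
  unfolding biadditive_on_def
proof (intro allI impI ballI conjI)
  fix U :: "'p set" and \<alpha> \<tau> assume U: "open U" and \<alpha>': "\<alpha> \<in> carrier (sect \<Omega>\<^sub>1 U)" and \<tau>: "\<tau> \<in> carrier (sect S\<^sub>1 U)"
  have \<alpha>: "\<alpha> \<in> differential_forms A 1 U" using \<alpha>' unfolding form_sheaf_simps .
  note lw = left_wedge[OF U \<alpha>] and D = additive_onD[OF left_wedge(1)[OF U \<alpha>] U order_refl \<tau>]
  show "left_wedge U \<alpha> U \<tau> \<in> carrier (sect S\<^sub>2 U)" by (rule D(1))
  show "left_wedge U \<alpha> U (\<tau> \<oplus>\<^bsub>sect S\<^sub>1 U\<^esub> \<tau>') = left_wedge U \<alpha> U \<tau> \<oplus>\<^bsub>sect S\<^sub>2 U\<^esub> left_wedge U \<alpha> U \<tau>'"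
    if "\<tau>' \<in> carrier (sect S\<^sub>1 U)" for \<tau>' using that by (rule D(2))
  show "left_wedge U (\<alpha> \<oplus>\<^bsub>sect \<Omega>\<^sub>1 U\<^esub> \<alpha>') U \<tau> = left_wedge U \<alpha> U \<tau> \<oplus>\<^bsub>sect S\<^sub>2 U\<^esub> left_wedge U \<alpha>' U \<tau>"
    if "\<alpha>' \<in> carrier (sect \<Omega>\<^sub>1 U)" for \<alpha>'
  proof -
    have \<alpha>2: "\<alpha>' \<in> differential_forms A 1 U" using that unfolding form_sheaf_simps .
    note lw2 = left_wedge[OF U \<alpha>2]
    show ?thesis
      unfolding form_sheaf_simps
    proof (rule left_wedge_eqI[OF U form_sheaf_add_closed[OF \<alpha> \<alpha>2] U order_refl W12.additive_on_add[OF lw(1) lw2(1)] _ \<tau>])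
      fix W \<beta> \<sigma> assume W: "open W" "W \<subseteq> U" and \<beta>: "\<beta> \<in> differential_forms A 1 W" and \<sigma>: "\<sigma> \<in> carrier (sect F W)"
      have r: "res \<Omega>\<^sub>1 U W (\<lambda>V Xs x. \<alpha> V Xs x + \<alpha>' V Xs x) = (\<lambda>V Xs x. res \<Omega>\<^sub>1 U W \<alpha> V Xs x + res \<Omega>\<^sub>1 U W \<alpha>' V Xs x)"
        by (simp add: res_form_sheaf fun_eq_iff)
      show "left_wedge U \<alpha> W (p\<^sub>1 W \<beta> \<sigma>) \<oplus>\<^bsub>sect S\<^sub>2 W\<^esub> left_wedge U \<alpha>' W (p\<^sub>1 W \<beta> \<sigma>) =
          p\<^sub>2 W (wedge 1 1 (res \<Omega>\<^sub>1 U W (\<lambda>V Xs x. \<alpha> V Xs x + \<alpha>' V Xs x)) \<beta>) \<sigma>"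
        unfolding r wedge_add_left lw(2)[OF W \<beta> \<sigma>] lw2(2)[OF W \<beta> \<sigma>]
        by (rule p2_add_left[OF W(1) wedge_closed[OF res_one_form[OF U W \<alpha>] \<beta>] \<sigma>
              wedge_closed[OF res_one_form[OF U W \<alpha>2] \<beta>], symmetric])
    qed
  qed
  show "left_wedge U (g \<odot>\<^bsub>sect \<Omega>\<^sub>1 U\<^esub> \<alpha>) U \<tau> = left_wedge U \<alpha> U (g \<odot>\<^bsub>sect S\<^sub>1 U\<^esub> \<tau>)" if "g \<in> A U" for g
    unfolding form_sheaf_simps by (rule left_wedge_smult(2)[OF U \<alpha> that \<tau>])
  show "left_wedge V (res \<Omega>\<^sub>1 U V \<alpha>) V (res S\<^sub>1 U V \<tau>) = res S\<^sub>2 U V (left_wedge U \<alpha> U \<tau>)" if V: "open V" "V \<subseteq> U" for V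
  proof -
    have rV: "res S\<^sub>1 U V \<tau> \<in> carrier (sect S\<^sub>1 V)" using U V \<tau> by (rule W1.S.res_closed)
    \<comment> \<open>The map for the restricted form and the map for \<alpha> have the same values
      on pure tensors over subsets of V, since restricting \<alpha> in two steps is restricting it
      in one.\<close>
    have "left_wedge V (res \<Omega>\<^sub>1 U V \<alpha>) V (res S\<^sub>1 U V \<tau>) = left_wedge U \<alpha> V (res S\<^sub>1 U V \<tau>)"
    proof (rule left_wedge_eqI[OF V(1) res_one_form[OF U V \<alpha>] V(1) order_refl additive_on_subset[OF lw(1) V(2)] _ rV])
      fix W \<beta> \<sigma> assume W: "open W" "W \<subseteq> V" and \<beta>: "\<beta> \<in> differential_forms A 1 W" and \<sigma>: "\<sigma> \<in> carrier (sect F W)"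
      have "W \<subseteq> U" using W V by blast
      have r: "res \<Omega>\<^sub>1 V W (res \<Omega>\<^sub>1 U V \<alpha>) = res \<Omega>\<^sub>1 U W \<alpha>" by (rule \<Omega>1.res_res[OF U V(1) W V(2) \<alpha>'])
      show "left_wedge U \<alpha> W (p\<^sub>1 W \<beta> \<sigma>) = p\<^sub>2 W (wedge 1 1 (res \<Omega>\<^sub>1 V W (res \<Omega>\<^sub>1 U V \<alpha>)) \<beta>) \<sigma>"
        unfolding r by (rule lw(2)[OF W(1) \<open>W \<subseteq> U\<close> \<beta> \<sigma>])
    qed
    also have "\<dots> = res S\<^sub>2 U V (left_wedge U \<alpha> U \<tau>)" using V by (rule D(3))
    finally show ?thesis .
  qed
qed

text \<open>Uniqueness is used twice: once to reduce to pure tensors of a form \<alpha> with a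
  section \<tau>, and then, with \<alpha> fixed, to reduce to \<tau> that are pure tensors
  themselves.\<close>

lemma wedge_morphism_unique:
  assumes \<phi>: "\<phi> \<in> additive_morphisms S\<^sub>1\<^sub>1 S\<^sub>2" and \<psi>: "\<psi> \<in> additive_morphisms S\<^sub>1\<^sub>1 S\<^sub>2"
    and eq: "\<And>U \<alpha> \<beta> \<sigma>. open U \<Longrightarrow> \<alpha> \<in> differential_forms A 1 U \<Longrightarrow> \<beta> \<in> differential_forms A 1 U \<Longrightarrow>
      \<sigma> \<in> carrier (sect F U) \<Longrightarrow> \<phi> U (p\<^sub>1\<^sub>1 U \<alpha> (p\<^sub>1 U \<beta> \<sigma>)) = \<psi> U (p\<^sub>1\<^sub>1 U \<alpha> (p\<^sub>1 U \<beta> \<sigma>))"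
  shows "\<phi> = \<psi>"
proof (rule W112.additive_morphisms_eqI[OF \<phi> \<psi>])
  note a\<phi> = additive_on_morphism[OF \<phi>] and a\<psi> = additive_on_morphism[OF \<psi>]
  fix U :: "'p set" and \<rho> assume U: "open U" and \<rho>: "\<rho> \<in> carrier (sect S\<^sub>1\<^sub>1 U)"
  show "\<phi> U \<rho> = \<psi> U \<rho>"
  proof (rule W11.tensor_eqI[OF W2.sheaf_S a\<phi> a\<psi> _ U subset_UNIV \<rho>])
    fix V :: "'p set" and \<alpha> \<tau> assume V: "open V" and \<alpha>: "\<alpha> \<in> carrier (sect \<Omega>\<^sub>1 V)" and \<tau>: "\<tau> \<in> carrier (sect S\<^sub>1 V)"
    note c = W11.additive_on_pure_tensor[OF V \<alpha>]
    \<comment> \<open>Writing \<alpha> as its own restriction to V matches the family of maps in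
      \<open>additive_on_pure_tensor\<close>.\<close>
    have "\<phi> V (p\<^sub>1\<^sub>1 V (res \<Omega>\<^sub>1 V V \<alpha>) \<tau>) = \<psi> V (p\<^sub>1\<^sub>1 V (res \<Omega>\<^sub>1 V V \<alpha>) \<tau>)"
    proof (rule W1.tensor_eqI[OF W2.sheaf_S
          additive_on_comp[OF c additive_on_subset[OF a\<phi> subset_UNIV]]
          additive_on_comp[OF c additive_on_subset[OF a\<psi> subset_UNIV]] _ V order_refl \<tau>])
      fix W \<beta> \<sigma> assume W: "open W" "W \<subseteq> V" and \<beta>: "\<beta> \<in> carrier (sect \<Omega>\<^sub>1 W)" and \<sigma>: "\<sigma> \<in> carrier (sect F W)"
      have "res \<Omega>\<^sub>1 V W \<alpha> \<in> carrier (sect \<Omega>\<^sub>1 W)" using V W \<alpha> by (rule \<Omega>1.res_closed)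
      then show "\<phi> W (p\<^sub>1\<^sub>1 W (res \<Omega>\<^sub>1 V W \<alpha>) (p\<^sub>1 W \<beta> \<sigma>)) = \<psi> W (p\<^sub>1\<^sub>1 W (res \<Omega>\<^sub>1 V W \<alpha>) (p\<^sub>1 W \<beta> \<sigma>))"
        using \<beta> unfolding form_sheaf_simps by (rule eq[OF W(1) _ _ \<sigma>])
    qed
    then show "\<phi> V (p\<^sub>1\<^sub>1 V \<alpha> \<tau>) = \<psi> V (p\<^sub>1\<^sub>1 V \<alpha> \<tau>)" unfolding \<Omega>1.res_id[OF V \<alpha>] .
  qed
qed

lemma wedge_morphism_exists:
  obtains \<phi> where "\<phi> \<in> linear_morphisms A S\<^sub>1\<^sub>1 S\<^sub>2"
    "\<forall>U. open U \<longrightarrow> (\<forall>\<alpha>\<in>differential_forms A 1 U. \<forall>\<beta>\<in>differential_forms A 1 U. \<forall>\<sigma>\<in>carrier (sect F U).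
      \<phi> U (p\<^sub>1\<^sub>1 U \<alpha> (p\<^sub>1 U \<beta> \<sigma>)) = p\<^sub>2 U (wedge 1 1 \<alpha> \<beta>) \<sigma>)"
proof -
  obtain \<psi> where \<psi>: "additive_on UNIV S\<^sub>1\<^sub>1 S\<^sub>2 \<psi>"
    "\<forall>U \<alpha> \<tau>. open U \<longrightarrow> U \<subseteq> UNIV \<longrightarrow> \<alpha> \<in> carrier (sect \<Omega>\<^sub>1 U) \<longrightarrow> \<tau> \<in> carrier (sect S\<^sub>1 U) \<longrightarrow>
      \<psi> U (p\<^sub>1\<^sub>1 U \<alpha> \<tau>) = left_wedge U \<alpha> U \<tau>"
    by (rule W11.tensor_lift_exists[OF W2.sheaf_S biadditive_on_left_wedge])
  have \<psi>v: "\<psi> U (p\<^sub>1\<^sub>1 U \<alpha> \<tau>) = left_wedge U \<alpha> U \<tau>"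
    if "open U" "\<alpha> \<in> differential_forms A 1 U" "\<tau> \<in> carrier (sect S\<^sub>1 U)" for U \<alpha> \<tau>
    using \<psi>(2) that unfolding form_sheaf_simps by blast
  \<comment> \<open>The lift is only known to be additive. Linearity is an equality of two additive
    maps, checked on pure tensors by means of the linearity of \<open>left_wedge\<close> in
    \<alpha>.\<close>
  have lin: "\<psi> U (g \<odot>\<^bsub>sect S\<^sub>1\<^sub>1 U\<^esub> \<rho>) = g \<odot>\<^bsub>sect S\<^sub>2 U\<^esub> \<psi> U \<rho>"
    if U: "open U" and g: "g \<in> A U" and \<rho>: "\<rho> \<in> carrier (sect S\<^sub>1\<^sub>1 U)" for U g \<rho>
  proof -
    note a = additive_on_subset[OF \<psi>(1) subset_UNIV[of U]]
    have "\<psi> U (cut U g \<odot>\<^bsub>sect S\<^sub>1\<^sub>1 U\<^esub> \<rho>) = cut U g \<odot>\<^bsub>sect S\<^sub>2 U\<^esub> \<psi> U \<rho>"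
    proof (rule W11.tensor_eqI[OF W2.sheaf_S W112.additive_on_smult_arg[OF a U g]
          W112.additive_on_smult[OF a U g] _ U order_refl \<rho>])
      fix V \<alpha> \<tau> assume V: "open V" "V \<subseteq> U" and \<alpha>': "\<alpha> \<in> carrier (sect \<Omega>\<^sub>1 V)" and \<tau>: "\<tau> \<in> carrier (sect S\<^sub>1 V)"
      have \<alpha>: "\<alpha> \<in> differential_forms A 1 V" using \<alpha>' unfolding form_sheaf_simps .
      have cg: "cut V g \<in> A V" using U V g by (rule cut_closed)
      have "cut V g \<odot>\<^bsub>sect S\<^sub>1\<^sub>1 V\<^esub> p\<^sub>1\<^sub>1 V \<alpha> \<tau> = p\<^sub>1\<^sub>1 V (\<lambda>W Xs x. cut W (cut V g) x * \<alpha> W Xs x) \<tau>"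
        using W11.pure_tensor_smult[OF V(1) cg \<alpha>' \<tau>] unfolding form_sheaf_simps ..
      then show "\<psi> V (cut V g \<odot>\<^bsub>sect S\<^sub>1\<^sub>1 V\<^esub> p\<^sub>1\<^sub>1 V \<alpha> \<tau>) = cut V g \<odot>\<^bsub>sect S\<^sub>2 V\<^esub> \<psi> V (p\<^sub>1\<^sub>1 V \<alpha> \<tau>)"
        by (simp only: \<psi>v[OF V(1) form_sheaf_smult_closed[OF V(1) cg \<alpha>] \<tau>] \<psi>v[OF V(1) \<alpha> \<tau>]
            left_wedge_smult(1)[OF V(1) \<alpha> cg \<tau>])
    qed
    then show ?thesis unfolding cut_self[OF U g] .
  qed
  define \<phi> where "\<phi> = (\<lambda>U. restrict (\<psi> U) (if open U then carrier (sect S\<^sub>1\<^sub>1 U) else {}))"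
  have \<phi>: "\<phi> U \<rho> = \<psi> U \<rho>" if "open U" "\<rho> \<in> carrier (sect S\<^sub>1\<^sub>1 U)" for U \<rho>
    using that by (simp add: \<phi>_def)
  show ?thesis
  proof (rule that)
    show "\<phi> \<in> linear_morphisms A S\<^sub>1\<^sub>1 S\<^sub>2"
      unfolding linear_morphisms_def mem_Collect_eq
    proof (intro conjI allI impI ballI)
      show "\<phi> \<in> additive_morphisms S\<^sub>1\<^sub>1 S\<^sub>2" unfolding \<phi>_def by (rule W112.additive_on_restrict[OF \<psi>(1)])
      fix U g \<rho> assume U: "open U" and g: "g \<in> A U" and \<rho>: "\<rho> \<in> carrier (sect S\<^sub>1\<^sub>1 U)"
      show "\<phi> U (g \<odot>\<^bsub>sect S\<^sub>1\<^sub>1 U\<^esub> \<rho>) = g \<odot>\<^bsub>sect S\<^sub>2 U\<^esub> \<phi> U \<rho>"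
        unfolding \<phi>[OF U \<rho>] \<phi>[OF U W11.S.sect_smult_closed[OF U g \<rho>]] by (rule lin[OF U g \<rho>])
    qed
    show "\<forall>U. open U \<longrightarrow> (\<forall>\<alpha>\<in>differential_forms A 1 U. \<forall>\<beta>\<in>differential_forms A 1 U. \<forall>\<sigma>\<in>carrier (sect F U).
        \<phi> U (p\<^sub>1\<^sub>1 U \<alpha> (p\<^sub>1 U \<beta> \<sigma>)) = p\<^sub>2 U (wedge 1 1 \<alpha> \<beta>) \<sigma>)"
    proof (intro allI impI ballI)
      fix U :: "'p set" and \<alpha> \<beta> \<sigma>
      assume U: "open U" and \<alpha>: "\<alpha> \<in> differential_forms A 1 U" and \<beta>: "\<beta> \<in> differential_forms A 1 U"
        and \<sigma>: "\<sigma> \<in> carrier (sect F U)"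
      have c: "\<alpha> \<in> carrier (sect \<Omega>\<^sub>1 U)" "\<beta> \<in> carrier (sect \<Omega>\<^sub>1 U)" unfolding form_sheaf_simps by (rule \<alpha>, rule \<beta>)
      note p = W1.pure_tensor_closed[OF U c(2) \<sigma>]
      show "\<phi> U (p\<^sub>1\<^sub>1 U \<alpha> (p\<^sub>1 U \<beta> \<sigma>)) = p\<^sub>2 U (wedge 1 1 \<alpha> \<beta>) \<sigma>"
        unfolding \<phi>[OF U W11.pure_tensor_closed[OF U c(1) p]] \<psi>v[OF U \<alpha> p]
          left_wedge(2)[OF U \<alpha> U order_refl \<beta> \<sigma>] \<Omega>1.res_id[OF U c(1)] ..
    qed
  qed
qed

lemma wedge_morphism:
  shows "wedge_morphism A F 1 \<in> linear_morphisms A S\<^sub>1\<^sub>1 S\<^sub>2"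
    and "\<And>U \<alpha> \<beta> \<sigma>. open U \<Longrightarrow> \<alpha> \<in> differential_forms A 1 U \<Longrightarrow> \<beta> \<in> differential_forms A 1 U \<Longrightarrow>
      \<sigma> \<in> carrier (sect F U) \<Longrightarrow> wedge_morphism A F 1 U (p\<^sub>1\<^sub>1 U \<alpha> (p\<^sub>1 U \<beta> \<sigma>)) = p\<^sub>2 U (wedge 1 1 \<alpha> \<beta>) \<sigma>"
proof -
  let ?Q = "\<lambda>\<phi>. \<phi> \<in> linear_morphisms A S\<^sub>1\<^sub>1 S\<^sub>2 \<and>
    (\<forall>U. open U \<longrightarrow> (\<forall>\<alpha>\<in>differential_forms A 1 U. \<forall>\<beta>\<in>differential_forms A 1 U. \<forall>\<sigma>\<in>carrier (sect F U).
      \<phi> U (p\<^sub>1\<^sub>1 U \<alpha> (p\<^sub>1 U \<beta> \<sigma>)) = p\<^sub>2 U (wedge 1 1 \<alpha> \<beta>) \<sigma>))"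
  obtain \<phi> where \<phi>: "?Q \<phi>" using wedge_morphism_exists by metis
  have "\<psi> = \<phi>" if \<psi>: "?Q \<psi>" for \<psi>
    by (rule wedge_morphism_unique) (use \<phi> \<psi> in \<open>simp_all add: linear_morphisms_def\<close>)
  with \<phi> have "?Q (THE \<phi>. ?Q \<phi>)" by (rule theI)
  then have Q: "?Q (wedge_morphism A F 1)"
    unfolding wedge_morphism_def forms_with_values_def Suc_1 .
  from Q show "wedge_morphism A F 1 \<in> linear_morphisms A S\<^sub>1\<^sub>1 S\<^sub>2" ..
  from Q show "\<And>U \<alpha> \<beta> \<sigma>. open U \<Longrightarrow> \<alpha> \<in> differential_forms A 1 U \<Longrightarrow> \<beta> \<in> differential_forms A 1 U \<Longrightarrow>
      \<sigma> \<in> carrier (sect F U) \<Longrightarrow> wedge_morphism A F 1 U (p\<^sub>1\<^sub>1 U \<alpha> (p\<^sub>1 U \<beta> \<sigma>)) = p\<^sub>2 U (wedge 1 1 \<alpha> \<beta>) \<sigma>"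
    by blast
qed

end

section \<open>Curvature\<close>

context valued_forms begin

abbreviation "ws \<equiv> wedge_section A F 1"

lemma wedge_section_rules:
  assumes U: "open U" and \<alpha>: "\<alpha> \<in> differential_forms A 1 U" and \<tau>: "\<tau> \<in> carrier (sect S\<^sub>1 U)"
  shows wedge_section_closed: "ws U \<alpha> \<tau> \<in> carrier (sect S\<^sub>2 U)"
    and wedge_section_add_left: "\<alpha>' \<in> differential_forms A 1 U \<Longrightarrow>
      ws U (\<lambda>V Xs x. \<alpha> V Xs x + \<alpha>' V Xs x) \<tau> = ws U \<alpha> \<tau> \<oplus>\<^bsub>sect S\<^sub>2 U\<^esub> ws U \<alpha>' \<tau>"
    and wedge_section_add_right: "\<tau>' \<in> carrier (sect S\<^sub>1 U) \<Longrightarrow>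
      ws U \<alpha> (\<tau> \<oplus>\<^bsub>sect S\<^sub>1 U\<^esub> \<tau>') = ws U \<alpha> \<tau> \<oplus>\<^bsub>sect S\<^sub>2 U\<^esub> ws U \<alpha> \<tau>'"
    and wedge_section_balanced: "g \<in> A U \<Longrightarrow>
      ws U (\<lambda>V Xs x. cut V g x * \<alpha> V Xs x) \<tau> = ws U \<alpha> (g \<odot>\<^bsub>sect S\<^sub>1 U\<^esub> \<tau>)"
    and wedge_section_res: "open V \<Longrightarrow> V \<subseteq> U \<Longrightarrow>
      ws V (res \<Omega>\<^sub>1 U V \<alpha>) (res S\<^sub>1 U V \<tau>) = res S\<^sub>2 U V (ws U \<alpha> \<tau>)"
proof -
  have \<alpha>': "\<alpha> \<in> carrier (sect \<Omega>\<^sub>1 U)" unfolding form_sheaf_simps by (rule \<alpha>)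
  have "wedge_morphism A F 1 \<in> additive_morphisms S\<^sub>1\<^sub>1 S\<^sub>2"
    using wedge_morphism(1) by (simp add: linear_morphisms_def)
  note D = additive_onD[OF additive_on_morphism[OF this] U subset_UNIV W11.pure_tensor_closed[OF U \<alpha>' \<tau>]]
  have ws: "ws V \<gamma> \<rho> = wedge_morphism A F 1 V (p\<^sub>1\<^sub>1 V \<gamma> \<rho>)" for V \<gamma> \<rho>
    by (simp only: wedge_section_def forms_with_values_def)
  show "ws U \<alpha> \<tau> \<in> carrier (sect S\<^sub>2 U)" unfolding ws by (rule D(1))
  show "ws U (\<lambda>V Xs x. \<alpha> V Xs x + \<alpha>' V Xs x) \<tau> = ws U \<alpha> \<tau> \<oplus>\<^bsub>sect S\<^sub>2 U\<^esub> ws U \<alpha>' \<tau>"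
    if "\<alpha>' \<in> differential_forms A 1 U" for \<alpha>'
  proof -
    have c: "\<alpha>' \<in> carrier (sect \<Omega>\<^sub>1 U)" unfolding form_sheaf_simps by (rule that)
    show ?thesis
      unfolding ws using W11.pure_tensor_add_left[OF U \<alpha>' c \<tau>] D(2)[OF W11.pure_tensor_closed[OF U c \<tau>]]
      unfolding form_sheaf_simps by simp
  qed
  show "ws U \<alpha> (\<tau> \<oplus>\<^bsub>sect S\<^sub>1 U\<^esub> \<tau>') = ws U \<alpha> \<tau> \<oplus>\<^bsub>sect S\<^sub>2 U\<^esub> ws U \<alpha> \<tau>'" if "\<tau>' \<in> carrier (sect S\<^sub>1 U)" for \<tau>'
    unfolding ws W11.pure_tensor_add_right[OF U \<alpha>' \<tau> that] by (rule D(2)[OF W11.pure_tensor_closed[OF U \<alpha>' that]])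
  show "ws U (\<lambda>V Xs x. cut V g x * \<alpha> V Xs x) \<tau> = ws U \<alpha> (g \<odot>\<^bsub>sect S\<^sub>1 U\<^esub> \<tau>)" if "g \<in> A U" for g
    unfolding ws using W11.pure_tensor_balanced[OF U that \<alpha>' \<tau>] unfolding form_sheaf_simps by simp
  show "ws V (res \<Omega>\<^sub>1 U V \<alpha>) (res S\<^sub>1 U V \<tau>) = res S\<^sub>2 U V (ws U \<alpha> \<tau>)" if V: "open V" "V \<subseteq> U" for V
    unfolding ws W11.pure_tensor_res[OF U V \<alpha>' \<tau>, symmetric] by (rule D(3)[OF V])
qed

lemma wedge_section_pure:
  assumes "open U" "\<alpha> \<in> differential_forms A 1 U" "\<beta> \<in> differential_forms A 1 U" "\<sigma> \<in> carrier (sect F U)"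
  shows "ws U \<alpha> (p\<^sub>1 U \<beta> \<sigma>) = p\<^sub>2 U (wedge 1 1 \<alpha> \<beta>) \<sigma>"
  using wedge_morphism(2)[OF assms] by (simp only: wedge_section_def forms_with_values_def)

text \<open>The extension of E carries its sign inside the wedge product, the extension of a
  connection outside; this moves one to the other.\<close>

lemma wedge_section_uminus:
  assumes U: "open U" and \<alpha>: "\<alpha> \<in> differential_forms A 1 U" and \<tau>: "\<tau> \<in> carrier (sect S\<^sub>1 U)"
  shows "ws U \<alpha> (\<ominus>\<^bsub>sect S\<^sub>1 U\<^esub> \<tau>) = \<ominus>\<^bsub>sect S\<^sub>2 U\<^esub> ws U \<alpha> \<tau>"
proof -
  interpret S1: abelian_group "sect S\<^sub>1 U" using U by (rule W1.S.sect_abelian_group)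
  interpret S2: abelian_group "sect S\<^sub>2 U" using U by (rule W2.S.sect_abelian_group)
  note c = wedge_section_closed[OF U \<alpha>]
  have 0: "ws U \<alpha> \<zero>\<^bsub>sect S\<^sub>1 U\<^esub> = \<zero>\<^bsub>sect S\<^sub>2 U\<^esub>"
    using wedge_section_add_right[OF U \<alpha> S1.zero_closed S1.zero_closed] c[OF S1.zero_closed]
    by (simp del: One_nat_def)
  have "ws U \<alpha> (\<ominus>\<^bsub>sect S\<^sub>1 U\<^esub> \<tau>) \<oplus>\<^bsub>sect S\<^sub>2 U\<^esub> ws U \<alpha> \<tau> = \<zero>\<^bsub>sect S\<^sub>2 U\<^esub>"
    using wedge_section_add_right[OF U \<alpha> S1.a_inv_closed[OF \<tau>] \<tau>] \<tau>
    by (simp add: S1.l_neg 0 del: One_nat_def)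
  then show ?thesis using c[OF \<tau>] c[OF S1.a_inv_closed[OF \<tau>]] by (intro S2.minus_equality[symmetric])
qed

lemma forms_with_values_1: "forms_with_values A 1 F = S\<^sub>1"
  and forms_with_values_2: "forms_with_values A 2 F = S\<^sub>2"
  by (simp_all only: forms_with_values_def)

lemma connectionD:
  assumes "connection A F D"
  shows "D \<in> additive_morphisms F S\<^sub>1"
    and "open U \<Longrightarrow> g \<in> A U \<Longrightarrow> \<sigma> \<in> carrier (sect F U) \<Longrightarrow> D U (g \<odot>\<^bsub>sect F U\<^esub> \<sigma>) =
      p\<^sub>1 U (ext_deriv A (function_form U g)) \<sigma> \<oplus>\<^bsub>sect S\<^sub>1 U\<^esub> g \<odot>\<^bsub>sect S\<^sub>1 U\<^esub> D U \<sigma>"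
  using assms unfolding connection_def forms_with_values_1 by blast+

text \<open>Additivity and naturality are inherited from the two summands. For the balance condition
  each summand has a defect; both defects are the wedge product of \<beta> and dg tensored with
  \<sigma>, and they cancel in the difference.\<close>

lemma biadditive_on_connection:
  assumes D: "connection A F D"
  shows "biadditive_on A UNIV \<Omega>\<^sub>1 F S\<^sub>2
    (\<lambda>U \<beta> \<sigma>. p\<^sub>2 U (ext_deriv A \<beta>) \<sigma> \<oplus>\<^bsub>sect S\<^sub>2 U\<^esub> \<ominus>\<^bsub>sect S\<^sub>2 U\<^esub> ws U \<beta> (D U \<sigma>))"
  unfolding biadditive_on_def
proof (intro allI impI ballI conjI)
  note aD = additive_on_morphism[OF connectionD(1)[OF D]]
  fix U :: "'p set" and \<beta> \<sigma> assume U: "open U" and \<beta>': "\<beta> \<in> carrier (sect \<Omega>\<^sub>1 U)" and \<sigma>: "\<sigma> \<in> carrier (sect F U)"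
  interpret S1: abelian_group "sect S\<^sub>1 U" using U by (rule W1.S.sect_abelian_group)
  interpret S2: abelian_group "sect S\<^sub>2 U" using U by (rule W2.S.sect_abelian_group)
  have \<beta>: "\<beta> \<in> differential_forms A 1 U" using \<beta>' unfolding form_sheaf_simps .
  note d\<beta> = ext_deriv_closed[OF \<beta>]
  have d\<beta>': "ext_deriv A \<beta> \<in> carrier (sect \<Omega>\<^sub>2 U)" unfolding form_sheaf_simps by (rule d\<beta>)
  note DU = additive_onD[OF aD U subset_UNIV \<sigma>]
  note c1 = p2_closed[OF U d\<beta> \<sigma>] and c2 = wedge_section_closed[OF U \<beta> DU(1)]
  show "p\<^sub>2 U (ext_deriv A \<beta>) \<sigma> \<oplus>\<^bsub>sect S\<^sub>2 U\<^esub> \<ominus>\<^bsub>sect S\<^sub>2 U\<^esub> ws U \<beta> (D U \<sigma>) \<in> carrier (sect S\<^sub>2 U)"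
    using c1 c2 by simp
  show "p\<^sub>2 U (ext_deriv A (\<beta> \<oplus>\<^bsub>sect \<Omega>\<^sub>1 U\<^esub> \<gamma>)) \<sigma> \<oplus>\<^bsub>sect S\<^sub>2 U\<^esub>
        \<ominus>\<^bsub>sect S\<^sub>2 U\<^esub> ws U (\<beta> \<oplus>\<^bsub>sect \<Omega>\<^sub>1 U\<^esub> \<gamma>) (D U \<sigma>) =
      p\<^sub>2 U (ext_deriv A \<beta>) \<sigma> \<oplus>\<^bsub>sect S\<^sub>2 U\<^esub> \<ominus>\<^bsub>sect S\<^sub>2 U\<^esub> ws U \<beta> (D U \<sigma>) \<oplus>\<^bsub>sect S\<^sub>2 U\<^esub>
        (p\<^sub>2 U (ext_deriv A \<gamma>) \<sigma> \<oplus>\<^bsub>sect S\<^sub>2 U\<^esub> \<ominus>\<^bsub>sect S\<^sub>2 U\<^esub> ws U \<gamma> (D U \<sigma>))"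
    if "\<gamma> \<in> carrier (sect \<Omega>\<^sub>1 U)" for \<gamma>
  proof -
    have \<gamma>: "\<gamma> \<in> differential_forms A 1 U" using that unfolding form_sheaf_simps .
    note c3 = p2_closed[OF U ext_deriv_closed[OF \<gamma>] \<sigma>] and c4 = wedge_section_closed[OF U \<gamma> DU(1)]
    show ?thesis
      unfolding form_sheaf_simps ext_deriv_add[OF \<beta> \<gamma>] p2_add_left[OF U d\<beta> \<sigma> ext_deriv_closed[OF \<gamma>]]
        wedge_section_add_left[OF U \<beta> DU(1) \<gamma>]
      using c1 c2 c3 c4 by (simp add: S2.minus_add S2.a_ac)
  qed
  show "p\<^sub>2 U (ext_deriv A \<beta>) (\<sigma> \<oplus>\<^bsub>sect F U\<^esub> \<sigma>') \<oplus>\<^bsub>sect S\<^sub>2 U\<^esub>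
        \<ominus>\<^bsub>sect S\<^sub>2 U\<^esub> ws U \<beta> (D U (\<sigma> \<oplus>\<^bsub>sect F U\<^esub> \<sigma>')) =
      p\<^sub>2 U (ext_deriv A \<beta>) \<sigma> \<oplus>\<^bsub>sect S\<^sub>2 U\<^esub> \<ominus>\<^bsub>sect S\<^sub>2 U\<^esub> ws U \<beta> (D U \<sigma>) \<oplus>\<^bsub>sect S\<^sub>2 U\<^esub>
        (p\<^sub>2 U (ext_deriv A \<beta>) \<sigma>' \<oplus>\<^bsub>sect S\<^sub>2 U\<^esub> \<ominus>\<^bsub>sect S\<^sub>2 U\<^esub> ws U \<beta> (D U \<sigma>'))"
    if \<sigma>': "\<sigma>' \<in> carrier (sect F U)" for \<sigma>'
  proof -
    note DU' = additive_onD(1)[OF aD U subset_UNIV \<sigma>']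
    note c3 = p2_closed[OF U d\<beta> \<sigma>'] and c4 = wedge_section_closed[OF U \<beta> DU']
    show ?thesis
      unfolding W2.pure_tensor_add_right[OF U d\<beta>' \<sigma> \<sigma>'] DU(2)[OF \<sigma>'] wedge_section_add_right[OF U \<beta> DU(1) DU']
      using c1 c2 c3 c4 by (simp add: S2.minus_add S2.a_ac)
  qed
  show "p\<^sub>2 U (ext_deriv A (g \<odot>\<^bsub>sect \<Omega>\<^sub>1 U\<^esub> \<beta>)) \<sigma> \<oplus>\<^bsub>sect S\<^sub>2 U\<^esub>
        \<ominus>\<^bsub>sect S\<^sub>2 U\<^esub> ws U (g \<odot>\<^bsub>sect \<Omega>\<^sub>1 U\<^esub> \<beta>) (D U \<sigma>) =
      p\<^sub>2 U (ext_deriv A \<beta>) (g \<odot>\<^bsub>sect F U\<^esub> \<sigma>) \<oplus>\<^bsub>sect S\<^sub>2 U\<^esub> \<ominus>\<^bsub>sect S\<^sub>2 U\<^esub> ws U \<beta> (D U (g \<odot>\<^bsub>sect F U\<^esub> \<sigma>))"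
    if g: "g \<in> A U" for g
  proof -
    note g\<beta> = form_sheaf_smult_closed[OF U g \<beta>] and dg = ext_deriv_function_form_closed[OF U g]
    have dg': "ext_deriv A (function_form U g) \<in> carrier (sect \<Omega>\<^sub>1 U)" unfolding form_sheaf_simps by (rule dg)
    let ?a = "p\<^sub>2 U (ext_deriv A (\<lambda>V Xs x. cut V g x * \<beta> V Xs x)) \<sigma>"
    let ?c = "p\<^sub>2 U (wedge 1 1 \<beta> (ext_deriv A (function_form U g))) \<sigma>"
    let ?e = "ws U \<beta> (g \<odot>\<^bsub>sect S\<^sub>1 U\<^esub> D U \<sigma>)"
    note gD = W1.S.sect_smult_closed[OF U g DU(1)]
    have 1: "p\<^sub>2 U (ext_deriv A \<beta>) (g \<odot>\<^bsub>sect F U\<^esub> \<sigma>) = ?a \<oplus>\<^bsub>sect S\<^sub>2 U\<^esub> ?c"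
      unfolding p2_balanced[OF U d\<beta> \<sigma> g, symmetric] ext_deriv_smult[OF U g \<beta>, symmetric]
      by (rule p2_add_left[OF U ext_deriv_closed[OF g\<beta>] \<sigma> wedge_closed[OF \<beta> dg]])
    have 2: "ws U \<beta> (D U (g \<odot>\<^bsub>sect F U\<^esub> \<sigma>)) = ?c \<oplus>\<^bsub>sect S\<^sub>2 U\<^esub> ?e"
      unfolding connectionD(2)[OF D U g \<sigma>] wedge_section_add_right[OF U \<beta> W1.pure_tensor_closed[OF U dg' \<sigma>] gD]
        wedge_section_pure[OF U \<beta> dg \<sigma>] ..
    have c: "?a \<in> carrier (sect S\<^sub>2 U)" "?c \<in> carrier (sect S\<^sub>2 U)" "?e \<in> carrier (sect S\<^sub>2 U)"
      by (rule p2_closed[OF U ext_deriv_closed[OF g\<beta>] \<sigma>], rule p2_closed[OF U wedge_closed[OF \<beta> dg] \<sigma>],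
          rule wedge_section_closed[OF U \<beta> gD])
    have "?a \<oplus>\<^bsub>sect S\<^sub>2 U\<^esub> ?c \<oplus>\<^bsub>sect S\<^sub>2 U\<^esub> \<ominus>\<^bsub>sect S\<^sub>2 U\<^esub> (?c \<oplus>\<^bsub>sect S\<^sub>2 U\<^esub> ?e) =
        ?a \<oplus>\<^bsub>sect S\<^sub>2 U\<^esub> \<ominus>\<^bsub>sect S\<^sub>2 U\<^esub> ?e"
      using c by (simp only: S2.minus_add S2.a_assoc S2.r_neg2 S2.a_closed S2.a_inv_closed)
    then show ?thesis
      unfolding form_sheaf_simps 1 2 wedge_section_balanced[OF U \<beta> DU(1) g] ..
  qed
  show "p\<^sub>2 V (ext_deriv A (res \<Omega>\<^sub>1 U V \<beta>)) (res F U V \<sigma>) \<oplus>\<^bsub>sect S\<^sub>2 V\<^esub>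
        \<ominus>\<^bsub>sect S\<^sub>2 V\<^esub> ws V (res \<Omega>\<^sub>1 U V \<beta>) (D V (res F U V \<sigma>)) =
      res S\<^sub>2 U V (p\<^sub>2 U (ext_deriv A \<beta>) \<sigma> \<oplus>\<^bsub>sect S\<^sub>2 U\<^esub> \<ominus>\<^bsub>sect S\<^sub>2 U\<^esub> ws U \<beta> (D U \<sigma>))"
    if V: "open V" "V \<subseteq> U" for V
    unfolding ext_deriv_res[OF U V \<beta>] W2.pure_tensor_res[OF U V d\<beta>' \<sigma>, symmetric] DU(3)[OF V]
      wedge_section_res[OF U \<beta> DU(1) V] W2.S.res_uminus[OF U V c2, symmetric]
    using W2.S.res_add[OF U V c1 S2.a_inv_closed[OF c2]] by simp
qed

text \<open>Linearity of E gives the balance condition directly: the scalar comes out of E, commutes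
  with the sign and crosses into the left factor.\<close>

lemma biadditive_on_endomorphism:
  assumes E: "E \<in> linear_morphisms A F S\<^sub>1"
  shows "biadditive_on A UNIV \<Omega>\<^sub>1 F S\<^sub>2 (\<lambda>U \<alpha> \<sigma>. ws U \<alpha> (\<ominus>\<^bsub>sect S\<^sub>1 U\<^esub> E U \<sigma>))"
  unfolding biadditive_on_def
proof (intro allI impI ballI conjI)
  have aE: "additive_on UNIV F S\<^sub>1 E" using E by (intro additive_on_morphism) (simp add: linear_morphisms_def)
  fix U :: "'p set" and \<alpha> \<sigma> assume U: "open U" and \<alpha>': "\<alpha> \<in> carrier (sect \<Omega>\<^sub>1 U)" and \<sigma>: "\<sigma> \<in> carrier (sect F U)"
  interpret S1: module "function_ring A U" "sect S\<^sub>1 U" using U by (rule W1.S.sect_module)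
  have \<alpha>: "\<alpha> \<in> differential_forms A 1 U" using \<alpha>' unfolding form_sheaf_simps .
  note EU = additive_onD[OF aE U subset_UNIV \<sigma>] and mE = S1.a_inv_closed[OF additive_onD(1)[OF aE U subset_UNIV \<sigma>]]
  show "ws U \<alpha> (\<ominus>\<^bsub>sect S\<^sub>1 U\<^esub> E U \<sigma>) \<in> carrier (sect S\<^sub>2 U)" by (rule wedge_section_closed[OF U \<alpha> mE])
  show "ws U (\<alpha> \<oplus>\<^bsub>sect \<Omega>\<^sub>1 U\<^esub> \<beta>) (\<ominus>\<^bsub>sect S\<^sub>1 U\<^esub> E U \<sigma>) =
      ws U \<alpha> (\<ominus>\<^bsub>sect S\<^sub>1 U\<^esub> E U \<sigma>) \<oplus>\<^bsub>sect S\<^sub>2 U\<^esub> ws U \<beta> (\<ominus>\<^bsub>sect S\<^sub>1 U\<^esub> E U \<sigma>)" if "\<beta> \<in> carrier (sect \<Omega>\<^sub>1 U)" for \<beta>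
    using wedge_section_add_left[OF U \<alpha> mE] that unfolding form_sheaf_simps by blast
  show "ws U \<alpha> (\<ominus>\<^bsub>sect S\<^sub>1 U\<^esub> E U (\<sigma> \<oplus>\<^bsub>sect F U\<^esub> \<sigma>')) =
      ws U \<alpha> (\<ominus>\<^bsub>sect S\<^sub>1 U\<^esub> E U \<sigma>) \<oplus>\<^bsub>sect S\<^sub>2 U\<^esub> ws U \<alpha> (\<ominus>\<^bsub>sect S\<^sub>1 U\<^esub> E U \<sigma>')"
    if \<sigma>': "\<sigma>' \<in> carrier (sect F U)" for \<sigma>'
    using additive_onD(1)[OF aE U subset_UNIV \<sigma>'] EU(1)
    by (simp only: EU(2)[OF \<sigma>'] S1.minus_add wedge_section_add_right[OF U \<alpha>] S1.a_inv_closed)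
  show "ws U (g \<odot>\<^bsub>sect \<Omega>\<^sub>1 U\<^esub> \<alpha>) (\<ominus>\<^bsub>sect S\<^sub>1 U\<^esub> E U \<sigma>) = ws U \<alpha> (\<ominus>\<^bsub>sect S\<^sub>1 U\<^esub> E U (g \<odot>\<^bsub>sect F U\<^esub> \<sigma>))" if g: "g \<in> A U" for g
  proof -
    have "E U (g \<odot>\<^bsub>sect F U\<^esub> \<sigma>) = g \<odot>\<^bsub>sect S\<^sub>1 U\<^esub> E U \<sigma>" using E U g \<sigma> by (simp add: linear_morphisms_def)
    moreover have "\<ominus>\<^bsub>sect S\<^sub>1 U\<^esub> (g \<odot>\<^bsub>sect S\<^sub>1 U\<^esub> E U \<sigma>) = g \<odot>\<^bsub>sect S\<^sub>1 U\<^esub> (\<ominus>\<^bsub>sect S\<^sub>1 U\<^esub> E U \<sigma>)"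
      using S1.smult_r_minus[of g "E U \<sigma>"] g EU(1) by simp
    ultimately show ?thesis
      unfolding form_sheaf_simps wedge_section_balanced[OF U \<alpha> mE g] by simp
  qed
  show "ws V (res \<Omega>\<^sub>1 U V \<alpha>) (\<ominus>\<^bsub>sect S\<^sub>1 V\<^esub> E V (res F U V \<sigma>)) = res S\<^sub>2 U V (ws U \<alpha> (\<ominus>\<^bsub>sect S\<^sub>1 U\<^esub> E U \<sigma>))"
    if V: "open V" "V \<subseteq> U" for V
    unfolding EU(3)[OF V] W1.S.res_uminus[OF U V EU(1), symmetric] by (rule wedge_section_res[OF U \<alpha> mE V])
qed

lemma connection_extension:
  assumes D: "connection A F D"
  shows "connection_extension A F D 1 \<in> additive_morphisms S\<^sub>1 S\<^sub>2"
    and "open U \<Longrightarrow> \<beta> \<in> differential_forms A 1 U \<Longrightarrow> \<sigma> \<in> carrier (sect F U) \<Longrightarrow>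
      connection_extension A F D 1 U (p\<^sub>1 U \<beta> \<sigma>) =
        p\<^sub>2 U (ext_deriv A \<beta>) \<sigma> \<oplus>\<^bsub>sect S\<^sub>2 U\<^esub> \<ominus>\<^bsub>sect S\<^sub>2 U\<^esub> ws U \<beta> (D U \<sigma>)"
proof -
  \<comment> \<open>The prescription exactly as in the definition, so that the extension unfolds to
    a lift of b; on sections it equals the version with a group inverse.\<close>
  define b where "b = (\<lambda>U \<beta> \<sigma>. p\<^sub>2 U (ext_deriv A \<beta>) \<sigma> \<oplus>\<^bsub>sect S\<^sub>2 U\<^esub> add_pow (sect S\<^sub>2 U) ((-1::int) ^ 1) (ws U \<beta> (D U \<sigma>)))"
  have eq: "b U \<beta> \<sigma> = p\<^sub>2 U (ext_deriv A \<beta>) \<sigma> \<oplus>\<^bsub>sect S\<^sub>2 U\<^esub> \<ominus>\<^bsub>sect S\<^sub>2 U\<^esub> ws U \<beta> (D U \<sigma>)"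
    if "open U" "\<beta> \<in> differential_forms A 1 U" "\<sigma> \<in> carrier (sect F U)" for U \<beta> \<sigma>
    unfolding b_def power_one_right
    by (subst add_pow_minus_one[OF W2.S.sect_abelian_group[OF that(1)] wedge_section_closed[OF that(1,2)]])
       (use additive_onD(1)[OF additive_on_morphism[OF connectionD(1)[OF D]] that(1) _ that(3)] in simp_all)
  have "biadditive_on A UNIV \<Omega>\<^sub>1 F S\<^sub>2 b"
    by (rule biadditive_on_cong[OF biadditive_on_connection[OF D] \<Omega>1.presheaf F.presheaf])
       (simp_all only: form_sheaf_simps eq function_presheaf_axioms)
  note L = W1.tensor_lift[OF W2.sheaf_S this]
  have ext: "connection_extension A F D 1 = tensor_lift A \<Omega>\<^sub>1 F S\<^sub>2 b"
    unfolding connection_extension_def b_def forms_with_values_def Suc_1 ..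
  show "connection_extension A F D 1 \<in> additive_morphisms S\<^sub>1 S\<^sub>2" unfolding ext by (rule L(1))
  show "connection_extension A F D 1 U (p\<^sub>1 U \<beta> \<sigma>) =
      p\<^sub>2 U (ext_deriv A \<beta>) \<sigma> \<oplus>\<^bsub>sect S\<^sub>2 U\<^esub> \<ominus>\<^bsub>sect S\<^sub>2 U\<^esub> ws U \<beta> (D U \<sigma>)"
    if "open U" "\<beta> \<in> differential_forms A 1 U" "\<sigma> \<in> carrier (sect F U)"
    unfolding ext using L(2)[of U \<beta> \<sigma>] that eq[OF that] unfolding form_sheaf_simps by simp
qed

lemma endomorphism_extension:
  assumes E: "E \<in> linear_morphisms A F S\<^sub>1"
  shows "endomorphism_extension A F E 1 \<in> additive_morphisms S\<^sub>1 S\<^sub>2"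
    and "open U \<Longrightarrow> \<alpha> \<in> differential_forms A 1 U \<Longrightarrow> \<sigma> \<in> carrier (sect F U) \<Longrightarrow>
      endomorphism_extension A F E 1 U (p\<^sub>1 U \<alpha> \<sigma>) = ws U \<alpha> (\<ominus>\<^bsub>sect S\<^sub>1 U\<^esub> E U \<sigma>)"
proof -
  have aE: "additive_on UNIV F S\<^sub>1 E" using E by (intro additive_on_morphism) (simp add: linear_morphisms_def)
  define b where "b = (\<lambda>U \<alpha> \<sigma>. ws U \<alpha> (add_pow (sect S\<^sub>1 U) ((-1::int) ^ 1) (E U \<sigma>)))"
  have eq: "b U \<alpha> \<sigma> = ws U \<alpha> (\<ominus>\<^bsub>sect S\<^sub>1 U\<^esub> E U \<sigma>)"
    if "open U" "\<sigma> \<in> carrier (sect F U)" for U \<alpha> \<sigma>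
    unfolding b_def power_one_right
    by (subst add_pow_minus_one[OF W1.S.sect_abelian_group[OF that(1)] additive_onD(1)[OF aE that(1) subset_UNIV that(2)]])
       (rule refl)
  have "biadditive_on A UNIV \<Omega>\<^sub>1 F S\<^sub>2 b"
    by (rule biadditive_on_cong[OF biadditive_on_endomorphism[OF E] \<Omega>1.presheaf F.presheaf])
       (simp_all only: eq function_presheaf_axioms)
  note L = W1.tensor_lift[OF W2.sheaf_S this]
  have ext: "endomorphism_extension A F E 1 = tensor_lift A \<Omega>\<^sub>1 F S\<^sub>2 b"
    unfolding endomorphism_extension_def b_def forms_with_values_def Suc_1 ..
  show "endomorphism_extension A F E 1 \<in> additive_morphisms S\<^sub>1 S\<^sub>2" unfolding ext by (rule L(1))
  show "endomorphism_extension A F E 1 U (p\<^sub>1 U \<alpha> \<sigma>) = ws U \<alpha> (\<ominus>\<^bsub>sect S\<^sub>1 U\<^esub> E U \<sigma>)"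
    if "open U" "\<alpha> \<in> differential_forms A 1 U" "\<sigma> \<in> carrier (sect F U)"
    unfolding ext using L(2)[of U \<alpha> \<sigma>] that eq[OF that(1,3)] unfolding form_sheaf_simps by simp
qed

section \<open>Adding an endomorphism-valued 1-form to the connection\<close>

lemma hom_add_apply: "open U \<Longrightarrow> s \<in> carrier (sect F U) \<Longrightarrow>
    hom_add F H \<phi> \<psi> U s = \<phi> U s \<oplus>\<^bsub>sect H U\<^esub> \<psi> U s"
  by (simp add: hom_add_def)

text \<open>The term with dg in the Leibniz rule comes from D alone, as E is linear. Being a
  connection, the sum has an extension with known values on generators.\<close>

lemma connection_hom_add:
  assumes D: "connection A F D" and E: "E \<in> linear_morphisms A F S\<^sub>1"
  shows "connection A F (hom_add F S\<^sub>1 D E)"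
  unfolding connection_def forms_with_values_1
proof (intro conjI allI impI ballI)
  have aD: "additive_on UNIV F S\<^sub>1 D" by (rule additive_on_morphism[OF connectionD(1)[OF D]])
  have aE: "additive_on UNIV F S\<^sub>1 E" using E by (intro additive_on_morphism) (simp add: linear_morphisms_def)
  have "hom_add F S\<^sub>1 D E = (\<lambda>U. restrict (\<lambda>s. D U s \<oplus>\<^bsub>sect S\<^sub>1 U\<^esub> E U s) (if open U then carrier (sect F U) else {}))"
    by (rule ext) (simp only: hom_add_def)
  with W01.additive_on_restrict[OF W01.additive_on_add[OF aD aE]]
  show "hom_add F S\<^sub>1 D E \<in> additive_morphisms F S\<^sub>1" by simp
  fix U :: "'p set" and g \<sigma> assume U: "open U" and g: "g \<in> A U" and \<sigma>: "\<sigma> \<in> carrier (sect F U)"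
  interpret S1: module "function_ring A U" "sect S\<^sub>1 U" using U by (rule W1.S.sect_module)
  have dg: "ext_deriv A (function_form U g) \<in> carrier (sect \<Omega>\<^sub>1 U)"
    unfolding form_sheaf_simps by (rule ext_deriv_function_form_closed[OF U g])
  note p = W1.pure_tensor_closed[OF U dg \<sigma>]
  note c = additive_onD(1)[OF aD U subset_UNIV \<sigma>] additive_onD(1)[OF aE U subset_UNIV \<sigma>]
  have "E U (g \<odot>\<^bsub>sect F U\<^esub> \<sigma>) = g \<odot>\<^bsub>sect S\<^sub>1 U\<^esub> E U \<sigma>" using E U g \<sigma> by (simp add: linear_morphisms_def)
  then show "hom_add F S\<^sub>1 D E U (g \<odot>\<^bsub>sect F U\<^esub> \<sigma>) = p\<^sub>1 U (ext_deriv A (function_form U g)) \<sigma>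
      \<oplus>\<^bsub>sect S\<^sub>1 U\<^esub> g \<odot>\<^bsub>sect S\<^sub>1 U\<^esub> hom_add F S\<^sub>1 D E U \<sigma>"
    using c p g S1.smult_closed[of g]
    by (simp add: hom_add_apply[OF U \<sigma>] hom_add_apply[OF U F.sect_smult_closed[OF U g \<sigma>]]
        connectionD(2)[OF D U g \<sigma>] S1.smult_r_distr S1.a_assoc del: One_nat_def)
qed

text \<open>On a generator the sum of D and E enters through the wedge product, which is additive.
  The minus sign before the part with E is absorbed into its argument, which gives the value of the
  extension of E.\<close>

lemma connection_extension_hom_add:
  assumes D: "connection A F D" and E: "E \<in> linear_morphisms A F S\<^sub>1"
    and U: "open U" and \<tau>: "\<tau> \<in> carrier (sect S\<^sub>1 U)"
  shows "connection_extension A F (hom_add F S\<^sub>1 D E) 1 U \<tau> =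
    connection_extension A F D 1 U \<tau> \<oplus>\<^bsub>sect S\<^sub>2 U\<^esub> endomorphism_extension A F E 1 U \<tau>"
proof -
  note D' = connection_hom_add[OF D E]
  have aD: "additive_on UNIV F S\<^sub>1 D" by (rule additive_on_morphism[OF connectionD(1)[OF D]])
  have aE: "additive_on UNIV F S\<^sub>1 E" using E by (intro additive_on_morphism) (simp add: linear_morphisms_def)
  show ?thesis
  proof (rule W1.tensor_eqI[OF W2.sheaf_S additive_on_morphism[OF connection_extension(1)[OF D']]
        W12.additive_on_add[OF additive_on_morphism[OF connection_extension(1)[OF D]]
          additive_on_morphism[OF endomorphism_extension(1)[OF E]]] _ U subset_UNIV \<tau>])
    fix V :: "'p set" and \<beta> \<sigma> assume V: "open V" and \<beta>': "\<beta> \<in> carrier (sect \<Omega>\<^sub>1 V)" and \<sigma>: "\<sigma> \<in> carrier (sect F V)"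
    interpret S2: abelian_group "sect S\<^sub>2 V" using V by (rule W2.S.sect_abelian_group)
    have \<beta>: "\<beta> \<in> differential_forms A 1 V" using \<beta>' unfolding form_sheaf_simps .
    note c = additive_onD(1)[OF aD V subset_UNIV \<sigma>] additive_onD(1)[OF aE V subset_UNIV \<sigma>]
    note c' = p2_closed[OF V ext_deriv_closed[OF \<beta>] \<sigma>] wedge_section_closed[OF V \<beta> c(1)] wedge_section_closed[OF V \<beta> c(2)]
    show "connection_extension A F (hom_add F S\<^sub>1 D E) 1 V (p\<^sub>1 V \<beta> \<sigma>) =
        connection_extension A F D 1 V (p\<^sub>1 V \<beta> \<sigma>) \<oplus>\<^bsub>sect S\<^sub>2 V\<^esub> endomorphism_extension A F E 1 V (p\<^sub>1 V \<beta> \<sigma>)"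
      unfolding connection_extension(2)[OF D' V \<beta> \<sigma>] connection_extension(2)[OF D V \<beta> \<sigma>]
        endomorphism_extension(2)[OF E V \<beta> \<sigma>] hom_add_apply[OF V \<sigma>] wedge_section_add_right[OF V \<beta> c]
        wedge_section_uminus[OF V \<beta> c(2)] S2.minus_add[OF c'(2,3)]
      using c' by (simp only: S2.a_assoc S2.a_inv_closed S2.a_closed)
  qed
qed

text \<open>At a section s the extension of the sum splits in two, and each piece is additive on the
  sum of \<open>D U s\<close> and \<open>E U s\<close>. The four values obtained are those on the
  right up to order of bracketing, except that the middle two need no exchange.\<close>

lemma curvature_hom_add:
  assumes D: "connection A F D" and E: "E \<in> linear_morphisms A F S\<^sub>1"
  shows "curvature A F (hom_add F S\<^sub>1 D E) =
      hom_add F S\<^sub>2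
        (hom_add F S\<^sub>2
          (hom_add F S\<^sub>2
            (curvature A F D)
            (hom_comp F (connection_extension A F D 1) E))
          (hom_comp F (endomorphism_extension A F E 1) D))
        (hom_comp F (endomorphism_extension A F E 1) E)" (is "?l = ?r")
proof (rule ext, rule ext)
  fix U s
  have aD: "additive_on UNIV F S\<^sub>1 D" by (rule additive_on_morphism[OF connectionD(1)[OF D]])
  have aE: "additive_on UNIV F S\<^sub>1 E" using E by (intro additive_on_morphism) (simp add: linear_morphisms_def)
  show "?l U s = ?r U s"
  proof (cases "open U \<and> s \<in> carrier (sect F U)")
    case True
    then have U: "open U" and s: "s \<in> carrier (sect F U)" by auto
    interpret S2: abelian_group "sect S\<^sub>2 U" using U by (rule W2.S.sect_abelian_group)
    note c = additive_onD(1)[OF aD U subset_UNIV s] additive_onD(1)[OF aE U subset_UNIV s]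
    let ?L = "connection_extension A F D 1 U" and ?M = "endomorphism_extension A F E 1 U"
    note L = additive_onD[OF additive_on_morphism[OF connection_extension(1)[OF D]] U subset_UNIV]
    note M = additive_onD[OF additive_on_morphism[OF endomorphism_extension(1)[OF E]] U subset_UNIV]
    have comp: "hom_comp F \<psi> \<phi> U s = \<psi> U (\<phi> U s)" for \<phi> :: "'p set \<Rightarrow> 's \<Rightarrow> 'x" and \<psi> :: "'p set \<Rightarrow> 'x \<Rightarrow> 'y"
      using U s by (simp add: hom_comp_def compose_def)
    note S1c = W1.S.sect_add_closed[OF U c]
    have "?l U s = (?L (D U s) \<oplus>\<^bsub>sect S\<^sub>2 U\<^esub> ?L (E U s)) \<oplus>\<^bsub>sect S\<^sub>2 U\<^esub> (?M (D U s) \<oplus>\<^bsub>sect S\<^sub>2 U\<^esub> ?M (E U s))"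
      unfolding curvature_def comp hom_add_apply[OF U s] connection_extension_hom_add[OF D E U S1c]
        L(2)[OF c] M(2)[OF c] ..
    moreover have "?r U s = ?L (D U s) \<oplus>\<^bsub>sect S\<^sub>2 U\<^esub> ?L (E U s) \<oplus>\<^bsub>sect S\<^sub>2 U\<^esub> ?M (D U s) \<oplus>\<^bsub>sect S\<^sub>2 U\<^esub> ?M (E U s)"
      unfolding curvature_def hom_add_apply[OF U s] comp ..
    ultimately show ?thesis
      using L(1)[OF c(1)] L(1)[OF c(2)] M(1)[OF c(1)] M(1)[OF c(2)]
      by (simp only: S2.a_assoc S2.a_closed)
  next
    case False
    \<comment> \<open>Away from sections over open sets both sides are \<open>undefined\<close>,
      since \<open>hom_add\<close> and \<open>hom_comp\<close> are extensional.\<close>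
    then show ?thesis by (auto simp: curvature_def hom_comp_def hom_add_def compose_def)
  qed
qed

end

text \<open>The first conjunct accompanies the formula because \<open>curvature\<close> is a total
  function built on a definite description; its value has the intended meaning when the argument is
  a connection.\<close>

theorem proposition1:
  fixes \<A> :: "('p::{second_countable_topology, t2_space}, 'e::real_normed_vector) atlas"
    and A :: "'p set \<Rightarrow> ('p \<Rightarrow> 'k::real_normed_field) set"
    and F :: "('p, 'p \<Rightarrow> 'k, 's) module_presheaf"
  assumes "smooth_manifold \<A>"
    and "compact (UNIV :: 'p set)"
    and "connected (UNIV :: 'p set)"
    and "A = smooth_functions \<A>"
    and "sheaf_of_modules A F"
    and "coherent A F"
    and "connection A F D"
    and "E \<in> linear_morphisms A F (forms_with_values A 1 F)"
  shows "connection A F (hom_add F (forms_with_values A 1 F) D E) \<and>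
    curvature A F (hom_add F (forms_with_values A 1 F) D E) =
      hom_add F (forms_with_values A 2 F)
        (hom_add F (forms_with_values A 2 F)
          (hom_add F (forms_with_values A 2 F)
            (curvature A F D)
            (hom_comp F (connection_extension A F D 1) E))
          (hom_comp F (endomorphism_extension A F E 1) D))
        (hom_comp F (endomorphism_extension A F E 1) E)"
proof -
  have "function_presheaf A"
    unfolding assms(4) by (rule smooth_functions_function_presheaf[OF assms(1)])
  moreover have "presheaf_of_modules A F" using assms(5) by (simp add: sheaf_of_modules_def)
  \<comment> \<open>The locale asks for values in a field of characteristic 0, which every real
    normed field is.\<close>
  ultimately interpret valued_forms A F
    by (intro valued_forms.intro function_presheaf_char_0.intro module_presheaf_on.intro module_presheaf_on_axioms.intro)
  show ?thesis
    using connection_hom_add curvature_hom_add assms(7,8) unfolding forms_with_values_1 forms_with_values_2 by blast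
qed

end
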